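(* There exist two arrangements $\mathcal{L}_1,\mathcal{L}_2\subset\mathbb{P}^2_{\mathbb{C}}$ of $12$ lines having isomorphic intersection lattices and weak-combinatorics $(d;t_2,t_3,t_4)=(12;21,9,3)$ such that the minimal graded free resolutions of their Milnor algebras are different; that is, $\mathcal{L}_1,\mathcal{L}_2$ form a strong Ziegler pair.
   Context: The intersection lattice of a line arrangement is the set of nonempty intersections of subfamilies of its lines, ordered by reverse inclusion. The weak-combinatorics $(d;t_2,\dots,t_m)$ records the number $d$ of lines and the numbers $t_i$ of points where exactly $i$ lines meet. For an arrangement with defining polynomial $f\in S=\mathbb{C}[x,y,z]$ (product of its linear forms), the Milnor algebra is $M(f)=S/(\partial_xf,\partial_yf,\partial_zf)$, a graded $S$-module. A strong Ziegler pair is a pair of line arrangements with isomorphic intersection lattices whose Milnor algebras have different minimal graded free resolutions (i.e., different graded Betti numbers). *)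

theory Defs
  imports Complex_Main "HOL-Library.Poly_Mapping" "HOL-Library.Product_Plus"
begin

type_synonym vec3 = "complex \<times> complex \<times> complex"

definition smult3 :: "complex \<Rightarrow> vec3 \<Rightarrow> vec3" where
  "smult3 c v = (case v of (x, y, z) \<Rightarrow> (c * x, c * y, c * z))"

definition lin_eval :: "vec3 \<Rightarrow> vec3 \<Rightarrow> complex" where
  "lin_eval l v = (case l of (a, b, c) \<Rightarrow> case v of (x, y, z) \<Rightarrow> a * x + b * y + c * z)"

text \<open>The line V(l) in P^2, represented by its affine cone in C^3 (a plane through 0).\<close>
definition zero_set :: "vec3 \<Rightarrow> vec3 set" where
  "zero_set l = {v. lin_eval l v = 0}"

text \<open>The point [v] of P^2, represented by the line C v in C^3.\<close>
definition proj_pt :: "vec3 \<Rightarrow> vec3 set" where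
  "proj_pt v = {smult3 c v | c. True}"

definition proj_points :: "vec3 set set" where
  "proj_points = {proj_pt v | v. v \<noteq> 0}"

definition line_arrangement :: "vec3 set \<Rightarrow> bool" where
  "line_arrangement F \<longleftrightarrow> finite F \<and> (\<forall>l\<in>F. l \<noteq> 0) \<and> inj_on zero_set F"

text \<open>Nonempty (in P^2) intersections of subfamilies of lines; the empty subfamily gives the whole plane.\<close>
definition intersection_lattice :: "vec3 set \<Rightarrow> vec3 set set" where
  "intersection_lattice F =
     {\<Inter> (zero_set ` G) | G. G \<subseteq> F \<and> \<Inter> (zero_set ` G) \<noteq> {0}}"

text \<open>Isomorphism of the posets (ordered by reverse inclusion; an order isomorphism for
  reverse inclusion is the same as one for inclusion).\<close>
definition iso_lattices :: "vec3 set \<Rightarrow> vec3 set \<Rightarrow> bool" where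
  "iso_lattices F1 F2 \<longleftrightarrow>
     (\<exists>\<phi>. bij_betw \<phi> (intersection_lattice F1) (intersection_lattice F2) \<and>
          (\<forall>X\<in>intersection_lattice F1. \<forall>Y\<in>intersection_lattice F1.
              (Y \<subseteq> X \<longleftrightarrow> \<phi> Y \<subseteq> \<phi> X)))"

definition t_count :: "vec3 set \<Rightarrow> nat \<Rightarrow> nat" where
  "t_count F i = card {p \<in> proj_points. card {l \<in> F. p \<subseteq> zero_set l} = i}"

text \<open>Monomials x^a y^b z^c are encoded by exponent triples (a,b,c).\<close>
type_synonym poly3 = "(nat \<times> nat \<times> nat) \<Rightarrow>\<^sub>0 complex"

definition mdeg :: "nat \<times> nat \<times> nat \<Rightarrow> nat" where
  "mdeg m = (case m of (a, b, c) \<Rightarrow> a + b + c)"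

definition homogeneous :: "int \<Rightarrow> poly3 \<Rightarrow> bool" where
  "homogeneous n p \<longleftrightarrow> (\<forall>m\<in>Poly_Mapping.keys p. int (mdeg m) = n)"

definition var_x :: poly3 where "var_x = Poly_Mapping.single (1, 0, 0) 1"
definition var_y :: poly3 where "var_y = Poly_Mapping.single (0, 1, 0) 1"
definition var_z :: poly3 where "var_z = Poly_Mapping.single (0, 0, 1) 1"

definition lin_poly :: "vec3 \<Rightarrow> poly3" where
  "lin_poly l = (case l of (a, b, c) \<Rightarrow>
     Poly_Mapping.single (1, 0, 0) a + Poly_Mapping.single (0, 1, 0) b +
     Poly_Mapping.single (0, 0, 1) c)"

definition def_poly :: "vec3 set \<Rightarrow> poly3" where
  "def_poly F = (\<Prod>l\<in>F. lin_poly l)"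

definition deriv_x :: "poly3 \<Rightarrow> poly3" where
  "deriv_x p = Abs_poly_mapping (\<lambda>(a, b, c). of_nat (a + 1) * Poly_Mapping.lookup p (a + 1, b, c))"
definition deriv_y :: "poly3 \<Rightarrow> poly3" where
  "deriv_y p = Abs_poly_mapping (\<lambda>(a, b, c). of_nat (b + 1) * Poly_Mapping.lookup p (a, b + 1, c))"
definition deriv_z :: "poly3 \<Rightarrow> poly3" where
  "deriv_z p = Abs_poly_mapping (\<lambda>(a, b, c). of_nat (c + 1) * Poly_Mapping.lookup p (a, b, c + 1))"

text \<open>Jacobian ideal J_f = (f_x, f_y, f_z); the Milnor algebra is M(f) = S / J_f.\<close>
definition jacobian_ideal :: "poly3 \<Rightarrow> poly3 set" where
  "jacobian_ideal f = {a * deriv_x f + b * deriv_y f + c * deriv_z f | a b c. True}"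

text \<open>A graded free module F_i = \<Oplus>_k S(-D_i!k) has elements: vectors v :: nat \<Rightarrow> poly3
  supported on indices < length (D i). The differential F_i \<rightarrow> F_{i-1} is given by the
  matrix Phi i (row r, column k).\<close>
definition free_mod :: "int list \<Rightarrow> (nat \<Rightarrow> poly3) set" where
  "free_mod D = {v. \<forall>k \<ge> length D. v k = 0}"

definition mat_apply :: "int list \<Rightarrow> (nat \<Rightarrow> nat \<Rightarrow> poly3) \<Rightarrow> (nat \<Rightarrow> poly3) \<Rightarrow> (nat \<Rightarrow> poly3)" where
  "mat_apply D A v = (\<lambda>r. \<Sum>k<length D. A r k * v k)"

text \<open>(D, Phi) is a minimal graded free resolution of S/I:
   F_0 = S (one generator of degree 0) with the canonical augmentation S \<rightarrow> S/I,
   F_i = \<Oplus>_k S(-D_i!k), graded differentials of degree 0,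
   image(Phi 1) = I, ker(Phi i) = image(Phi (i+1)) for i \<ge> 1,
   and minimality: no matrix entry has a nonzero constant term.
   The graded Betti number beta_{i,j} is the multiplicity of j in D i.\<close>
definition min_graded_free_res ::
  "poly3 set \<Rightarrow> (nat \<Rightarrow> int list) \<Rightarrow> (nat \<Rightarrow> nat \<Rightarrow> nat \<Rightarrow> poly3) \<Rightarrow> bool" where
  "min_graded_free_res I D Phi \<longleftrightarrow>
     D 0 = [0] \<and>
     (\<forall>i \<ge> 1. \<forall>r k. (r \<ge> length (D (i - 1)) \<or> k \<ge> length (D i)) \<longrightarrow> Phi i r k = 0) \<and>
     (\<forall>i \<ge> 1. \<forall>r < length (D (i - 1)). \<forall>k < length (D i).
         homogeneous (D i ! k - D (i - 1) ! r) (Phi i r k)) \<and>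
     (\<forall>i \<ge> 1. \<forall>r k. Poly_Mapping.lookup (Phi i r k) (0, 0, 0) = 0) \<and>
     mat_apply (D 1) (Phi 1) ` free_mod (D 1) = {v \<in> free_mod (D 0). v 0 \<in> I} \<and>
     (\<forall>i \<ge> 1. {v \<in> free_mod (D i). mat_apply (D i) (Phi i) v = (\<lambda>_. 0)} =
               mat_apply (D (Suc i)) (Phi (Suc i)) ` free_mod (D (Suc i)))"

definition graded_betti :: "(nat \<Rightarrow> int list) \<Rightarrow> nat \<Rightarrow> int \<Rightarrow> nat" where
  "graded_betti D i j = count_list (D i) j"

end

theory Submission
  imports Defs "HOL-Library.Product_Lexorder" "HOL-Computational_Algebra.Polynomial"
begin

text \<open>The two arrangements differ in the minimal degree of a Jacobian syzygy: \<open>L1\<close> has one of degree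
  6, \<open>L2\<close> has none. In a minimal resolution of the Milnor algebra the first map is, up to an
  invertible constant matrix, the vector of the three partial derivatives of degree 11. So some second shift is
  at most \<open>11 + r\<close> exactly if there is a nonzero syzygy of degree at most \<open>r\<close>, and the
  second graded Betti numbers are different.

  A syzygy is the same as a derivation that is tangent to all lines, modulo the Euler derivation.
  The coordinate triangle belongs to both arrangements and its vertices are the three quadruple points.
  Killing the last component by the Euler derivation therefore leaves two cubic forms as the only unknowns
  in degree 6. For \<open>L1\<close> they are written down. For \<open>L2\<close> they have to vanish at many
  intersection points, which forces them to be zero.\<close>

section \<open>Ternary polynomials as functions\<close>

text \<open>The Betti numbers are compared for all minimal resolutions, in arbitrary bases, so no
  resolution is ever written down. A comparison of this kind would be vacuous if one of the algebras
  had no minimal resolution. Existence is therefore proved too: each step chooses a homogeneous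
  generating set of least cardinality, and minimality of the number of generators keeps constants
  out of the next kernel.

  Syzygies between three polynomials of degree 11 would be a large elimination problem. It is
  avoided by identifying a polynomial with its function on C^3: the derivative of a product of
  linear forms is expanded at a point, and tangency is tested at points of the lines. For
  \<open>L2\<close> this leaves small linear systems. Each cubic form has ten coefficients and nine
  known zeros.

  All lines have integer coefficients. Equality of the lattices becomes equality of two tables of
  vanishing determinants, which is settled by evaluation.\<close>

instance prod :: ("{ordered_cancel_comm_monoid_add, linorder}",
    "{ordered_cancel_comm_monoid_add, linorder}") ordered_cancel_comm_monoid_add
  \<comment> \<open>Adding a fixed pair respects the lexicographic order. This instance gives
    \<open>poly3\<close> the absence of zero divisors, and it turns the order on exponent triples
    into a monomial order for leading terms.\<close>
  by standard (auto simp: less_eq_prod_def plus_prod_def add_left_mono add_strict_left_mono)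

definition mon_eval :: "nat \<times> nat \<times> nat \<Rightarrow> vec3 \<Rightarrow> complex" where
  "mon_eval m v = (case m of (i, j, k) \<Rightarrow> case v of (x, y, z) \<Rightarrow> x ^ i * y ^ j * z ^ k)"

lemma mon_eval_simp: "mon_eval (i, j, k) (x, y, z) = x ^ i * y ^ j * z ^ k"
  by (simp add: mon_eval_def)

lemma mon_eval_add: "mon_eval (m + n) v = mon_eval m v * mon_eval n v"
  by (auto simp: mon_eval_def plus_prod_def power_add split: prod.splits)

lemma mon_eval_zero [simp]: "mon_eval 0 v = 1"
  by (auto simp: mon_eval_def zero_prod_def split: prod.splits)

definition poly_eval :: "poly3 \<Rightarrow> vec3 \<Rightarrow> complex" where
  "poly_eval p v = (\<Sum>m\<in>Poly_Mapping.keys p. Poly_Mapping.lookup p m * mon_eval m v)"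

lemma poly_eval_superset:
  assumes "finite S" "Poly_Mapping.keys p \<subseteq> S"
  shows "poly_eval p v = (\<Sum>m\<in>S. Poly_Mapping.lookup p m * mon_eval m v)"
  unfolding poly_eval_def by (rule sum.mono_neutral_left) (use assms in \<open>auto simp: in_keys_iff\<close>)

lemma poly_eval_zero [simp]: "poly_eval 0 v = 0"
  by (simp add: poly_eval_def)

lemma poly_eval_single [simp]: "poly_eval (Poly_Mapping.single m c) v = c * mon_eval m v"
  by (subst poly_eval_superset[of "{m}"]) auto

lemma poly_eval_add [simp]: "poly_eval (p + q) v = poly_eval p v + poly_eval q v"
proof -
  let ?S = "Poly_Mapping.keys p \<union> Poly_Mapping.keys q"
  have "poly_eval (p + q) v = (\<Sum>m\<in>?S. Poly_Mapping.lookup (p + q) m * mon_eval m v)"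
    by (rule poly_eval_superset) (auto simp: Poly_Mapping.keys_add)
  then show ?thesis
    by (simp add: lookup_add ring_distribs sum.distrib poly_eval_superset[of ?S])
qed

lemma poly_eval_uminus [simp]: "poly_eval (- p) v = - poly_eval p v"
  using poly_eval_add[of p "- p" v] by (simp add: eq_neg_iff_add_eq_0 add.commute)

lemma poly_eval_diff [simp]: "poly_eval (p - q) v = poly_eval p v - poly_eval q v"
  using poly_eval_add[of p "- q" v] by simp

lemma poly_eval_sum [simp]: "poly_eval (sum f A) v = (\<Sum>a\<in>A. poly_eval (f a) v)"
  by (induction A rule: infinite_finite_induct) auto

lemma poly_mapping_sum_single:
  "p = (\<Sum>m\<in>Poly_Mapping.keys p. Poly_Mapping.single m (Poly_Mapping.lookup p m))"
  by (rule poly_mapping_eqI)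
     (auto simp: lookup_sum lookup_single when_def in_keys_iff)

lemma poly_eval_mult [simp]: "poly_eval (p * q) v = poly_eval p v * poly_eval q v"
proof -
  have "p * q = (\<Sum>m\<in>Poly_Mapping.keys p. \<Sum>n\<in>Poly_Mapping.keys q.
      Poly_Mapping.single (m + n) (Poly_Mapping.lookup p m * Poly_Mapping.lookup q n))"
    by (subst poly_mapping_sum_single[of p], subst poly_mapping_sum_single[of q])
       (simp add: sum_product mult_single)
  then have "poly_eval (p * q) v = (\<Sum>m\<in>Poly_Mapping.keys p. \<Sum>n\<in>Poly_Mapping.keys q.
      Poly_Mapping.lookup p m * Poly_Mapping.lookup q n * mon_eval (m + n) v)"
    by simp
  also have "\<dots> = poly_eval p v * poly_eval q v"
    by (simp add: mon_eval_add poly_eval_def sum_product mult_ac)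
  finally show ?thesis .
qed

lemma poly_eval_one [simp]: "poly_eval 1 v = 1"
  using poly_eval_single[of 0 1 v] by (simp del: poly_eval_single)

lemma poly_eval_power [simp]: "poly_eval (p ^ n) v = poly_eval p v ^ n"
  by (induction n) auto

lemma poly_eval_prod [simp]: "poly_eval (prod f A) v = (\<Prod>a\<in>A. poly_eval (f a) v)"
  by (induction A rule: infinite_finite_induct) auto

lemma poly_eval_lin_poly [simp]: "poly_eval (lin_poly l) v = lin_eval l v"
  by (auto simp: lin_poly_def lin_eval_def mon_eval_simp split: prod.splits)

lemma poly_eval_vars [simp]:
  "poly_eval var_x (x, y, z) = x" "poly_eval var_y (x, y, z) = y" "poly_eval var_z (x, y, z) = z"
  by (simp_all add: var_x_def var_y_def var_z_def mon_eval_simp)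

text \<open>The substitution \<open>(x, y, z) = (t, t ^ N, t ^ N\<^sup>2)\<close> keeps the finitely many monomials of a
  polynomial apart once \<open>N\<close> is large.\<close>
lemma poly_eval_eq_zero_imp:
  assumes "\<And>v. poly_eval p v = 0"
  shows "p = 0"
proof (rule poly_mapping_eqI)
  fix m
  obtain N where N: "\<And>i j k. (i, j, k) \<in> Poly_Mapping.keys p \<Longrightarrow> i < N \<and> j < N \<and> k < N"
  proof -
    let ?M = "insert 0 ((\<lambda>(i, j, k). i + j + k) ` Poly_Mapping.keys p)"
    show ?thesis
    proof (rule that[of "Suc (Max ?M)"])
      fix i j k assume *: "(i, j, k) \<in> Poly_Mapping.keys p"
      have "i + j + k \<le> Max ?M" by (rule Max_ge) (use * in force)+
      then show "i < Suc (Max ?M) \<and> j < Suc (Max ?M) \<and> k < Suc (Max ?M)" by simp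
    qed
  qed
  \<comment> \<open>The exponent of \<open>t\<close> after the substitution. All exponents are below
    \<open>N\<close>, so \<open>i\<close>, \<open>j\<close>, \<open>k\<close> are base
    \<open>N\<close> digits, recovered by \<open>mod\<close> and \<open>div\<close>.\<close>
  define enc where "enc = (\<lambda>(i, j, k). i + N * j + N * N * k)"
  have inj: "inj_on enc (Poly_Mapping.keys p)"
  proof (rule inj_onI, clarsimp simp: enc_def)
    fix a b c i j k
    assume 1: "(a, b, c) \<in> Poly_Mapping.keys p" "(i, j, k) \<in> Poly_Mapping.keys p"
      and eq: "a + N * b + N * N * c = i + N * j + N * N * k"
    have "a = i" using arg_cong[OF eq, of "\<lambda>t. t mod N"] N[OF 1(1)] N[OF 1(2)]
      by (simp add: mult.assoc)
    moreover have "b + N * c = j + N * k"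
      using arg_cong[OF eq, of "\<lambda>t. t div N"] N[OF 1(1)] N[OF 1(2)]
      by (simp add: mult.assoc div_add1_eq)
    note arg_cong[OF this, of "\<lambda>t. t mod N"] arg_cong[OF this, of "\<lambda>t. t div N"]
    then have "b = j" "c = k" using N[OF 1(1)] N[OF 1(2)] by simp_all
    ultimately show "a = i \<and> b = j \<and> c = k" by simp
  qed
  define q where "q = (\<Sum>m\<in>Poly_Mapping.keys p. Polynomial.monom (Poly_Mapping.lookup p m) (enc m))"
  have "poly q t = poly_eval p (t, t ^ N, t ^ (N * N))" for t
    by (auto simp: q_def poly_sum poly_monom poly_eval_def mon_eval_simp enc_def power_add power_mult
        intro!: sum.cong split: prod.splits)
  then have "q = 0" using assms by (simp add: poly_all_0_iff_0[symmetric])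
  show "Poly_Mapping.lookup p m = Poly_Mapping.lookup 0 m"
  proof (cases "m \<in> Poly_Mapping.keys p")
    case True
    have "coeff q (enc m) = (\<Sum>n\<in>Poly_Mapping.keys p. if n = m then Poly_Mapping.lookup p n else 0)"
      unfolding q_def coeff_sum
      by (rule sum.cong) (use True in \<open>auto simp: inj_on_eq_iff[OF inj]\<close>)
    also have "\<dots> = Poly_Mapping.lookup p m" using True by simp
    finally show ?thesis using \<open>q = 0\<close> by simp
  qed (simp add: in_keys_iff)
qed

lemma poly_eval_eqI: "(\<And>v. poly_eval p v = poly_eval q v) \<Longrightarrow> p = q"
  using poly_eval_eq_zero_imp[of "p - q"] by simp

lemma poly_eval_along_line:
  "\<exists>q. \<forall>t. poly q t = poly_eval p (a + t * a', b + t * b', c + t * c')"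
proof -
  have "poly_eval p (a + t * a', b + t * b', c + t * c') =
      poly (\<Sum>(i, j, k)\<in>Poly_Mapping.keys p. [:Poly_Mapping.lookup p (i, j, k):] *
        [:a, a':] ^ i * [:b, b':] ^ j * [:c, c':] ^ k) t" for t
    by (auto simp: poly_eval_def mon_eval_simp poly_sum intro!: sum.cong split: prod.splits)
  from this[symmetric] show ?thesis by (intro exI allI)
qed

text \<open>The evaluations of \<open>p\<close> on a line agree with a univariate polynomial, so a cofinite set
  of zeros suffices.\<close>
lemma poly_eval_zero_cofinite_line:
  assumes "finite S" "\<And>t. t \<notin> S \<Longrightarrow> poly_eval p (a + t * a', b + t * b', c + t * c') = 0"
  shows "poly_eval p (a, b, c) = 0"
proof -
  obtain q where q: "\<And>t. poly q t = poly_eval p (a + t * a', b + t * b', c + t * c')"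
    using poly_eval_along_line[of p a a' b b' c c'] by blast
  have "infinite (UNIV - S)" using assms(1) by (simp add: infinite_UNIV_char_0)
  moreover have "UNIV - S \<subseteq> {t. poly q t = 0}" using assms(2) q by auto
  ultimately have "q = 0" using poly_roots_finite[of q] finite_subset[of "UNIV - S"] by blast
  then show ?thesis using q[of 0] by simp
qed

section \<open>Formal partial derivatives\<close>

lemma lookup_deriv:
  "Poly_Mapping.lookup (deriv_x p) (a, b, c) = of_nat (a + 1) * Poly_Mapping.lookup p (a + 1, b, c)"
  "Poly_Mapping.lookup (deriv_y p) (a, b, c) = of_nat (b + 1) * Poly_Mapping.lookup p (a, b + 1, c)"
  "Poly_Mapping.lookup (deriv_z p) (a, b, c) = of_nat (c + 1) * Poly_Mapping.lookup p (a, b, c + 1)"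
proof -
  \<comment> \<open>\<open>Abs_poly_mapping\<close> is meaningful only on functions of finite
    support. The support of a derivative lies in the preimage of the support of \<open>p\<close>
    under an injective shift of indices.\<close>
  have fin: "finite {m. f (g m) \<noteq> 0}"
    if "inj g" "finite {n. f n \<noteq> 0}" for f :: "nat \<times> nat \<times> nat \<Rightarrow> complex" and g
    using finite_vimageI[OF that(2,1)] by (simp add: vimage_def)
  let ?f = "Poly_Mapping.lookup p"
  have "finite {m. ?f ((\<lambda>(a, b, c). (a + 1, b, c)) m) \<noteq> 0}"
    "finite {m. ?f ((\<lambda>(a, b, c). (a, b + 1, c)) m) \<noteq> 0}"
    "finite {m. ?f ((\<lambda>(a, b, c). (a, b, c + 1)) m) \<noteq> 0}"
    by (rule fin; auto simp: inj_def)+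
  then have "finite {m. (\<lambda>(a, b, c). of_nat (a + 1) * ?f (a + 1, b, c)) m \<noteq> 0}"
    "finite {m. (\<lambda>(a, b, c). of_nat (b + 1) * ?f (a, b + 1, c)) m \<noteq> 0}"
    "finite {m. (\<lambda>(a, b, c). of_nat (c + 1) * ?f (a, b, c + 1)) m \<noteq> 0}"
    by (auto simp: case_prod_unfold elim: rev_finite_subset)
  then show
    "Poly_Mapping.lookup (deriv_x p) (a, b, c) = of_nat (a + 1) * Poly_Mapping.lookup p (a + 1, b, c)"
    "Poly_Mapping.lookup (deriv_y p) (a, b, c) = of_nat (b + 1) * Poly_Mapping.lookup p (a, b + 1, c)"
    "Poly_Mapping.lookup (deriv_z p) (a, b, c) = of_nat (c + 1) * Poly_Mapping.lookup p (a, b, c + 1)"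
    unfolding deriv_x_def deriv_y_def deriv_z_def by simp_all
qed

lemma deriv_add:
  "deriv_x (p + q) = deriv_x p + deriv_x q"
  "deriv_y (p + q) = deriv_y p + deriv_y q"
  "deriv_z (p + q) = deriv_z p + deriv_z q"
  by (rule poly_mapping_eqI; clarsimp simp: lookup_deriv lookup_add ring_distribs
      simp del: of_nat_Suc)+

lemma deriv_zero [simp]: "deriv_x 0 = 0" "deriv_y 0 = 0" "deriv_z 0 = 0"
  by (rule poly_mapping_eqI; clarsimp simp: lookup_deriv)+

lemma deriv_sum:
  "deriv_x (sum f A) = (\<Sum>a\<in>A. deriv_x (f a))"
  "deriv_y (sum f A) = (\<Sum>a\<in>A. deriv_y (f a))"
  "deriv_z (sum f A) = (\<Sum>a\<in>A. deriv_z (f a))"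
  by (induction A rule: infinite_finite_induct; simp add: deriv_add)+

text \<open>Truncated subtraction does no harm: for exponent 0 the coefficient on the right is
  0.\<close>

lemma deriv_single:
  "deriv_x (Poly_Mapping.single (i, j, k) c) = Poly_Mapping.single (i - 1, j, k) (of_nat i * c)"
  "deriv_y (Poly_Mapping.single (i, j, k) c) = Poly_Mapping.single (i, j - 1, k) (of_nat j * c)"
  "deriv_z (Poly_Mapping.single (i, j, k) c) = Poly_Mapping.single (i, j, k - 1) (of_nat k * c)"
proof (safe intro!: poly_mapping_eqI)
  fix a b e
  show "Poly_Mapping.lookup (deriv_x (Poly_Mapping.single (i, j, k) c)) (a, b, e) =
      Poly_Mapping.lookup (Poly_Mapping.single (i - 1, j, k) (of_nat i * c)) (a, b, e)"
    by (cases i) (auto simp: lookup_deriv lookup_single when_def)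
  show "Poly_Mapping.lookup (deriv_y (Poly_Mapping.single (i, j, k) c)) (a, b, e) =
      Poly_Mapping.lookup (Poly_Mapping.single (i, j - 1, k) (of_nat j * c)) (a, b, e)"
    by (cases j) (auto simp: lookup_deriv lookup_single when_def)
  show "Poly_Mapping.lookup (deriv_z (Poly_Mapping.single (i, j, k) c)) (a, b, e) =
      Poly_Mapping.lookup (Poly_Mapping.single (i, j, k - 1) (of_nat k * c)) (a, b, e)"
    by (cases k) (auto simp: lookup_deriv lookup_single when_def)
qed

text \<open>Links the formal derivatives to analysis, so that the product rule for many factors can
  be taken from there.\<close>

lemma poly_eval_has_derivative_along_line:
  "((\<lambda>t. poly_eval p (x + t * a, y + t * b, z + t * c)) has_field_derivative
     a * poly_eval (deriv_x p) (x, y, z) + b * poly_eval (deriv_y p) (x, y, z)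
       + c * poly_eval (deriv_z p) (x, y, z)) (at 0)"
proof -
  let ?s = "\<lambda>m. Poly_Mapping.single m (Poly_Mapping.lookup p m)"
  have "((\<lambda>t. poly_eval (?s m) (x + t * a, y + t * b, z + t * c)) has_field_derivative
     a * poly_eval (deriv_x (?s m)) (x, y, z) + b * poly_eval (deriv_y (?s m)) (x, y, z)
       + c * poly_eval (deriv_z (?s m)) (x, y, z)) (at 0)" for m
    by (cases m) (auto simp: mon_eval_simp deriv_single algebra_simps intro!: derivative_eq_intros)
  then have "((\<lambda>t. \<Sum>m\<in>Poly_Mapping.keys p. poly_eval (?s m) (x + t * a, y + t * b, z + t * c))
     has_field_derivative (\<Sum>m\<in>Poly_Mapping.keys p.
      a * poly_eval (deriv_x (?s m)) (x, y, z) + b * poly_eval (deriv_y (?s m)) (x, y, z)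
       + c * poly_eval (deriv_z (?s m)) (x, y, z))) (at 0)"
    by (intro derivative_intros)
  then show ?thesis
    unfolding sum.distrib sum_distrib_left[symmetric] poly_eval_sum[symmetric] deriv_sum[symmetric]
      poly_mapping_sum_single[symmetric] .
qed

text \<open>Both sides are the derivative at 0 of the product of the linear forms along the line
  through \<open>v\<close> in direction \<open>(a, b, c)\<close>. At a point on only one line of
  \<open>F\<close>, a single summand survives.\<close>

lemma syzygy_eval_def_poly:
  assumes "finite F"
  shows "a * poly_eval (deriv_x (def_poly F)) v + b * poly_eval (deriv_y (def_poly F)) v
      + c * poly_eval (deriv_z (def_poly F)) v =
     (\<Sum>l\<in>F. lin_eval l (a, b, c) * (\<Prod>m\<in>F - {l}. lin_eval m v))"
proof -
  obtain x y z where v: "v = (x, y, z)" by (cases v) auto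
  have "((\<lambda>t. \<Prod>l\<in>F. lin_eval l (x + t * a, y + t * b, z + t * c)) has_field_derivative
     (\<Sum>l\<in>F. lin_eval l (a, b, c) *
        (\<Prod>m\<in>F - {l}. lin_eval m (x + 0 * a, y + 0 * b, z + 0 * c)))) (at 0)"
    by (rule has_field_derivative_prod)
       (auto simp: lin_eval_def algebra_simps split: prod.splits intro!: derivative_eq_intros)
  from DERIV_unique[OF poly_eval_has_derivative_along_line[of "def_poly F", unfolded def_poly_def
        poly_eval_prod poly_eval_lin_poly] this]
  show ?thesis by (simp add: v def_poly_def)
qed

section \<open>Homogeneous components\<close>

definition hcomp :: "int \<Rightarrow> poly3 \<Rightarrow> poly3" where
  "hcomp n p = (\<Sum>m\<in>{m\<in>Poly_Mapping.keys p. int (mdeg m) = n}.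
     Poly_Mapping.single m (Poly_Mapping.lookup p m))"

lemma lookup_hcomp:
  "Poly_Mapping.lookup (hcomp n p) m = (if int (mdeg m) = n then Poly_Mapping.lookup p m else 0)"
  by (auto simp: hcomp_def lookup_sum lookup_single when_def in_keys_iff)

lemma homogeneous_alt:
  "homogeneous n p \<longleftrightarrow> (\<forall>m. Poly_Mapping.lookup p m \<noteq> 0 \<longrightarrow> int (mdeg m) = n)"
  by (auto simp: homogeneous_def in_keys_iff)

lemma homogeneous_hcomp [simp]: "homogeneous n (hcomp n p)"
  by (auto simp: homogeneous_alt lookup_hcomp)

lemma hcomp_homogeneous: "homogeneous n p \<Longrightarrow> hcomp k p = (if k = n then p else 0)"
  by (rule poly_mapping_eqI) (auto simp: homogeneous_alt lookup_hcomp)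

lemma hcomp_add: "hcomp n (p + q) = hcomp n p + hcomp n q"
  by (rule poly_mapping_eqI) (auto simp: lookup_hcomp lookup_add)

lemma hcomp_zero [simp]: "hcomp n 0 = 0"
  by (simp add: hcomp_def)

lemma hcomp_sum: "hcomp n (sum f A) = (\<Sum>a\<in>A. hcomp n (f a))"
  by (induction A rule: infinite_finite_induct) (auto simp: hcomp_add)

lemma hcomp_decomp:
  assumes "finite S" "\<And>m. m \<in> Poly_Mapping.keys p \<Longrightarrow> int (mdeg m) \<in> S"
  shows "p = (\<Sum>n\<in>S. hcomp n p)"
  using assms by (intro poly_mapping_eqI) (auto simp: lookup_sum lookup_hcomp in_keys_iff)

lemma homogeneous_zero [simp]: "homogeneous n 0"
  by (simp add: homogeneous_def)

lemma homogeneous_add: "homogeneous n p \<Longrightarrow> homogeneous n q \<Longrightarrow> homogeneous n (p + q)"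
  unfolding homogeneous_def using Poly_Mapping.keys_add[of p q] by blast

lemma homogeneous_uminus: "homogeneous n p \<Longrightarrow> homogeneous n (- p)"
  by (simp add: homogeneous_alt)

lemma homogeneous_diff: "homogeneous n p \<Longrightarrow> homogeneous n q \<Longrightarrow> homogeneous n (p - q)"
  using homogeneous_add[OF _ homogeneous_uminus, of n p q] by simp

lemma homogeneous_sum: "(\<And>a. a \<in> A \<Longrightarrow> homogeneous n (f a)) \<Longrightarrow> homogeneous n (sum f A)"
  by (induction A rule: infinite_finite_induct) (auto intro: homogeneous_add)

lemma mdeg_add: "mdeg (m + n) = mdeg m + mdeg n"
  by (auto simp: mdeg_def plus_prod_def split: prod.splits)

lemma homogeneous_mult:
  assumes "homogeneous a p" "homogeneous b q"
  shows "homogeneous (a + b) (p * q)"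
  unfolding homogeneous_def
proof
  fix m assume "m \<in> Poly_Mapping.keys (p * q)"
  then obtain u w where "u \<in> Poly_Mapping.keys p" "w \<in> Poly_Mapping.keys q" "m = u + w"
    using Poly_Mapping.keys_mult[of p q] by blast
  then show "int (mdeg m) = a + b" using assms by (simp add: homogeneous_def mdeg_add)
qed

lemma homogeneous_single: "homogeneous n (Poly_Mapping.single m c) \<longleftrightarrow> c = 0 \<or> int (mdeg m) = n"
  by (auto simp: homogeneous_def)

lemma mdeg_zero [simp]: "mdeg 0 = 0" "mdeg (0, 0, 0) = 0"
  by (simp_all add: mdeg_def zero_prod_def)

lemma mdeg_eq_0_iff: "mdeg m = 0 \<longleftrightarrow> m = 0"
  by (auto simp: mdeg_def zero_prod_def split: prod.splits)

lemma homogeneous_const: "homogeneous 0 (Poly_Mapping.single 0 c)"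
  by (simp add: homogeneous_single)

lemma homogeneous_0_iff: "homogeneous 0 p \<longleftrightarrow> p = Poly_Mapping.single 0 (Poly_Mapping.lookup p 0)"
proof
  assume *: "homogeneous 0 p"
  show "p = Poly_Mapping.single 0 (Poly_Mapping.lookup p 0)"
    by (rule poly_mapping_eqI)
       (use * in \<open>auto simp: homogeneous_alt lookup_single when_def mdeg_eq_0_iff\<close>)
qed (metis homogeneous_const)

text \<open>Degrees are integers because shifts are subtracted from them. Coefficients of generators
  whose shift is too large vanish for this reason.\<close>

lemma homogeneous_neg: "homogeneous n p \<Longrightarrow> n < 0 \<Longrightarrow> p = 0"
  by (rule poly_mapping_eqI) (force simp: homogeneous_alt)

lemma hcomp_mult:
  assumes "homogeneous d q"
  shows "hcomp n (q * p) = q * hcomp (n - d) p"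
proof -
  \<comment> \<open>The degree \<open>n - d\<close> is added by hand, since \<open>p\<close> may
    have no term of that degree.\<close>
  let ?S = "(\<lambda>m. int (mdeg m)) ` Poly_Mapping.keys p \<union> {n - d}"
  have "q * p = (\<Sum>k\<in>?S. q * hcomp k p)"
    unfolding sum_distrib_left[symmetric] by (subst hcomp_decomp[of ?S p, symmetric]) auto
  then have "hcomp n (q * p) = (\<Sum>k\<in>?S. hcomp n (q * hcomp k p))" by (simp only: hcomp_sum)
  also have "\<dots> = (\<Sum>k\<in>?S. if k = n - d then q * hcomp (n - d) p else 0)"
    by (intro sum.cong) (auto simp: hcomp_homogeneous[OF homogeneous_mult[OF assms homogeneous_hcomp]])
  also have "\<dots> = q * hcomp (n - d) p" by (subst sum.delta) auto
  finally show ?thesis .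
qed

lemma homogeneous_lin_poly: "homogeneous 1 (lin_poly l)"
  by (auto simp: lin_poly_def homogeneous_single mdeg_def intro!: homogeneous_add split: prod.splits)

lemma homogeneous_prod:
  "finite A \<Longrightarrow> (\<And>a. a \<in> A \<Longrightarrow> homogeneous 1 (f a)) \<Longrightarrow> homogeneous (int (card A)) (prod f A)"
proof (induction A rule: finite_induct)
  case empty
  then show ?case using homogeneous_const[of 1] by simp
next
  case (insert x A)
  then show ?case using homogeneous_mult[of 1 "f x" "int (card A)" "prod f A"] by simp
qed

lemma homogeneous_def_poly: "finite F \<Longrightarrow> homogeneous (int (card F)) (def_poly F)"
  unfolding def_poly_def by (rule homogeneous_prod) (auto simp: homogeneous_lin_poly)

lemma homogeneous_deriv:
  assumes "homogeneous n p"
  shows "homogeneous (n - 1) (deriv_x p)" "homogeneous (n - 1) (deriv_y p)"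
    "homogeneous (n - 1) (deriv_z p)"
proof -
  have "int (mdeg m) = n" if "Poly_Mapping.lookup p m \<noteq> 0" for m
    using assms that unfolding homogeneous_alt by blast
  from this[of "(Suc i, j, k)" for i j k] this[of "(i, Suc j, k)" for i j k]
    this[of "(i, j, Suc k)" for i j k]
  show "homogeneous (n - 1) (deriv_x p)" "homogeneous (n - 1) (deriv_y p)"
    "homogeneous (n - 1) (deriv_z p)"
    by (force simp: homogeneous_alt lookup_deriv mdeg_def)+
qed

lemma var_lin_poly: "var_x = lin_poly (1, 0, 0)" "var_y = lin_poly (0, 1, 0)" "var_z = lin_poly (0, 0, 1)"
  by (simp_all add: var_x_def var_y_def var_z_def lin_poly_def)

lemma single_eq_vars:
  "Poly_Mapping.single (i, j, k) c = Poly_Mapping.single 0 c * var_x ^ i * var_y ^ j * var_z ^ k"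
proof (rule poly_eval_eqI)
  fix v :: vec3
  show "poly_eval (Poly_Mapping.single (i, j, k) c) v =
      poly_eval (Poly_Mapping.single 0 c * var_x ^ i * var_y ^ j * var_z ^ k) v"
    by (cases v) (simp add: mon_eval_simp)
qed

section \<open>Divisibility by linear forms\<close>

lemma dvd_diff_mult:
  fixes d :: "'a::comm_ring_1"
  assumes "d dvd a - a'" "d dvd b - b'"
  shows "d dvd a * b - a' * b'"
proof -
  have "a * b - a' * b' = (a - a') * b + a' * (b - b')" by (simp add: algebra_simps)
  then show ?thesis using assms by simp
qed

lemma dvd_diff_power:
  fixes d :: "'a::comm_ring_1"
  shows "d dvd a - a' \<Longrightarrow> d dvd a ^ n - a' ^ n"
  by (induction n) (auto intro: dvd_diff_mult)

text \<open>With \<open>l(e) = 1\<close>, the substitution \<open>v \<mapsto> v - l(v) e\<close> is the identity modulo \<open>l\<close> and takes its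
  values in the zero set of \<open>l\<close>.\<close>
lemma lin_poly_dvd:
  assumes "l \<noteq> 0" "\<And>v. lin_eval l v = 0 \<Longrightarrow> poly_eval p v = 0"
  shows "lin_poly l dvd p"
proof -
  obtain e1 e2 e3 where e: "lin_eval l (e1, e2, e3) = 1"
  proof -
    obtain a b c where l: "l = (a, b, c)" by (cases l) auto
    consider "a \<noteq> 0" | "b \<noteq> 0" | "c \<noteq> 0" using assms(1) by (auto simp: l zero_prod_def)
    then show ?thesis
      using that[of "1 / a" 0 0] that[of 0 "1 / b" 0] that[of 0 0 "1 / c"]
      by (cases) (auto simp: l lin_eval_def)
  qed
  let ?L = "lin_poly l"
  define X where "X = var_x - ?L * Poly_Mapping.single 0 e1"
  define Y where "Y = var_y - ?L * Poly_Mapping.single 0 e2"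
  define Z where "Z = var_z - ?L * Poly_Mapping.single 0 e3"
  \<comment> \<open>\<open>s\<close> is \<open>p\<close> after the substitution: congruent to
    \<open>p\<close> modulo \<open>l\<close> monomial by monomial, and zero as a function.\<close>
  define s where "s = (\<Sum>(i, j, k)\<in>Poly_Mapping.keys p.
    Poly_Mapping.single 0 (Poly_Mapping.lookup p (i, j, k)) * X ^ i * Y ^ j * Z ^ k)"
  have "poly_eval s v = 0" for v
  proof -
    obtain x y z where v: "v = (x, y, z)" by (cases v) auto
    let ?t = "lin_eval l v"
    have "poly_eval s v = poly_eval p (x - ?t * e1, y - ?t * e2, z - ?t * e3)"
      by (auto simp: s_def X_def Y_def Z_def poly_eval_def[of p] mon_eval_simp v
          intro!: sum.cong split: prod.splits)
    also have "\<dots> = 0"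
    proof (rule assms(2))
      obtain a b c where l: "l = (a, b, c)" by (cases l) auto
      show "lin_eval l (x - ?t * e1, y - ?t * e2, z - ?t * e3) = 0"
        using e unfolding v l lin_eval_def prod.case by algebra
    qed
    finally show ?thesis .
  qed
  then have "s = 0" by (rule poly_eval_eq_zero_imp)
  have p: "p = (\<Sum>(i, j, k)\<in>Poly_Mapping.keys p.
    Poly_Mapping.single 0 (Poly_Mapping.lookup p (i, j, k)) * var_x ^ i * var_y ^ j * var_z ^ k)"
    by (subst poly_mapping_sum_single[of p]) (auto intro!: sum.cong simp: single_eq_vars)
  have d: "?L dvd var_x - X" "?L dvd var_y - Y" "?L dvd var_z - Z"
    by (simp_all add: X_def Y_def Z_def)
  have "?L dvd p - s"
    by (subst p, unfold s_def sum_subtractf[symmetric])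
       (auto intro!: dvd_sum dvd_diff_mult dvd_diff_power d split: prod.splits)
  then show ?thesis using \<open>s = 0\<close> by simp
qed

text \<open>Divisibility gives some quotient. Comparing the components of degree \<open>n\<close>
  shows that its component of degree \<open>n - 1\<close> is a quotient as well.\<close>

lemma lin_poly_dvd_homogeneous:
  assumes "l \<noteq> 0" "\<And>v. lin_eval l v = 0 \<Longrightarrow> poly_eval p v = 0" "homogeneous n p"
  obtains q where "p = lin_poly l * q" "homogeneous (n - 1) q"
proof -
  obtain q where "p = lin_poly l * q" using lin_poly_dvd[OF assms(1,2)] by (auto simp: dvd_def)
  then have "p = lin_poly l * hcomp (n - 1) q"
    by (metis assms(3) hcomp_homogeneous hcomp_mult homogeneous_lin_poly)
  then show ?thesis using that homogeneous_hcomp by blast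
qed

section \<open>Existence of minimal graded free resolutions\<close>

definition finite_basis :: "('a \<Rightarrow> 'a \<Rightarrow> bool) \<Rightarrow> bool" where
  "finite_basis le \<longleftrightarrow> (\<forall>T. \<exists>G. finite G \<and> G \<subseteq> T \<and> (\<forall>t\<in>T. \<exists>g\<in>G. le g t))"

lemma finite_basisD: "finite_basis le \<Longrightarrow> \<exists>G. finite G \<and> G \<subseteq> T \<and> (\<forall>t\<in>T. \<exists>g\<in>G. le g t)"
  by (simp add: finite_basis_def)

lemma finite_basis_nat: "finite_basis ((\<le>) :: nat \<Rightarrow> nat \<Rightarrow> bool)"
  unfolding finite_basis_def
proof
  fix T :: "nat set"
  show "\<exists>G. finite G \<and> G \<subseteq> T \<and> (\<forall>t\<in>T. \<exists>g\<in>G. g \<le> t)"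
  proof (cases "T = {}")
    case False
    then obtain t0 where "t0 \<in> T" by auto
    then have "(LEAST t. t \<in> T) \<in> T" by (rule LeastI)
    then show ?thesis by (intro exI[of _ "{LEAST t. t \<in> T}"]) (auto intro: Least_le)
  qed auto
qed

text \<open>Lift a finite basis of the second projections back to \<open>T\<close>, and let
  \<open>N\<close> bound the first coordinates of the lifts. The lifts handle all pairs with first
  coordinate at least \<open>N\<close>. Each of the finitely many slices below \<open>N\<close> gets
  its own finite basis.\<close>

lemma finite_basis_nat_times:
  assumes "finite_basis le"
  shows "finite_basis (\<lambda>(n :: nat, a) (n', a'). n \<le> n' \<and> le a a')"
  unfolding finite_basis_def
proof
  fix T :: "(nat \<times> 'a) set"
  obtain G0 where G0: "finite G0" "G0 \<subseteq> snd ` T" "\<And>t. t \<in> T \<Longrightarrow> \<exists>g\<in>G0. le g (snd t)"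
    using finite_basisD[OF assms, of "snd ` T"] by auto
  have "\<exists>h. \<forall>g\<in>G0. (h g, g) \<in> T" by (rule bchoice) (use G0(2) in force)
  then obtain h where h: "\<And>g. g \<in> G0 \<Longrightarrow> (h g, g) \<in> T" by blast
  define N where "N = (\<Sum>g\<in>G0. h g)"
  have N: "h g \<le> N" if "g \<in> G0" for g
    unfolding N_def using that G0(1) by (intro member_le_sum) auto
  have "\<exists>G. \<forall>n. finite (G n) \<and> G n \<subseteq> {a. (n, a) \<in> T} \<and> (\<forall>a\<in>{a. (n, a) \<in> T}. \<exists>g\<in>G n. le g a)"
    by (intro choice allI finite_basisD assms)
  then obtain G where "\<forall>n. finite (G n) \<and> G n \<subseteq> {a. (n, a) \<in> T} \<and>
      (\<forall>a\<in>{a. (n, a) \<in> T}. \<exists>g\<in>G n. le g a)" ..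
  then have G: "\<And>n. finite (G n)" "\<And>n. G n \<subseteq> {a. (n, a) \<in> T}"
    "\<And>n a. (n, a) \<in> T \<Longrightarrow> \<exists>g\<in>G n. le g a" by auto
  let ?G = "(\<lambda>g. (h g, g)) ` G0 \<union> (\<Union>n<N. Pair n ` G n)"
  have "\<exists>g\<in>?G. (\<lambda>(n, a) (n', a'). n \<le> n' \<and> le a a') g t" if tT: "t \<in> T" for t
  proof -
    obtain n a where t: "t = (n, a)" by (cases t) auto
    show ?thesis
    proof (cases "n < N")
      case True
      obtain g where "g \<in> G n" "le g a" using G(3)[of n a] tT t by auto
      then show ?thesis using True t by (intro bexI[of _ "(n, g)"]) auto
    next
      case False
      obtain g where "g \<in> G0" "le g a" using G0(3)[OF tT] t by auto
      then show ?thesis using N[of g] False t by (intro bexI[of _ "(h g, g)"]) auto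
    qed
  qed
  moreover have "finite ?G" using G0(1) G(1) by auto
  moreover have "?G \<subseteq> T" using h G(2) by blast
  ultimately show "\<exists>G. finite G \<and> G \<subseteq> T \<and>
      (\<forall>t\<in>T. \<exists>g\<in>G. (\<lambda>(n, a) (n', a'). n \<le> n' \<and> le a a') g t)"
    by (intro exI[of _ ?G] conjI ballI)
qed

lemma dickson3:
  "\<exists>G. finite G \<and> G \<subseteq> T \<and> (\<forall>t\<in>T. \<exists>g\<in>G. \<exists>u. t = u + g)" for T :: "(nat \<times> nat \<times> nat) set"
proof -
  obtain G where "finite G" "G \<subseteq> T"
    and G: "\<And>t. t \<in> T \<Longrightarrow> \<exists>g\<in>G. (\<lambda>(n, a) (n', a'). n \<le> n' \<and>
      (\<lambda>(n, a) (n', a'). n \<le> n' \<and> a \<le> a') a a') g t"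
    using finite_basisD[OF finite_basis_nat_times[OF finite_basis_nat_times[OF finite_basis_nat]], of T]
    by blast
  have "\<exists>g\<in>G. \<exists>u. t = u + g" if tT: "t \<in> T" for t
  proof -
    obtain i j k where t: "t = (i, j, k)" by (cases t) auto
    obtain i' j' k' where "(i', j', k') \<in> G" "i' \<le> i" "j' \<le> j" "k' \<le> k"
      using G[OF tT] t by auto
    then show ?thesis
      by (intro bexI[of _ "(i', j', k')"] exI[of _ "(i - i', j - j', k - k')"])
         (auto simp: t plus_prod_def)
  qed
  then show ?thesis using \<open>finite G\<close> \<open>G \<subseteq> T\<close> by blast
qed

text \<open>A pair \<open>(k, m)\<close> stands for a monomial with exponents \<open>m\<close> in
  component \<open>k\<close> of a free module of rank \<open>N\<close>. One such monomial divides
  another only within the same component, so the components are treated separately.\<close>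

lemma dickson_vec:
  fixes T :: "(nat \<times> nat \<times> nat \<times> nat) set"
  assumes "fst ` T \<subseteq> {..<N}"
  shows "\<exists>G. finite G \<and> G \<subseteq> T \<and> (\<forall>(k, m)\<in>T. \<exists>g u. (k, g) \<in> G \<and> m = u + g)"
proof -
  have "\<exists>G. \<forall>k. finite (G k) \<and> G k \<subseteq> {m. (k, m) \<in> T} \<and>
      (\<forall>m\<in>{m. (k, m) \<in> T}. \<exists>g\<in>G k. \<exists>u. m = u + g)"
    by (intro choice allI dickson3)
  then obtain G where "\<forall>k. finite (G k) \<and> G k \<subseteq> {m. (k, m) \<in> T} \<and>
      (\<forall>m\<in>{m. (k, m) \<in> T}. \<exists>g\<in>G k. \<exists>u. m = u + g)" ..
  then have G: "\<And>k. finite (G k)" "\<And>k. G k \<subseteq> {m. (k, m) \<in> T}"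
    "\<And>k m. (k, m) \<in> T \<Longrightarrow> \<exists>g\<in>G k. \<exists>u. m = u + g" by auto
  let ?G = "\<Union>k<N. Pair k ` G k"
  have "\<exists>g u. (k, g) \<in> ?G \<and> m = u + g" if t: "(k, m) \<in> T" for k m
  proof -
    have "k < N" using t assms by force
    moreover obtain g u where "g \<in> G k" "m = u + g" using G(3)[OF t] by blast
    ultimately show ?thesis by (intro exI[of _ g] exI[of _ u]) auto
  qed
  then have "\<forall>(k, m)\<in>T. \<exists>g u. (k, g) \<in> ?G \<and> m = u + g" by (intro ballI) (clarify, blast)
  moreover have "finite ?G" using G(1) by auto
  moreover have "?G \<subseteq> T" using G(2) by blast
  ultimately show ?thesis by (intro exI[of _ ?G] conjI)
qed

lemma lookup_single_mult:
  "Poly_Mapping.lookup (Poly_Mapping.single u c * p) (u + n) = c * Poly_Mapping.lookup p (n :: nat \<times> nat \<times> nat)"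
  for p :: poly3
proof -
  have "Poly_Mapping.single u c * p =
    (\<Sum>m\<in>Poly_Mapping.keys p. Poly_Mapping.single (u + m) (c * Poly_Mapping.lookup p m))"
    by (subst poly_mapping_sum_single[of p]) (simp add: sum_distrib_left mult_single)
  then show ?thesis by (simp add: lookup_sum lookup_single when_def in_keys_iff)
qed

section \<open>Submodules of free modules and Hilbert's basis theorem\<close>

definition submod :: "nat \<Rightarrow> (nat \<Rightarrow> poly3) set \<Rightarrow> bool" where
  "submod N M \<longleftrightarrow> (\<forall>v\<in>M. \<forall>k\<ge>N. v k = 0) \<and> (\<lambda>_. 0) \<in> M \<and>
     (\<forall>v\<in>M. \<forall>w\<in>M. (\<lambda>k. v k + w k) \<in> M) \<and> (\<forall>a. \<forall>v\<in>M. (\<lambda>k. a * v k) \<in> M)"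

lemma submod_outside: "submod N M \<Longrightarrow> v \<in> M \<Longrightarrow> k \<ge> N \<Longrightarrow> v k = 0"
  unfolding submod_def by blast

lemma submod_zero: "submod N M \<Longrightarrow> (\<lambda>_. 0) \<in> M"
  unfolding submod_def by (elim conjE)

lemma submod_add: "submod N M \<Longrightarrow> v \<in> M \<Longrightarrow> w \<in> M \<Longrightarrow> (\<lambda>k. v k + w k) \<in> M"
  unfolding submod_def by (elim conjE) (drule (1) bspec, drule (1) bspec, assumption)

lemma submod_scale: "submod N M \<Longrightarrow> v \<in> M \<Longrightarrow> (\<lambda>k. a * v k) \<in> M"
  unfolding submod_def by (elim conjE) (drule spec, drule (1) bspec, assumption)

lemma submod_sum:
  assumes "submod N M" "\<And>i. i \<in> A \<Longrightarrow> f i \<in> M"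
  shows "(\<lambda>k. \<Sum>i\<in>A. f i k) \<in> M"
  using assms(2)
proof (induction A rule: infinite_finite_induct)
  case (insert x A)
  then show ?case
    using submod_add[OF assms(1), of "f x" "\<lambda>k. \<Sum>i\<in>A. f i k"] by simp
qed (simp_all add: submod_zero[OF assms(1)])

text \<open>Meant for finite \<open>S\<close>: over an infinite set every sum is 0 by
  convention.\<close>

definition vspan :: "(nat \<Rightarrow> poly3) set \<Rightarrow> (nat \<Rightarrow> poly3) set" where
  "vspan S = {v. \<exists>c. v = (\<lambda>r. \<Sum>g\<in>S. c g * g r)}"

lemma vspan_subset: "submod N M \<Longrightarrow> S \<subseteq> M \<Longrightarrow> vspan S \<subseteq> M"
  unfolding vspan_def by (clarify, rule submod_sum, assumption) (blast intro: submod_scale)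

lemma vspan_zero: "(\<lambda>_. 0) \<in> vspan S"
  unfolding vspan_def by (intro CollectI exI[of _ "\<lambda>_. 0"]) simp

lemma vspan_add: "v \<in> vspan S \<Longrightarrow> w \<in> vspan S \<Longrightarrow> (\<lambda>k. v k + w k) \<in> vspan S"
  unfolding vspan_def
proof clarify
  fix c d
  show "\<exists>e. (\<lambda>k. (\<Sum>g\<in>S. c g * g k) + (\<Sum>g\<in>S. d g * g k)) = (\<lambda>r. \<Sum>g\<in>S. e g * g r)"
    by (intro exI[of _ "\<lambda>g. c g + d g"]) (simp add: ring_distribs sum.distrib)
qed

lemma vspan_scale: "v \<in> vspan S \<Longrightarrow> (\<lambda>k. a * v k) \<in> vspan S"
  unfolding vspan_def
proof clarify
  fix c
  show "\<exists>e. (\<lambda>k. a * (\<Sum>g\<in>S. c g * g k)) = (\<lambda>r. \<Sum>g\<in>S. e g * g r)"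
    by (intro exI[of _ "\<lambda>g. a * c g"]) (simp add: sum_distrib_left mult.assoc)
qed

lemma vspan_base: "finite S \<Longrightarrow> g \<in> S \<Longrightarrow> g \<in> vspan S"
  unfolding vspan_def
proof (intro CollectI exI[of _ "\<lambda>h. if h = g then 1 else 0"])
  assume "finite S" "g \<in> S"
  have "(\<Sum>h\<in>S. (if h = g then 1 else 0) * h r) = g r" for r
  proof -
    have "(\<Sum>h\<in>S. (if h = g then 1 else 0) * h r) = (\<Sum>h\<in>S. if h = g then g r else 0)"
      by (rule sum.cong) auto
    then show ?thesis using \<open>finite S\<close> \<open>g \<in> S\<close> by simp
  qed
  then show "g = (\<lambda>r. \<Sum>h\<in>S. (if h = g then 1 else 0) * h r)" by simp
qed

lemma vspan_sum: "(\<And>i. i \<in> A \<Longrightarrow> f i \<in> vspan S) \<Longrightarrow> (\<lambda>k. \<Sum>i\<in>A. f i k) \<in> vspan S"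
proof (induction A rule: infinite_finite_induct)
  case (insert x A)
  then show ?case using vspan_add[of "f x" S "\<lambda>k. \<Sum>i\<in>A. f i k"] by simp
qed (simp_all add: vspan_zero)

definition vterms :: "(nat \<Rightarrow> poly3) \<Rightarrow> (nat \<times> nat \<times> nat \<times> nat) set" where
  "vterms v = {(k, m). m \<in> Poly_Mapping.keys (v k)}"

lemma vterms_iff: "(k, m) \<in> vterms v \<longleftrightarrow> Poly_Mapping.lookup (v k) m \<noteq> 0"
  by (simp add: vterms_def in_keys_iff)

lemma finite_vterms:
  assumes "\<forall>k\<ge>N. v k = 0" shows "finite (vterms v)"
proof (rule finite_subset)
  show "vterms v \<subseteq> Sigma {..<N} (\<lambda>k. Poly_Mapping.keys (v k))"
  proof (rule subsetI)
    fix x assume x: "x \<in> vterms v"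
    obtain k m where km: "x = (k, m)" by (cases x) auto
    have "k < N" using x assms[rule_format, of k] by (cases "k < N") (auto simp: km vterms_def)
    then show "x \<in> Sigma {..<N} (\<lambda>k. Poly_Mapping.keys (v k))" using x by (simp add: km vterms_def)
  qed
qed auto

lemma vterms_empty: "vterms v = {} \<Longrightarrow> v = (\<lambda>_. 0)"
proof (intro ext poly_mapping_eqI)
  fix k m assume "vterms v = {}"
  then show "Poly_Mapping.lookup (v k) m = Poly_Mapping.lookup 0 m" using vterms_iff[of k m v] by simp
qed

text \<open>Leading terms are taken with respect to the lexicographic order on (component, exponents).\<close>
lemma submod_finitely_generated:
  assumes M: "submod N M"
  shows "\<exists>G. finite G \<and> G \<subseteq> M \<and> M \<subseteq> vspan G"
proof -
  define T where "T = (\<lambda>v. Max (vterms v)) ` {v\<in>M. vterms v \<noteq> {}}"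
  have fin: "finite (vterms v)" if "v \<in> M" for v
    using that M by (intro finite_vterms[of N]) (auto simp: submod_def)
  have "fst ` T \<subseteq> {..<N}"
  proof (clarsimp simp: T_def)
    fix v assume v: "v \<in> M" "vterms v \<noteq> {}"
    then have "Max (vterms v) \<in> vterms v" using fin by simp
    then have "v (fst (Max (vterms v))) \<noteq> 0" by (auto simp: vterms_def split: prod.splits)
    then show "fst (Max (vterms v)) < N" using M v(1) by (meson submod_def not_le)
  qed
  from dickson_vec[OF this] obtain L where L': "finite L \<and> L \<subseteq> T \<and>
    (\<forall>(k, m)\<in>T. \<exists>g u. (k, g) \<in> L \<and> m = u + g)" ..
  have L: "finite L" "L \<subseteq> T" using L' by auto
  have L3: "\<exists>g u. (k, g) \<in> L \<and> m = u + g" if "(k, m) \<in> T" for k m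
    using bspec[OF conjunct2[OF conjunct2[OF L']] that] by simp
  \<comment> \<open>One element of \<open>M\<close> for each leading term in the finite set
    \<open>L\<close>. These elements will generate \<open>M\<close>.\<close>
  have "\<exists>G. \<forall>t\<in>L. G t \<in> M \<and> vterms (G t) \<noteq> {} \<and> Max (vterms (G t)) = t"
    by (rule bchoice) (use L(2) in \<open>unfold T_def, blast\<close>)
  then obtain G where "\<forall>t\<in>L. G t \<in> M \<and> vterms (G t) \<noteq> {} \<and> Max (vterms (G t)) = t" ..
  then have G: "\<And>t. t \<in> L \<Longrightarrow> G t \<in> M" "\<And>t. t \<in> L \<Longrightarrow> vterms (G t) \<noteq> {}"
    "\<And>t. t \<in> L \<Longrightarrow> Max (vterms (G t)) = t" by auto
  \<comment> \<open>Division algorithm. The induction runs over the leading term, since the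
    lexicographic order on module monomials is a well-order.\<close>
  have "v \<in> vspan (G ` L)" if "v \<in> M" "vterms v \<noteq> {}" "Max (vterms v) = t" for v t
    using that
  proof (induction t arbitrary: v rule: less_induct)
    case (less t)
    obtain k m where t: "t = (k, m)" by (cases t) auto
    have "t \<in> T" using less.prems by (auto simp: T_def)
    then obtain g u where g: "(k, g) \<in> L" "m = u + g" using L3[of k m] t by auto
    define h where "h = G (k, g)"
    have h: "h \<in> M" "vterms h \<noteq> {}" "Max (vterms h) = (k, g)"
      using G[OF g(1)] by (auto simp: h_def)
    have hg: "Poly_Mapping.lookup (h k) g \<noteq> 0"
      using Max_in[OF fin[OF h(1)] h(2)] h(3) by (simp add: vterms_iff)
    \<comment> \<open>\<open>c\<close> and \<open>u\<close> are the quotients of the leading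
      coefficients and of the leading exponents, so \<open>s\<close> times \<open>h\<close> has the
      same leading term and coefficient as \<open>v\<close>.\<close>
    define c where "c = Poly_Mapping.lookup (v k) m / Poly_Mapping.lookup (h k) g"
    define s where "s = Poly_Mapping.single u c"
    define w where "w = (\<lambda>r. v r - s * h r)"
    have "w = (\<lambda>r. v r + (- s) * h r)" by (simp add: w_def)
    then have wM: "w \<in> M" using submod_add[OF M less.prems(1) submod_scale[OF M h(1), of "- s"]] by simp
    have le: "x \<le> t" if x: "x \<in> vterms w" for x
    proof -
      obtain r n where rn: "x = (r, n)" by (cases x) auto
      have "(r, n) \<in> vterms v \<or> n \<in> Poly_Mapping.keys (s * h r)"
        using x by (auto simp: rn vterms_iff w_def lookup_minus in_keys_iff)
      then show ?thesis
      proof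
        assume "(r, n) \<in> vterms v"
        then show ?thesis using Max_ge[OF fin[OF less.prems(1)]] less.prems(3) rn by blast
      next
        assume "n \<in> Poly_Mapping.keys (s * h r)"
        then obtain n' where n': "n = u + n'" "n' \<in> Poly_Mapping.keys (h r)"
          using Poly_Mapping.keys_mult[of s "h r"] by (auto simp: s_def split: if_splits)
        then have "(r, n') \<le> (k, g)"
          using Max_ge[OF fin[OF h(1)], of "(r, n')"] h(3) by (simp add: vterms_def)
        then show ?thesis
          unfolding rn t n'(1) g(2) less_eq_prod_def[where ?'a = nat and ?'b = "nat \<times> nat \<times> nat"]
          by (auto simp: add_left_mono)
      qed
    qed
    have "t \<notin> vterms w"
      using hg by (simp add: t vterms_iff w_def lookup_minus s_def g(2) lookup_single_mult c_def)
    have w: "w \<in> vspan (G ` L)"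
    proof (cases "vterms w = {}")
      case True
      then have "w = (\<lambda>_. 0)" by (rule vterms_empty)
      then show ?thesis by (simp add: vspan_zero)
    next
      case False
      then have "Max (vterms w) \<in> vterms w" using fin[OF wM] by simp
      then have "Max (vterms w) < t" using le \<open>t \<notin> vterms w\<close> by (auto simp: order_less_le)
      then show ?thesis by (rule less.IH[OF _ wM False refl])
    qed
    have "h \<in> vspan (G ` L)"
      using vspan_base[of "G ` L" h] L(1) g(1) by (auto simp: h_def)
    from vspan_add[OF w vspan_scale[OF this, of s]]
    show ?case by (simp add: w_def)
  qed
  moreover have "v \<in> vspan (G ` L)" if "vterms v = {}" for v
    using vterms_empty[OF that] by (simp add: vspan_zero)
  ultimately have "M \<subseteq> vspan (G ` L)" by blast
  then show ?thesis using L(1) G(1) by (intro exI[of _ "G ` L"]) auto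
qed

section \<open>Graded submodules and homogeneous generators\<close>

definition vcomp :: "int list \<Rightarrow> int \<Rightarrow> (nat \<Rightarrow> poly3) \<Rightarrow> (nat \<Rightarrow> poly3)" where
  "vcomp D n v = (\<lambda>k. if k < length D then hcomp (n - D ! k) (v k) else 0)"

definition graded_submod :: "int list \<Rightarrow> (nat \<Rightarrow> poly3) set \<Rightarrow> bool" where
  "graded_submod D M \<longleftrightarrow> submod (length D) M \<and> (\<forall>v\<in>M. \<forall>n. vcomp D n v \<in> M)"

text \<open>The \<open>k\<close>-th basis vector has degree \<open>D ! k\<close>, so a vector of
  degree \<open>n\<close> has an entry of degree \<open>n - D ! k\<close> at place
  \<open>k\<close>.\<close>

definition vhom :: "int list \<Rightarrow> int \<Rightarrow> (nat \<Rightarrow> poly3) \<Rightarrow> bool" where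
  "vhom D n v \<longleftrightarrow> (\<forall>k<length D. homogeneous (n - D ! k) (v k))"

lemma vhom_vcomp: "vhom D n (vcomp D n v)"
  by (simp add: vhom_def vcomp_def)

lemma vcomp_decomp:
  assumes "\<forall>k\<ge>length D. v k = 0"
  obtains S where "finite S" "v = (\<lambda>k. \<Sum>n\<in>S. vcomp D n v k)"
proof
  let ?S = "(\<lambda>(k, m). int (mdeg m) + D ! k) ` vterms v"
  show "finite ?S" using finite_vterms[OF assms] by simp
  show "v = (\<lambda>k. \<Sum>n\<in>?S. vcomp D n v k)"
  proof
    fix k
    show "v k = (\<Sum>n\<in>?S. vcomp D n v k)"
    proof (cases "k < length D")
      case True
      have "v k = (\<Sum>n\<in>(\<lambda>n. n - D ! k) ` ?S. hcomp n (v k))"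
        by (rule hcomp_decomp) (use \<open>finite ?S\<close> in \<open>force simp: vterms_def\<close>)+
      also have "\<dots> = (\<Sum>n\<in>?S. hcomp (n - D ! k) (v k))"
        by (subst sum.reindex) (auto simp: inj_on_def)
      finally show ?thesis using True by (simp add: vcomp_def)
    qed (use assms in \<open>simp add: vcomp_def\<close>)
  qed
qed

text \<open>The homogeneous components of finitely many generators stay in a graded submodule, are
  again finitely many, and sum up to the generators.\<close>

lemma graded_submod_generators:
  assumes "graded_submod D M"
  shows "\<exists>S. finite S \<and> S \<subseteq> M \<and> (\<forall>g\<in>S. \<exists>n. vhom D n g) \<and> M \<subseteq> vspan S"
proof -
  have M: "submod (length D) M" "\<And>v n. v \<in> M \<Longrightarrow> vcomp D n v \<in> M"
    using assms by (auto simp: graded_submod_def)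
  obtain G where G: "finite G" "G \<subseteq> M" "M \<subseteq> vspan G"
    using submod_finitely_generated[OF M(1)] by blast
  have "\<exists>S. \<forall>g\<in>G. finite (S g) \<and> g = (\<lambda>k. \<Sum>n\<in>S g. vcomp D n g k)"
  proof (intro bchoice ballI)
    fix g assume "g \<in> G"
    then have "\<forall>k\<ge>length D. g k = 0" using G(2) M(1) by (auto simp: submod_def)
    from vcomp_decomp[OF this] show "\<exists>S. finite S \<and> g = (\<lambda>k. \<Sum>n\<in>S. vcomp D n g k)" by metis
  qed
  then obtain S where "\<forall>g\<in>G. finite (S g) \<and> g = (\<lambda>k. \<Sum>n\<in>S g. vcomp D n g k)" ..
  then have S: "\<And>g. g \<in> G \<Longrightarrow> finite (S g)"
    "\<And>g. g \<in> G \<Longrightarrow> g = (\<lambda>k. \<Sum>n\<in>S g. vcomp D n g k)" by auto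
  let ?H = "(\<lambda>(g, n). vcomp D n g) ` Sigma G S"
  have fin: "finite ?H" using G(1) S(1) by auto
  have "g \<in> vspan ?H" if "g \<in> G" for g
  proof -
    have "(\<lambda>k. \<Sum>n\<in>S g. vcomp D n g k) \<in> vspan ?H"
      by (intro vspan_sum vspan_base fin) (use that in force)
    then show ?thesis using S(2)[OF that] by simp
  qed
  then have "vspan G \<subseteq> vspan ?H"
    by (auto simp: vspan_def[of G] intro!: vspan_sum vspan_scale)
  moreover have "?H \<subseteq> M" using G(2) M(2) by auto
  moreover have "\<forall>g\<in>?H. \<exists>n. vhom D n g" using vhom_vcomp by fast
  ultimately show ?thesis using fin G(3) by (intro exI[of _ ?H]) auto
qed

section \<open>Minimal generators and the iterated construction of a resolution\<close>

lemma mat_apply_add: "mat_apply D A (\<lambda>k. v k + w k) = (\<lambda>r. mat_apply D A v r + mat_apply D A w r)"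
  by (simp add: mat_apply_def ring_distribs sum.distrib)

lemma mat_apply_scale: "mat_apply D A (\<lambda>k. a * v k) = (\<lambda>r. a * mat_apply D A v r)"
  by (simp add: mat_apply_def sum_distrib_left mult_ac)

text \<open>Entries of degree \<open>D' ! k - D ! r\<close> make the matrix a graded map of degree
  0, which commutes with taking components.\<close>

lemma mat_apply_vcomp:
  assumes "\<And>k r. k < length D' \<Longrightarrow> r < length D \<Longrightarrow> homogeneous (D' ! k - D ! r) (A r k)"
    and "r < length D"
  shows "mat_apply D' A (vcomp D' n v) r = hcomp (n - D ! r) (mat_apply D' A v r)"
  using assms(2)
  by (auto simp: mat_apply_def vcomp_def hcomp_sum hcomp_mult[OF assms(1)] intro!: sum.cong)

lemma graded_submod_kernel:
  assumes hom: "\<And>k r. k < length D' \<Longrightarrow> r < length D \<Longrightarrow> homogeneous (D' ! k - D ! r) (A r k)"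
    and out: "\<And>k r. r \<ge> length D \<Longrightarrow> A r k = 0"
  shows "graded_submod D' {v \<in> free_mod D'. mat_apply D' A v = (\<lambda>_. 0)}"
  unfolding graded_submod_def
proof (intro conjI ballI allI)
  show "submod (length D') {v \<in> free_mod D'. mat_apply D' A v = (\<lambda>_. 0)}"
    by (auto simp: submod_def free_mod_def mat_apply_add mat_apply_scale)
       (simp add: mat_apply_def)
  fix v n assume v: "v \<in> {v \<in> free_mod D'. mat_apply D' A v = (\<lambda>_. 0)}"
  have "mat_apply D' A (vcomp D' n v) r = 0" for r
  proof (cases "r < length D")
    case True
    then show ?thesis using mat_apply_vcomp[of D' D A r n v] hom v by auto
  qed (simp add: mat_apply_def out)
  then show "vcomp D' n v \<in> {v \<in> free_mod D'. mat_apply D' A v = (\<lambda>_. 0)}"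
    by (auto simp: free_mod_def vcomp_def)
qed

text \<open>A relation in which \<open>g\<close> has a nonzero constant as coefficient can be solved
  for \<open>g\<close>. This is the elementary form of Nakayama's lemma behind minimality.\<close>

lemma vspan_remove:
  assumes "finite S" "g \<in> S" "a g = Poly_Mapping.single 0 c" "c \<noteq> 0"
    and rel: "\<And>r. (\<Sum>h\<in>S. a h * h r) = 0"
  shows "vspan S \<subseteq> vspan (S - {g})"
proof -
  let ?b = "\<lambda>h. - (Poly_Mapping.single 0 (1 / c) * a h)"
  have g: "g r = (\<Sum>h\<in>S - {g}. ?b h * h r)" for r
  proof -
    have "Poly_Mapping.single 0 c * g r + (\<Sum>h\<in>S - {g}. a h * h r) = 0"
      using rel[of r] sum.remove[OF assms(1,2), of "\<lambda>h. a h * h r"] assms(3) by simp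
    then have "Poly_Mapping.single 0 (1 / c) * (Poly_Mapping.single 0 c * g r) =
        Poly_Mapping.single 0 (1 / c) * - (\<Sum>h\<in>S - {g}. a h * h r)"
      by (simp add: add_eq_0_iff2)
    moreover have "Poly_Mapping.single 0 (1 / c) * (Poly_Mapping.single 0 c * g r) = g r"
      using assms(4) by (simp add: mult.assoc[symmetric] mult_single)
    ultimately show ?thesis
      by (simp add: sum_distrib_left mult.assoc sum_negf)
  qed
  have gS: "g \<in> vspan (S - {g})" 
    unfolding vspan_def by (intro CollectI exI[of _ ?b] ext g)
  have "h \<in> vspan (S - {g})" if "h \<in> S" for h
    using gS vspan_base[of "S - {g}" h] assms(1) that by (cases "h = g") auto
  then show ?thesis by (auto simp: vspan_def[of S] intro!: vspan_sum vspan_scale)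
qed

text \<open>The columns of \<open>A\<close> are a homogeneous generating set of \<open>M\<close> of
  least cardinality. They have no constant terms because vectors of \<open>M\<close> have none. The
  last conclusion is the hypothesis \<open>const\<close> for the kernel, which is what permits
  iteration.\<close>

lemma resolution_step:
  assumes M: "graded_submod D M" and const: "\<forall>v\<in>M. \<forall>k. Poly_Mapping.lookup (v k) 0 = 0"
  shows "\<exists>D' A. (\<forall>r k. r \<ge> length D \<or> k \<ge> length D' \<longrightarrow> A r k = 0) \<and>
    (\<forall>r<length D. \<forall>k<length D'. homogeneous (D' ! k - D ! r) (A r k)) \<and>
    (\<forall>r k. Poly_Mapping.lookup (A r k) 0 = 0) \<and>
    mat_apply D' A ` free_mod D' = M \<and>
    (\<forall>v \<in> free_mod D'. mat_apply D' A v = (\<lambda>_. 0) \<longrightarrow> (\<forall>k. Poly_Mapping.lookup (v k) 0 = 0))"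
proof -
  let ?P = "\<lambda>S. finite S \<and> S \<subseteq> M \<and> (\<forall>g\<in>S. \<exists>n. vhom D n g) \<and> M \<subseteq> vspan S"
  obtain S0 where "?P S0" using graded_submod_generators[OF M] ..
  from ex_has_least_nat[of ?P, OF this, of card]
  obtain S where S': "?P S \<and> (\<forall>S'. ?P S' \<longrightarrow> card S \<le> card S')" ..
  then have S: "?P S" by (rule conjunct1)
  have min: "card S \<le> card S'" if "?P S'" for S'
    by (rule mp[OF spec[OF conjunct2[OF S']] that])
  have "\<exists>d. \<forall>g\<in>S. vhom D (d g) g" by (rule bchoice) (use S in blast)
  then obtain d where d: "\<And>g. g \<in> S \<Longrightarrow> vhom D (d g) g" by blast
  obtain xs where xs: "set xs = S" "distinct xs" using finite_distinct_list[of S] S by blast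
  define D' where "D' = map d xs"
  define A where "A = (\<lambda>r k. if k < length xs then (xs ! k) r else 0)"
  have len: "length D' = length xs" by (simp add: D'_def)
  have bij: "bij_betw (\<lambda>i. xs ! i) {..<length xs} S"
    using xs by (intro bij_betw_nth) auto
  have nthS: "xs ! k \<in> S" "xs ! k \<in> M" if "k < length xs" for k
    using that S xs(1) by auto
  have subM: "submod (length D) M" using M by (simp add: graded_submod_def)
  \<comment> \<open>The position of a generator in the list, needed to rewrite sums over columns as
    sums over \<open>S\<close>.\<close>
  define ix where "ix = the_inv_into {..<length xs} (\<lambda>i. xs ! i)"
  have ix: "ix (xs ! k) = k" if "k < length xs" for k
    unfolding ix_def by (rule the_inv_into_f_f) (use that bij in \<open>auto simp: bij_betw_def\<close>)
  have app: "mat_apply D' A v r = (\<Sum>g\<in>S. v (ix g) * g r)" for v r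
    unfolding mat_apply_def len
    by (subst sum.reindex_bij_betw[OF bij, symmetric]) (auto simp: A_def ix mult.commute)
  have A0: "A r k = 0" if "r \<ge> length D \<or> k \<ge> length D'" for r k
    using that submod_outside[OF subM nthS(2)] by (auto simp: A_def len)
  have hom: "homogeneous (D' ! k - D ! r) (A r k)" if "r < length D" "k < length D'" for r k
    using d[OF nthS(1)[of k]] that by (simp add: vhom_def D'_def A_def)
  have Ac: "Poly_Mapping.lookup (A r k) 0 = 0" for r k
    using const nthS(2) by (auto simp: A_def)
  have "mat_apply D' A v \<in> M" for v
  proof -
    have "mat_apply D' A v = (\<lambda>r. \<Sum>g\<in>S. v (ix g) * g r)" by (simp add: app fun_eq_iff)
    then show ?thesis using vspan_subset[OF subM, of S] S by (auto simp: vspan_def)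
  qed
  moreover have "v \<in> mat_apply D' A ` free_mod D'" if v: "v \<in> M" for v
  proof -
    obtain c where c: "v = (\<lambda>r. \<Sum>g\<in>S. c g * g r)" using S v by (auto simp: vspan_def)
    let ?w = "\<lambda>k. if k < length xs then c (xs ! k) else 0"
    have "?w (ix g) = c g" if "g \<in> S" for g
      using that ix xs(1) by (metis in_set_conv_nth)
    then have "v = mat_apply D' A ?w" by (simp add: app c fun_eq_iff)
    moreover have "?w \<in> free_mod D'" by (simp add: free_mod_def len)
    ultimately show ?thesis by blast
  qed
  ultimately have img: "mat_apply D' A ` free_mod D' = M" by blast
  have K: "graded_submod D' {v \<in> free_mod D'. mat_apply D' A v = (\<lambda>_. 0)}"
    using graded_submod_kernel[of D' D A] hom A0 by blast
  have "Poly_Mapping.lookup (v k) 0 = 0"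
    if v: "v \<in> free_mod D'" "mat_apply D' A v = (\<lambda>_. 0)" for v k
  proof (rule ccontr)
    assume c: "Poly_Mapping.lookup (v k) 0 \<noteq> 0"
    then have k: "k < length xs" using v(1) by (auto simp: free_mod_def len not_le[symmetric])
    define w where "w = vcomp D' (D' ! k) v"
    have "mat_apply D' A w = (\<lambda>_. 0)" using K v by (auto simp: w_def graded_submod_def)
    then have rel: "(\<Sum>g\<in>S. w (ix g) * g r) = 0" for r by (simp add: app[symmetric])
    have "w k = Poly_Mapping.single 0 (Poly_Mapping.lookup (w k) 0)"
      using k by (subst homogeneous_0_iff[symmetric]) (simp add: w_def vcomp_def len)
    also have "Poly_Mapping.lookup (w k) 0 = Poly_Mapping.lookup (v k) 0"
      using k by (simp add: w_def vcomp_def len lookup_hcomp)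
    finally have wk: "w (ix (xs ! k)) = Poly_Mapping.single 0 (Poly_Mapping.lookup (v k) 0)"
      by (simp add: ix k)
    have "vspan S \<subseteq> vspan (S - {xs ! k})"
      by (rule vspan_remove[of S _ "\<lambda>g. w (ix g)"]) (use S nthS(1)[OF k] wk c rel in auto)
    then have "?P (S - {xs ! k})" using S by blast
    then have "card S \<le> card (S - {xs ! k})" by (rule min)
    then show False using S nthS(1)[OF k] by (metis card_Diff1_less not_le)
  qed
  then show ?thesis
    by (intro exI[of _ D'] exI[of _ A] conjI allI impI ballI) (use A0 hom Ac img in simp_all)
qed

theorem min_graded_free_res_exists:
  assumes zero: "0 \<in> I" and add: "\<And>p q. p \<in> I \<Longrightarrow> q \<in> I \<Longrightarrow> p + q \<in> I"
    and mult: "\<And>a p. p \<in> I \<Longrightarrow> a * p \<in> I" and comp: "\<And>n p. p \<in> I \<Longrightarrow> hcomp n p \<in> I"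
    and const: "\<And>p. p \<in> I \<Longrightarrow> Poly_Mapping.lookup p 0 = 0"
  shows "\<exists>D Phi. min_graded_free_res I D Phi"
proof -
  define K0 where "K0 = {v \<in> free_mod [0]. v 0 \<in> I}"
  define good :: "int list \<times> (nat \<Rightarrow> nat \<Rightarrow> poly3) \<times> (nat \<Rightarrow> poly3) set \<Rightarrow> bool" where
    "good = (\<lambda>(D, A, K). graded_submod D K \<and> (\<forall>v\<in>K. \<forall>k. Poly_Mapping.lookup (v k) 0 = 0))"
  \<comment> \<open>A state consists of the shifts of the current free module, the last matrix, and
    the submodule that the next matrix has to cover. That submodule is the kernel of the last
    matrix, or the ideal at the start.\<close>
  define step :: "int list \<times> (nat \<Rightarrow> nat \<Rightarrow> poly3) \<times> (nat \<Rightarrow> poly3) set \<Rightarrow>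
      int list \<times> (nat \<Rightarrow> nat \<Rightarrow> poly3) \<times> (nat \<Rightarrow> poly3) set \<Rightarrow> bool" where
    "step = (\<lambda>(D, _, K) (D', A, K'). (\<forall>r k. r \<ge> length D \<or> k \<ge> length D' \<longrightarrow> A r k = 0) \<and>
    (\<forall>r<length D. \<forall>k<length D'. homogeneous (D' ! k - D ! r) (A r k)) \<and>
    (\<forall>r k. Poly_Mapping.lookup (A r k) 0 = 0) \<and>
    mat_apply D' A ` free_mod D' = K \<and> K' = {v \<in> free_mod D'. mat_apply D' A v = (\<lambda>_. 0)})"
  have K0: "graded_submod [0] K0"
    unfolding graded_submod_def submod_def K0_def
    by (auto simp: free_mod_def vcomp_def zero add mult comp)
  have "Poly_Mapping.lookup (v k) 0 = 0" if "v \<in> K0" for v k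
    using that const by (cases k) (auto simp: K0_def free_mod_def)
  then have g0: "good ([0], \<lambda>_ _. 0, K0)" using K0 by (simp add: good_def)
  have ex: "\<exists>y. good y \<and> step x y" if gx: "good x" for x
  proof -
    obtain D A K where x: "x = (D, A, K)" by (cases x) auto
    then have K: "graded_submod D K" "\<forall>v\<in>K. \<forall>k. Poly_Mapping.lookup (v k) 0 = 0"
      using gx by (simp_all add: good_def)
    obtain D' A' where A': "\<forall>r k. r \<ge> length D \<or> k \<ge> length D' \<longrightarrow> A' r k = 0"
      "\<forall>r<length D. \<forall>k<length D'. homogeneous (D' ! k - D ! r) (A' r k)"
      "\<forall>r k. Poly_Mapping.lookup (A' r k) 0 = 0"
      "mat_apply D' A' ` free_mod D' = K"
      "\<forall>v \<in> free_mod D'. mat_apply D' A' v = (\<lambda>_. 0) \<longrightarrow> (\<forall>k. Poly_Mapping.lookup (v k) 0 = 0)"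
      using resolution_step[OF K] by (elim exE conjE) (rule that)
    let ?y = "(D', A', {v \<in> free_mod D'. mat_apply D' A' v = (\<lambda>_. 0)})"
    have "good ?y" using graded_submod_kernel[of D' D A'] A' by (auto simp: good_def)
    moreover have "step x ?y" using A' by (auto simp: step_def x)
    ultimately show ?thesis by blast
  qed
  \<comment> \<open>Dependent choice carries the invariant \<open>good\<close> along. The initial
    state is encoded in the invariant for \<open>n = 0\<close>.\<close>
  have "\<exists>f. \<forall>n. (good (f n) \<and> (n = 0 \<longrightarrow> f n = ([0], \<lambda>_ _. 0, K0))) \<and> step (f n) (f (Suc n))"
    by (rule dependent_nat_choice) (use g0 ex in auto)
  then obtain f where f: "f 0 = ([0], \<lambda>_ _. 0, K0)" "\<And>n. step (f n) (f (Suc n))" by blast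
  define D where "D = (\<lambda>n. fst (f n))"
  define Phi where "Phi = (\<lambda>n. fst (snd (f n)))"
  define K where "K = (\<lambda>n. snd (snd (f n)))"
  have s: "(\<forall>r k. r \<ge> length (D n) \<or> k \<ge> length (D (Suc n)) \<longrightarrow> Phi (Suc n) r k = 0)"
    "(\<forall>r<length (D n). \<forall>k<length (D (Suc n)). homogeneous (D (Suc n) ! k - D n ! r) (Phi (Suc n) r k))"
    "(\<forall>r k. Poly_Mapping.lookup (Phi (Suc n) r k) 0 = 0)"
    "mat_apply (D (Suc n)) (Phi (Suc n)) ` free_mod (D (Suc n)) = K n"
    "K (Suc n) = {v \<in> free_mod (D (Suc n)). mat_apply (D (Suc n)) (Phi (Suc n)) v = (\<lambda>_. 0)}" for n
    using f(2)[of n] by (auto simp: step_def D_def Phi_def K_def split: prod.splits)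
  have z: "(0, 0, 0) = (0 :: nat \<times> nat \<times> nat)" by (simp add: zero_prod_def)
  have D0: "D 0 = [0]" "K 0 = K0" by (simp_all add: D_def K_def f(1))
  have pos: "(\<forall>i\<ge>1. P i) \<longleftrightarrow> (\<forall>n. P (Suc n))" for P :: "nat \<Rightarrow> bool"
  proof safe
    fix i :: nat assume "\<forall>n. P (Suc n)" "1 \<le> i"
    then show "P i" by (cases i) auto
  qed simp
  have "min_graded_free_res I D Phi"
    unfolding min_graded_free_res_def pos z diff_Suc_1
    using s[of 0] D0 s by (auto simp: K0_def)
  then show ?thesis by blast
qed

section \<open>The second step of a minimal resolution\<close>

text \<open>Makes the constant term multiplicative, being an evaluation.\<close>

lemma poly_eval_origin: "poly_eval p (0, 0, 0) = Poly_Mapping.lookup p 0"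
proof -
  have "mon_eval m (0, 0, 0) = (if m = 0 then 1 else 0)" for m
    by (cases m) (auto simp: mon_eval_simp zero_prod_def)
  then have "poly_eval p (0, 0, 0) =
      (\<Sum>m\<in>Poly_Mapping.keys p. if m = 0 then Poly_Mapping.lookup p m else 0)"
    unfolding poly_eval_def by (intro sum.cong) auto
  then show ?thesis by (simp add: in_keys_iff)
qed

lemma lookup_mult_0: "Poly_Mapping.lookup (p * q) 0 = Poly_Mapping.lookup p 0 * Poly_Mapping.lookup q 0"
  for p q :: poly3
  by (simp add: poly_eval_origin[symmetric])

abbreviation pconst :: "complex \<Rightarrow> poly3" where
  "pconst c \<equiv> Poly_Mapping.single 0 c"

lemma pconst_sum: "pconst (sum f A) = (\<Sum>a\<in>A. pconst (f a))"
  by (induction A rule: infinite_finite_induct) (auto simp: single_add)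

definition unit_vec :: "nat \<Rightarrow> nat \<Rightarrow> poly3" where
  "unit_vec k = (\<lambda>l. if l = k then 1 else 0)"

lemma mat_apply_unit_vec: "k < length D \<Longrightarrow> mat_apply D A (unit_vec k) = (\<lambda>r. A r k)"
proof
  fix r assume "k < length D"
  have "(\<Sum>l<length D. A r l * unit_vec k l) = (\<Sum>l<length D. if l = k then A r k else 0)"
    by (rule sum.cong) (auto simp: unit_vec_def)
  then show "mat_apply D A (unit_vec k) r = A r k"
    using \<open>k < length D\<close> by (simp add: mat_apply_def)
qed

lemma unit_vec_free_mod: "k < length D \<Longrightarrow> unit_vec k \<in> free_mod D"
  by (auto simp: unit_vec_def free_mod_def)

lemma min_resD:
  assumes "min_graded_free_res I D Phi"
  shows "D 0 = [0]"
    and "\<And>i r k. r \<ge> length (D i) \<or> k \<ge> length (D (Suc i)) \<Longrightarrow> Phi (Suc i) r k = 0"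
    and "\<And>i r k. r < length (D i) \<Longrightarrow> k < length (D (Suc i)) \<Longrightarrow>
      homogeneous (D (Suc i) ! k - D i ! r) (Phi (Suc i) r k)"
    and "\<And>i r k. Poly_Mapping.lookup (Phi (Suc i) r k) 0 = 0"
    and "mat_apply (D 1) (Phi 1) ` free_mod (D 1) = {v \<in> free_mod (D 0). v 0 \<in> I}"
    and "\<And>i. {v \<in> free_mod (D (Suc i)). mat_apply (D (Suc i)) (Phi (Suc i)) v = (\<lambda>_. 0)} =
      mat_apply (D (Suc (Suc i))) (Phi (Suc (Suc i))) ` free_mod (D (Suc (Suc i)))"
proof -
  have z: "(0, 0, 0) = (0 :: nat \<times> nat \<times> nat)" by (simp add: zero_prod_def)
  note * = assms[unfolded min_graded_free_res_def z]
  show "D 0 = [0]" by (rule *[THEN conjunct1])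
  note * = *[THEN conjunct2]
  show "Phi (Suc i) r k = 0" if "r \<ge> length (D i) \<or> k \<ge> length (D (Suc i))" for i r k
    using *[THEN conjunct1, rule_format, of "Suc i" r k] that by simp
  note * = *[THEN conjunct2]
  show "homogeneous (D (Suc i) ! k - D i ! r) (Phi (Suc i) r k)"
    if "r < length (D i)" "k < length (D (Suc i))" for i r k
    using *[THEN conjunct1, rule_format, of "Suc i" r k] that by simp
  note * = *[THEN conjunct2]
  show "Poly_Mapping.lookup (Phi (Suc i) r k) 0 = 0" for i r k
    using *[THEN conjunct1, rule_format, of "Suc i" r k] by simp
  note * = *[THEN conjunct2]
  show "mat_apply (D 1) (Phi 1) ` free_mod (D 1) = {v \<in> free_mod (D 0). v 0 \<in> I}"
    by (rule *[THEN conjunct1])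
  note * = *[THEN conjunct2]
  show "{v \<in> free_mod (D (Suc i)). mat_apply (D (Suc i)) (Phi (Suc i)) v = (\<lambda>_. 0)} =
      mat_apply (D (Suc (Suc i))) (Phi (Suc (Suc i))) ` free_mod (D (Suc (Suc i)))" for i
    using *[rule_format, of "Suc i"] by simp
qed

text \<open>The working form of minimality: a kernel vector is an image under the next matrix, whose
  entries have no constant terms.\<close>

lemma min_res_kernel_no_const:
  assumes "min_graded_free_res I D Phi" "v \<in> free_mod (D (Suc i))"
    "mat_apply (D (Suc i)) (Phi (Suc i)) v = (\<lambda>_. 0)"
  shows "Poly_Mapping.lookup (v k) 0 = 0"
proof -
  obtain w where "v = mat_apply (D (Suc (Suc i))) (Phi (Suc (Suc i))) w"
    using min_resD(6)[OF assms(1), of i] assms(2,3) by blast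
  then show ?thesis
    by (simp add: mat_apply_def lookup_sum lookup_mult_0 min_resD(4)[OF assms(1)])
qed

text \<open>If the column were zero, the unit vector with constant entry 1 would lie in the
  kernel.\<close>

lemma min_res_column_nonzero:
  assumes res: "min_graded_free_res I D Phi" and k: "k < length (D (Suc i))"
  obtains r where "r < length (D i)" "Phi (Suc i) r k \<noteq> 0"
proof (rule ccontr)
  assume *: "\<not> thesis"
  have "Phi (Suc i) r k = 0" for r
    using * that[of r] min_resD(2)[OF res, of i r k] by (cases "r < length (D i)") auto
  then have "mat_apply (D (Suc i)) (Phi (Suc i)) (unit_vec k) = (\<lambda>_. 0)"
    by (simp add: mat_apply_unit_vec k)
  from min_res_kernel_no_const[OF res unit_vec_free_mod[OF k] this, of k]
  show False by (simp add: unit_vec_def)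
qed

definition span_ideal :: "nat \<Rightarrow> (nat \<Rightarrow> poly3) \<Rightarrow> poly3 set" where
  "span_ideal n f = {\<Sum>i<n. a i * f i | a. True}"

text \<open>The first syzygy matrix of a minimal resolution is the given system of generators up to an
  invertible change of basis over the complex numbers.\<close>
lemma min_res_first_map:
  assumes hom: "\<forall>i<n. homogeneous e (f i)"
    and ind: "\<forall>a. (\<Sum>i<n. pconst (a i) * f i) = 0 \<longrightarrow> (\<forall>i<n. a i = 0)"
    and res: "min_graded_free_res (span_ideal n f) D Phi"
  shows "\<exists>b c. (\<forall>k<length (D 1). D 1 ! k = e) \<and>
    (\<forall>k<length (D 1). Phi 1 0 k = (\<Sum>i<n. pconst (b k i) * f i)) \<and>
    (\<forall>i<n. f i = (\<Sum>k<length (D 1). pconst (c i k) * Phi 1 0 k)) \<and>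
    (\<forall>k<length (D 1). \<forall>l<length (D 1). (\<Sum>i<n. b k i * c i l) = (if k = l then 1 else 0)) \<and>
    (\<forall>i<n. \<forall>j<n. (\<Sum>k<length (D 1). c i k * b k j) = (if i = j then 1 else 0))"
proof -
  let ?L = "length (D 1)"
  define g where "g = Phi 1 0"
  note R = min_resD[OF res]
  have R0: "Phi 1 r k = 0" if "r \<noteq> 0" for r k
    using R(2)[of 0 r k] R(1) that by simp
  have ghom: "homogeneous (D 1 ! k) (g k)" if "k < ?L" for k
    using R(3)[of 0 0 k] R(1) that by (simp add: g_def)
  have gne: "g k \<noteq> 0" if "k < ?L" for k
    using min_res_column_nonzero[OF res, of k 0] R(1) that by (auto simp: g_def)
  have "\<exists>a. g k = (\<Sum>i<n. a i * f i)" if "k < ?L" for k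
  proof -
    have "(\<lambda>r. Phi 1 r k) \<in> mat_apply (D 1) (Phi 1) ` free_mod (D 1)"
      using mat_apply_unit_vec[OF that, of "Phi 1"] unit_vec_free_mod[OF that] by force
    then show ?thesis using R(5) by (auto simp: g_def span_ideal_def)
  qed
  then have "\<exists>a. \<forall>k\<in>{..<?L}. g k = (\<Sum>i<n. a k i * f i)" by (intro bchoice) auto
  then obtain B where B: "\<And>k. k < ?L \<Longrightarrow> g k = (\<Sum>i<n. B k i * f i)" by auto
  \<comment> \<open>Only the component of degree \<open>D 1 ! k\<close> counts, so the coefficients
    can be taken homogeneous of degree \<open>D 1 ! k - e\<close>.\<close>
  have Bh: "g k = (\<Sum>i<n. hcomp (D 1 ! k - e) (B k i) * f i)" if "k < ?L" for k
  proof -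
    have "g k = hcomp (D 1 ! k) (\<Sum>i<n. f i * B k i)"
      using B[OF that] hcomp_homogeneous[OF ghom[OF that], of "D 1 ! k"] by (simp add: mult.commute)
    also have "\<dots> = (\<Sum>i<n. hcomp (D 1 ! k - e) (B k i) * f i)"
      unfolding hcomp_sum by (intro sum.cong) (auto simp: hcomp_mult[OF hom[rule_format]] mult.commute)
    finally show ?thesis .
  qed
  \<comment> \<open>A nonzero element of an ideal generated in degree \<open>e\<close> cannot have
    smaller degree: all its coefficients would have negative degree.\<close>
  have ge: "D 1 ! k \<ge> e" if "k < ?L" for k
  proof (rule ccontr)
    assume "\<not> D 1 ! k \<ge> e"
    then have "hcomp (D 1 ! k - e) (B k i) = 0" for i
      using homogeneous_neg[OF homogeneous_hcomp] by simp
    then show False using Bh[OF that] gne[OF that] by simp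
  qed
  \<comment> \<open>Generators of degree above \<open>e\<close> cannot contribute to
    \<open>f i\<close>. By \<open>ge\<close> the others have degree exactly \<open>e\<close>, and
    their coefficients are constants.\<close>
  have "\<exists>c. f i = (\<Sum>k<?L. pconst (c k) * g k) \<and> (\<forall>k<?L. D 1 ! k \<noteq> e \<longrightarrow> c k = 0)" if "i < n" for i
  proof -
    let ?v = "\<lambda>r :: nat. if r = 0 then f i else 0"
    have "f i = (\<Sum>j<n. (if j = i then 1 else 0) * f j)"
      using that by (subst sum.remove[of _ i]) auto
    then have "f i \<in> span_ideal n f"
      unfolding span_ideal_def by (intro CollectI exI[of _ "\<lambda>j. if j = i then 1 else 0"]) simp
    then have "?v \<in> {v \<in> free_mod (D 0). v 0 \<in> span_ideal n f}"
      by (simp add: free_mod_def R(1))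
    then obtain w where "?v = mat_apply (D 1) (Phi 1) w" unfolding R(5)[symmetric] by blast
    from fun_cong[OF this, of 0] have "f i = (\<Sum>k<?L. g k * w k)"
      by (simp add: mat_apply_def g_def)
    then have "f i = (\<Sum>k<?L. g k * hcomp (e - D 1 ! k) (w k))"
      using hcomp_homogeneous[OF hom[rule_format, OF that], of e]
      by (simp add: hcomp_sum hcomp_mult[OF ghom])
    also have "\<dots> = (\<Sum>k<?L. pconst (if D 1 ! k = e then Poly_Mapping.lookup (w k) 0 else 0) * g k)"
    proof (rule sum.cong)
      fix k assume "k \<in> {..<?L}"
      then have "D 1 ! k = e \<or> D 1 ! k > e" using ge[of k] by auto
      then have "hcomp (e - D 1 ! k) (w k) =
          pconst (if D 1 ! k = e then Poly_Mapping.lookup (w k) 0 else 0)"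
      proof
        assume "D 1 ! k = e"
        then show ?thesis
          using homogeneous_0_iff[of "hcomp 0 (w k)"] by (simp add: lookup_hcomp)
      next
        assume "D 1 ! k > e"
        then show ?thesis using homogeneous_neg[OF homogeneous_hcomp] by simp
      qed
      then show "g k * hcomp (e - D 1 ! k) (w k) =
          pconst (if D 1 ! k = e then Poly_Mapping.lookup (w k) 0 else 0) * g k"
        by (simp add: mult.commute)
    qed simp
    finally show ?thesis
      by (intro exI[of _ "\<lambda>k. if D 1 ! k = e then Poly_Mapping.lookup (w k) 0 else 0"]) simp
  qed
  then have "\<exists>c. \<forall>i\<in>{..<n}. f i = (\<Sum>k<?L. pconst (c i k) * g k) \<and>
      (\<forall>k<?L. D 1 ! k \<noteq> e \<longrightarrow> c i k = 0)" by (intro bchoice) auto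
  then obtain c where c: "\<And>i. i < n \<Longrightarrow> f i = (\<Sum>k<?L. pconst (c i k) * g k)"
    "\<And>i k. i < n \<Longrightarrow> k < ?L \<Longrightarrow> D 1 ! k \<noteq> e \<Longrightarrow> c i k = 0" by auto
  \<comment> \<open>Expanding each \<open>f i\<close> in the \<open>g l\<close> turns the
    representation of \<open>g k\<close> into a relation among the \<open>g l\<close>. Its
    coefficients have no constant terms by minimality, which gives a matrix identity over the
    complex numbers.\<close>
  have rel: "(\<Sum>i<n. Poly_Mapping.lookup (A i) 0 * c i l) = (if k = l then 1 else 0)"
    if k: "k < ?L" and l: "l < ?L" and A: "g k = (\<Sum>i<n. A i * f i)" for k l A
  proof -
    let ?v = "\<lambda>l. if l < ?L then (if l = k then 1 else 0) - (\<Sum>i<n. A i * pconst (c i l)) else 0"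
    have "(\<Sum>l<?L. g l * ?v l) = (\<Sum>l<?L. (if l = k then g k else 0) - (\<Sum>i<n. A i * pconst (c i l) * g l))"
      by (rule sum.cong) (auto simp: algebra_simps sum_distrib_left)
    also have "\<dots> = g k - (\<Sum>i<n. \<Sum>l<?L. A i * pconst (c i l) * g l)"
      using k by (simp add: sum_subtractf sum.swap[of _ "{..<n}"])
    also have "(\<Sum>i<n. \<Sum>l<?L. A i * pconst (c i l) * g l) = (\<Sum>i<n. A i * f i)"
      by (intro sum.cong) (auto simp: c(1) sum_distrib_left mult.assoc)
    finally have "(\<Sum>l<?L. g l * ?v l) = 0" using A by simp
    then have "mat_apply (D 1) (Phi 1) ?v r = 0" for r
      by (cases "r = 0") (simp_all add: mat_apply_def R0 g_def del: One_nat_def)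
    then have "mat_apply (D (Suc 0)) (Phi (Suc 0)) ?v = (\<lambda>_. 0)" by auto
    moreover have "?v \<in> free_mod (D (Suc 0))" by (simp add: free_mod_def)
    ultimately have "Poly_Mapping.lookup (?v l) 0 = 0"
      using min_res_kernel_no_const[OF res, of ?v 0 l] by blast
    then show ?thesis using l
      by (auto simp: lookup_minus lookup_sum lookup_mult_0 split: if_splits)
  qed
  \<comment> \<open>If \<open>D 1 ! k\<close> differs from \<open>e\<close>, all
    \<open>c i k\<close> are 0 and \<open>rel\<close> with \<open>l = k\<close> reads 0 = 1.\<close>
  have De: "D 1 ! k = e" if "k < ?L" for k
  proof (rule ccontr)
    assume "D 1 ! k \<noteq> e"
    then show False using rel[OF that that B[OF that]] c(2)[OF _ that] by simp
  qed
  define b where "b = (\<lambda>k i. Poly_Mapping.lookup (B k i) 0)"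
  have b: "g k = (\<Sum>i<n. pconst (b k i) * f i)" if "k < ?L" for k
  proof -
    have "hcomp 0 (B k i) = pconst (b k i)" for i
      using homogeneous_0_iff[of "hcomp 0 (B k i)"] by (simp add: lookup_hcomp b_def)
    then show ?thesis using Bh[OF that] De[OF that] by simp
  qed
  have bc: "(\<Sum>i<n. b k i * c i l) = (if k = l then 1 else 0)" if "k < ?L" "l < ?L" for k l
    using rel[OF that B[OF that(1)]] by (simp add: b_def)
  \<comment> \<open>The other product of the two matrices: substitute in the opposite order and
    compare coefficients, using the linear independence of the \<open>f i\<close> over the complex
    numbers.\<close>
  have cb: "(\<Sum>k<?L. c i k * b k j) = (if i = j then 1 else 0)" if "i < n" "j < n" for i j
  proof -
    have "f i = (\<Sum>k<?L. \<Sum>j<n. pconst (c i k * b k j) * f j)"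
      using c(1)[OF that(1)]
      by (simp add: b sum_distrib_left mult.assoc[symmetric] mult_single)
    also have "\<dots> = (\<Sum>j<n. pconst (\<Sum>k<?L. c i k * b k j) * f j)"
      by (subst sum.swap) (simp add: pconst_sum sum_distrib_right)
    finally have "(\<Sum>j<n. pconst (\<Sum>k<?L. c i k * b k j) * f j) - f i = 0" by simp
    moreover have "f i = (\<Sum>j<n. pconst (if i = j then 1 else 0) * f j)"
      using that(1) by (subst sum.remove[of _ i]) auto
    ultimately have "(\<Sum>j<n. pconst (\<Sum>k<?L. c i k * b k j) * f j) -
        (\<Sum>j<n. pconst (if i = j then 1 else 0) * f j) = 0" by argo
    then have "(\<Sum>j<n. pconst ((\<Sum>k<?L. c i k * b k j) - (if i = j then 1 else 0)) * f j) = 0"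
      by (simp add: single_diff left_diff_distrib sum_subtractf)
    from ind[rule_format, OF this] that(2) show ?thesis by simp
  qed
  show ?thesis
    by (intro exI[of _ b] exI[of _ c] conjI allI impI
        De b[unfolded g_def] c(1)[unfolded g_def] bc cb)
qed

text \<open>A nonzero syzygy of degree \<open>r\<close> becomes a nonzero kernel vector of degree
  \<open>e + r\<close>. It is a combination of the columns of \<open>Phi 2\<close>, so they cannot
  all have larger degree.\<close>

lemma min_res_second_degree_le:
  assumes hom: "\<forall>i<n. homogeneous e (f i)"
    and ind: "\<forall>a. (\<Sum>i<n. pconst (a i) * f i) = 0 \<longrightarrow> (\<forall>i<n. a i = 0)"
    and res: "min_graded_free_res (span_ideal n f) D Phi"
    and syz: "\<And>i. i < n \<Longrightarrow> homogeneous r (a i)" "(\<Sum>i<n. a i * f i) = 0" "j < n" "a j \<noteq> 0"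
  shows "\<exists>m<length (D 2). D 2 ! m \<le> e + r"
proof (rule ccontr)
  assume "\<not> ?thesis"
  then have gt: "D 2 ! m > e + r" if "m < length (D 2)" for m using that by force
  let ?L = "length (D 1)"
  obtain b c where bcf: "\<forall>k<?L. D 1 ! k = e"
    "\<forall>k<?L. Phi 1 0 k = (\<Sum>i<n. pconst (b k i) * f i)"
    "\<forall>i<n. f i = (\<Sum>k<?L. pconst (c i k) * Phi 1 0 k)"
    "\<forall>k<?L. \<forall>l<?L. (\<Sum>i<n. b k i * c i l) = (if k = l then 1 else 0)"
    "\<forall>i<n. \<forall>j<n. (\<Sum>k<?L. c i k * b k j) = (if i = j then 1 else 0)"
    using min_res_first_map[OF hom ind res] by (elim exE conjE) (rule that)
  note De = bcf(1)[rule_format] and b = bcf(2)[rule_format] and c = bcf(3)[rule_format]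
    and bc = bcf(4)[rule_format] and cb = bcf(5)[rule_format]
  note R = min_resD[OF res]
  \<comment> \<open>The syzygy rewritten for the generators \<open>Phi 1 0 k\<close> instead of the
    \<open>f i\<close>.\<close>
  define v where "v = (\<lambda>k. if k < ?L then (\<Sum>i<n. a i * pconst (c i k)) else 0)"
  have "(\<Sum>k<?L. Phi 1 0 k * v k) = (\<Sum>k<?L. \<Sum>i<n. a i * (pconst (c i k) * Phi 1 0 k))"
    by (rule sum.cong) (auto simp: v_def sum_distrib_left mult_ac)
  also have "\<dots> = (\<Sum>i<n. a i * f i)"
    by (subst sum.swap) (auto simp: c sum_distrib_left intro!: sum.cong)
  finally have "(\<Sum>k<?L. Phi 1 0 k * v k) = 0" using syz(2) by simp
  then have "mat_apply (D 1) (Phi 1) v r' = 0" for r'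
    using R(2)[of 0 r'] R(1) by (cases "r' = 0") (simp_all add: mat_apply_def)
  then have "v \<in> {v \<in> free_mod (D 1). mat_apply (D 1) (Phi 1) v = (\<lambda>_. 0)}"
    by (auto simp: free_mod_def v_def)
  then have "v \<in> mat_apply (D 2) (Phi 2) ` free_mod (D 2)"
    using R(6)[of 0] by (simp add: numeral_2_eq_2)
  then obtain w where w: "v = mat_apply (D 2) (Phi 2) w" by blast
  \<comment> \<open>Entry \<open>k\<close> has degree \<open>r\<close>, whereas column
    \<open>m\<close> has degree \<open>D 2 ! m - e > r\<close> there, so its coefficient would need
    negative degree.\<close>
  have "v k = 0" if k: "k < ?L" for k
  proof -
    have "homogeneous r (a i * pconst x)" if "i < n" for i x
      using homogeneous_mult[OF syz(1)[OF that] homogeneous_const[of x]] by simp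
    then have "homogeneous r (v k)" by (auto simp: v_def intro!: homogeneous_sum)
    then have "v k = hcomp r (v k)" using hcomp_homogeneous[of r "v k" r] by simp
    also have "\<dots> = (\<Sum>m<length (D 2). hcomp r (Phi 2 k m * w m))"
      by (simp add: w mat_apply_def hcomp_sum)
    also have "\<dots> = 0"
    proof (rule sum.neutral, safe)
      fix m assume m: "m < length (D 2)"
      have "homogeneous (D 2 ! m - e) (Phi 2 k m)"
        using R(3)[of k 1 m] m k De[OF k] by (simp add: numeral_2_eq_2)
      then have "hcomp r (Phi 2 k m * w m) = Phi 2 k m * hcomp (r - (D 2 ! m - e)) (w m)"
        by (rule hcomp_mult)
      also have "hcomp (r - (D 2 ! m - e)) (w m) = 0"
        by (rule homogeneous_neg[OF homogeneous_hcomp]) (use gt[OF m] in simp)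
      finally show "hcomp r (Phi 2 k m * w m) = 0" by simp
    qed
    finally show ?thesis .
  qed
  \<comment> \<open>Multiplying by \<open>b\<close> undoes the change of generators and returns
    \<open>a j\<close>, which would be 0.\<close>
  then have "0 = (\<Sum>k<?L. v k * pconst (b k j))" by simp
  also have "\<dots> = (\<Sum>k<?L. \<Sum>i<n. a i * pconst (c i k * b k j))"
    by (rule sum.cong) (auto simp: v_def sum_distrib_right mult.assoc mult_single)
  also have "\<dots> = (\<Sum>i<n. a i * pconst (\<Sum>k<?L. c i k * b k j))"
    by (subst sum.swap) (simp add: pconst_sum sum_distrib_left)
  also have "\<dots> = (\<Sum>i<n. if i = j then a j else 0)"
    by (rule sum.cong) (auto simp: cb syz(3) simp del: One_nat_def)
  also have "\<dots> = a j" using syz(3) by simp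
  finally show False using syz(4) by simp
qed

text \<open>Conversely, column \<open>m\<close> of \<open>Phi 2\<close> is a nonzero kernel vector
  of the first map. The change of generators carries it back to the \<open>f i\<close>.\<close>

lemma min_res_second_degree_syzygy:
  assumes hom: "\<forall>i<n. homogeneous e (f i)"
    and ind: "\<forall>a. (\<Sum>i<n. pconst (a i) * f i) = 0 \<longrightarrow> (\<forall>i<n. a i = 0)"
    and res: "min_graded_free_res (span_ideal n f) D Phi"
    and m: "m < length (D 2)"
  shows "\<exists>a. (\<forall>i<n. homogeneous (D 2 ! m - e) (a i)) \<and> (\<Sum>i<n. a i * f i) = 0 \<and> (\<exists>j<n. a j \<noteq> 0)"
proof -
  let ?L = "length (D 1)"
  obtain b c where bcf: "\<forall>k<?L. D 1 ! k = e"
    "\<forall>k<?L. Phi 1 0 k = (\<Sum>i<n. pconst (b k i) * f i)"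
    "\<forall>i<n. f i = (\<Sum>k<?L. pconst (c i k) * Phi 1 0 k)"
    "\<forall>k<?L. \<forall>l<?L. (\<Sum>i<n. b k i * c i l) = (if k = l then 1 else 0)"
    "\<forall>i<n. \<forall>j<n. (\<Sum>k<?L. c i k * b k j) = (if i = j then 1 else 0)"
    using min_res_first_map[OF hom ind res] by (elim exE conjE) (rule that)
  note De = bcf(1)[rule_format] and b = bcf(2)[rule_format] and c = bcf(3)[rule_format]
    and bc = bcf(4)[rule_format] and cb = bcf(5)[rule_format]
  note R = min_resD[OF res]
  define u where "u = (\<lambda>k. Phi 2 k m)"
  have "u = mat_apply (D 2) (Phi 2) (unit_vec m)" using m by (simp add: mat_apply_unit_vec u_def)
  then have "u \<in> mat_apply (D 2) (Phi 2) ` free_mod (D 2)" using unit_vec_free_mod[OF m] by blast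
  then have "mat_apply (D 1) (Phi 1) u = (\<lambda>_. 0)"
    using R(6)[of 0] by (auto simp: numeral_2_eq_2)
  from fun_cong[OF this, of 0] have ker: "(\<Sum>k<?L. Phi 1 0 k * u k) = 0" by (simp add: mat_apply_def)
  define a where "a = (\<lambda>i. \<Sum>k<?L. u k * pconst (b k i))"
  have uhom: "homogeneous (D 2 ! m - e) (u k)" if "k < ?L" for k
    using R(3)[of k 1 m] m that De[OF that] by (simp add: numeral_2_eq_2 u_def)
  have "homogeneous (D 2 ! m - e + 0) (a i)" for i
    unfolding a_def by (intro homogeneous_sum homogeneous_mult uhom homogeneous_const) simp
  then have ahom: "homogeneous (D 2 ! m - e) (a i)" for i by simp
  have "(\<Sum>i<n. a i * f i) = (\<Sum>i<n. \<Sum>k<?L. u k * (pconst (b k i) * f i))"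
    by (simp add: a_def sum_distrib_right mult.assoc)
  also have "\<dots> = (\<Sum>k<?L. Phi 1 0 k * u k)"
    by (subst sum.swap)
       (auto simp: b sum_distrib_right sum_distrib_left mult_ac simp del: One_nat_def intro!: sum.cong)
  finally have asum: "(\<Sum>i<n. a i * f i) = 0" using ker by simp
  \<comment> \<open>If all \<open>a i\<close> were 0, inverting the change of generators would make
    column \<open>m\<close> zero.\<close>
  have "\<exists>j<n. a j \<noteq> 0"
  proof (rule ccontr)
    assume *: "\<not> ?thesis"
    have "u l = 0" if l: "l < ?L" for l
    proof -
      have "u l = (\<Sum>k<?L. if k = l then u l else 0)" using l by simp
      also have "\<dots> = (\<Sum>k<?L. u k * pconst (\<Sum>i<n. b k i * c i l))"
        by (rule sum.cong) (auto simp: bc l simp del: One_nat_def)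
      also have "\<dots> = (\<Sum>i<n. a i * pconst (c i l))"
        unfolding pconst_sum a_def sum_distrib_left sum_distrib_right
        by (subst sum.swap) (simp add: mult.assoc mult_single)
      also have "\<dots> = 0" using * by simp
      finally show ?thesis .
    qed
    then show False
      using min_res_column_nonzero[OF res, of m 1] m by (auto simp: u_def numeral_2_eq_2)
  qed
  then show ?thesis using ahom asum by (intro exI[of _ a]) simp
qed

section \<open>Comparison of two minimal resolutions\<close>

lemma homogeneous_power: "homogeneous 1 p \<Longrightarrow> homogeneous (int k) (p ^ k)"
proof (induction k)
  case 0
  then show ?case using homogeneous_const[of 1] by simp
next
  case (Suc k)
  then show ?case using homogeneous_mult[of 1 p "int k" "p ^ k"] by simp
qed

text \<open>Multiplication by a power of \<open>var_x\<close> raises a syzygy to degree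
  \<open>r\<close>, and it is injective.\<close>

lemma no_syzygy_lower_degree:
  assumes "\<And>a. \<forall>i<n. homogeneous r (a i) \<Longrightarrow> (\<Sum>i<n. a i * f i) = 0 \<Longrightarrow> \<forall>i<n. a i = 0"
    and "s \<le> r" "\<forall>i<n. homogeneous s (a i)" "(\<Sum>i<n. a i * f i) = 0"
  shows "\<forall>i<n. a i = 0"
proof -
  define k where "k = nat (r - s)"
  have "homogeneous (int k) (var_x ^ k)"
    by (rule homogeneous_power) (simp add: var_lin_poly homogeneous_lin_poly)
  then have "homogeneous r (var_x ^ k * a i)" if "i < n" for i
    using homogeneous_mult[of "int k" "var_x ^ k" s "a i"] assms(2,3) that by (simp add: k_def)
  moreover have "(\<Sum>i<n. var_x ^ k * a i * f i) = 0"
    using assms(4) by (simp add: mult.assoc sum_distrib_left[symmetric])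
  ultimately have "\<forall>i<n. var_x ^ k * a i = 0" by (intro assms(1)) auto
  moreover have "poly_eval var_x (1, 0, 0) = 1" by simp
  then have "var_x \<noteq> 0" by (metis poly_eval_zero zero_neq_one)
  ultimately show ?thesis by simp
qed

lemma graded_betti_differ:
  assumes hom: "\<forall>i<n. homogeneous e (f i)" "\<forall>i<n. homogeneous e (g i)"
    and ind: "\<forall>a. (\<Sum>i<n. pconst (a i) * f i) = 0 \<longrightarrow> (\<forall>i<n. a i = 0)"
      "\<forall>a. (\<Sum>i<n. pconst (a i) * g i) = 0 \<longrightarrow> (\<forall>i<n. a i = 0)"
    and syz: "\<And>i. i < n \<Longrightarrow> homogeneous r (a i)" "(\<Sum>i<n. a i * f i) = 0" "j < n" "a j \<noteq> 0"
    and no_syz: "\<And>a. \<forall>i<n. homogeneous r (a i) \<Longrightarrow> (\<Sum>i<n. a i * g i) = 0 \<Longrightarrow> \<forall>i<n. a i = 0"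
    and res: "min_graded_free_res (span_ideal n f) D1 Phi1"
      "min_graded_free_res (span_ideal n g) D2 Phi2"
  shows "\<exists>i j. graded_betti D1 i j \<noteq> graded_betti D2 i j"
proof (rule ccontr)
  assume "\<not> ?thesis"
  then have eq: "graded_betti D1 2 d = graded_betti D2 2 d" for d by blast
  obtain m where m: "m < length (D1 2)" "D1 2 ! m \<le> e + r"
    using min_res_second_degree_le[OF hom(1) ind(1) res(1) syz] by blast
  have "D1 2 ! m \<in> set (D1 2)" using m(1) by simp
  then have "D1 2 ! m \<in> set (D2 2)"
    using eq[of "D1 2 ! m"] unfolding graded_betti_def by (metis count_list_0_iff)
  then obtain m' where m': "m' < length (D2 2)" "D2 2 ! m' = D1 2 ! m"
    by (auto simp: in_set_conv_nth)
  obtain a where a: "\<forall>i<n. homogeneous (D2 2 ! m' - e) (a i)" "(\<Sum>i<n. a i * g i) = 0"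
    "\<exists>j<n. a j \<noteq> 0"
    using min_res_second_degree_syzygy[OF hom(2) ind(2) res(2) m'(1)]
    by - (erule exE, elim conjE, rule that)
  have "D2 2 ! m' - e \<le> r" using m(2) m'(2) by simp
  from no_syzygy_lower_degree[of n r g, OF no_syz this a(1,2)] a(3) show False by blast
qed

section \<open>Line arrangements\<close>

definition cross :: "vec3 \<Rightarrow> vec3 \<Rightarrow> vec3" where
  "cross l m = (case l of (a, b, c) \<Rightarrow> case m of (a', b', c') \<Rightarrow>
     (b * c' - c * b', c * a' - a * c', a * b' - b * a'))"

text \<open>The determinant of the three coefficient vectors. For distinct lines \<open>m\<close>
  and \<open>n\<close> it vanishes exactly if \<open>l\<close> passes through their common
  point.\<close>

definition det3 :: "vec3 \<Rightarrow> vec3 \<Rightarrow> vec3 \<Rightarrow> complex" where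
  "det3 l m n = lin_eval l (cross m n)"

lemma zero_vec3: "(0 :: vec3) = (0, 0, 0)"
  by (simp add: zero_prod_def)

lemma lin_eval_cross [simp]: "lin_eval l (cross l m) = 0" "lin_eval m (cross l m) = 0"
  by (cases l; cases m; simp add: lin_eval_def cross_def algebra_simps)+

lemma lin_eval_smult3 [simp]: "lin_eval l (smult3 c v) = c * lin_eval l v"
  by (cases l; cases v) (simp add: lin_eval_def smult3_def algebra_simps)

lemma lin_eval_zero [simp]: "lin_eval l 0 = 0" "lin_eval l (0, 0, 0) = 0"
  by (simp_all add: lin_eval_def zero_vec3 split: prod.splits)

lemma smult3_smult3 [simp]: "smult3 c (smult3 d u) = smult3 (c * d) u"
  by (simp add: smult3_def split: prod.splits)

lemma proj_pt_smult3:
  assumes "s \<noteq> 0"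
  shows "proj_pt (smult3 s u) = proj_pt u"
proof -
  have "smult3 c u = smult3 (c / s) (smult3 s u)" for c using assms by simp
  then have "\<exists>d. smult3 c u = smult3 d (smult3 s u)" for c by blast
  then show ?thesis unfolding proj_pt_def by auto
qed

lemma parallel_if_cross_zero:
  assumes "cross v w = 0" "w \<noteq> 0"
  shows "\<exists>c. v = smult3 c w"
proof -
  obtain a b c p q r where v: "v = (a, b, c)" and w: "w = (p, q, r)" by (cases v; cases w) auto
  have e: "b * r = c * q" "c * p = a * r" "a * q = b * p"
    using assms(1) by (simp_all add: cross_def v w zero_vec3)
  consider "p \<noteq> 0" | "q \<noteq> 0" | "r \<noteq> 0" using assms(2) by (auto simp: w zero_vec3)
  then show ?thesis
  proof cases
    case 1
    then show ?thesis using e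
      by (intro exI[of _ "a / p"]) (auto simp: v w smult3_def field_simps)
  next
    case 2
    then show ?thesis using e
      by (intro exI[of _ "b / q"]) (auto simp: v w smult3_def field_simps)
  next
    case 3
    then show ?thesis using e
      by (intro exI[of _ "c / r"]) (auto simp: v w smult3_def field_simps)
  qed
qed

text \<open>By the double cross product identity, v x (l x m) is a combination of l and m with
  coefficients m(v) and -l(v), hence 0.\<close>

lemma meet_eq_cross:
  assumes "cross l m \<noteq> 0" "lin_eval l v = 0" "lin_eval m v = 0"
  shows "\<exists>c. v = smult3 c (cross l m)"
proof (rule parallel_if_cross_zero[OF _ assms(1)])
  obtain x y z a b c p q r where v: "v = (x, y, z)" and l: "l = (a, b, c)" and m: "m = (p, q, r)"
    by (cases v; cases l; cases m) auto
  have "a * x + b * y + c * z = 0" "p * x + q * y + r * z = 0"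
    using assms(2,3) by (simp_all add: v l m lin_eval_def)
  then show "cross v (cross l m) = 0"
    unfolding v l m cross_def prod.case zero_vec3 prod.inject by algebra
qed

lemma zero_set_subset_imp_cross:
  assumes "zero_set l \<subseteq> zero_set m"
  shows "cross l m = 0"
proof -
  obtain a b c p q r where l: "l = (a, b, c)" and m: "m = (p, q, r)" by (cases l; cases m) auto
  \<comment> \<open>These points lie on \<open>l\<close>, and \<open>m\<close> takes there, up to
    sign, the components of the cross product as values.\<close>
  have "(b, - a, 0) \<in> zero_set m" "(c, 0, - a) \<in> zero_set m" "(0, c, - b) \<in> zero_set m"
    by (rule subsetD[OF assms]; simp add: zero_set_def lin_eval_def l)+
  then show ?thesis
    by (simp add: l m zero_set_def lin_eval_def cross_def zero_vec3 algebra_simps)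
qed

lemma zero_set_zero_iff: "zero_set l = UNIV \<longleftrightarrow> l = 0"
proof
  assume *: "zero_set l = UNIV"
  obtain a b c where l: "l = (a, b, c)" by (cases l) auto
  have "(1, 0, 0) \<in> zero_set l" "(0, 1, 0) \<in> zero_set l" "(0, 0, 1) \<in> zero_set l"
    using * by auto
  then show "l = 0" by (simp add: l zero_set_def lin_eval_def zero_vec3)
qed (auto simp: zero_set_def lin_eval_def zero_vec3)

lemma exists_nonzero_on_line: "\<exists>v. v \<noteq> 0 \<and> v \<in> zero_set l"
proof -
  obtain a b c where l: "l = (a, b, c)" by (cases l) auto
  show ?thesis
  proof (cases "a = 0 \<and> b = 0")
    case True
    then show ?thesis
      by (intro exI[of _ "(1, 0, 0)"]) (simp add: l zero_set_def lin_eval_def zero_vec3)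
  next
    case False
    then show ?thesis
      by (intro exI[of _ "(b, - a, 0)"]) (auto simp: l zero_set_def lin_eval_def zero_vec3)
  qed
qed

section \<open>Jacobian syzygies as derivations tangent to the lines\<close>

lemma lin_eval_along:
  "lin_eval l (x + t * a, y + t * b, z + t * c) = lin_eval l (x, y, z) + t * lin_eval l (a, b, c)"
  by (cases l) (simp add: lin_eval_def algebra_simps)

text \<open>Start from a point of \<open>l\<close> that avoids \<open>G\<close> and move it along
  \<open>l\<close> in the direction of a point off \<open>m\<close>. Each line excludes at most one
  parameter.\<close>

lemma generic_point_on_line:
  assumes "finite G" "\<And>m. m \<in> G \<Longrightarrow> cross l m \<noteq> 0"
  shows "\<exists>w. lin_eval l w = 0 \<and> (\<forall>m\<in>G. lin_eval m w \<noteq> 0)"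
  using assms
proof (induction G rule: finite_induct)
  case empty
  show ?case by (intro exI[of _ 0]) simp
next
  case (insert m G)
  have "\<exists>w. lin_eval l w = 0 \<and> (\<forall>m\<in>G. lin_eval m w \<noteq> 0)"
    by (rule insert.IH) (rule insert.prems, simp)
  then obtain w where w: "lin_eval l w = 0" "\<forall>m\<in>G. lin_eval m w \<noteq> 0" by (elim exE conjE)
  have "\<not> zero_set l \<subseteq> zero_set m"
    using zero_set_subset_imp_cross[of l m] insert.prems[of m] by blast
  then obtain u where u: "lin_eval l u = 0" "lin_eval m u \<noteq> 0" unfolding zero_set_def by blast
  obtain w1 w2 w3 u1 u2 u3 where wu: "w = (w1, w2, w3)" "u = (u1, u2, u3)"
    by (cases w; cases u) auto
  let ?S = "insert 0 ((\<lambda>n. - lin_eval n w / lin_eval n u) ` insert m G)"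
  have fin: "finite ?S" using insert.hyps(1) by simp
  obtain t where t: "t \<notin> ?S" using ex_new_if_finite[OF infinite_UNIV_char_0 fin] ..
  let ?v = "(w1 + t * u1, w2 + t * u2, w3 + t * u3)"
  have ev: "lin_eval n ?v = lin_eval n w + t * lin_eval n u" for n
    by (simp add: lin_eval_along wu)
  have "lin_eval n ?v \<noteq> 0" if n: "n \<in> insert m G" for n
  proof
    assume "lin_eval n ?v = 0"
    then have *: "t * lin_eval n u = - lin_eval n w"
      using ev[of n] by (simp add: eq_neg_iff_add_eq_0 add.commute)
    show False
    proof (cases "lin_eval n u = 0")
      case True
      then have "lin_eval n w = 0" "n \<noteq> m" using * u(2) by auto
      then show ?thesis using w(2) n by simp
    next
      case False
      then have "t = - lin_eval n w / lin_eval n u" using * by (simp add: field_simps)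
      then have "t \<in> (\<lambda>n. - lin_eval n w / lin_eval n u) ` insert m G" using n by (rule image_eqI)
      then show ?thesis using t by simp
    qed
  qed
  moreover have "lin_eval l ?v = 0" using ev[of l] w(1) u(1) by simp
  ultimately show ?case by (intro exI[of _ ?v] conjI ballI)
qed

text \<open>At points of \<open>l\<close> on no other line, the expansion of the syzygy has one
  summand, whose product factor is nonzero. The remaining points of \<open>l\<close> follow because
  a polynomial vanishing at cofinitely many parameters of a line vanishes on it.\<close>

lemma syzygy_tangent:
  assumes F: "finite F" "l \<in> F" "\<And>m. m \<in> F - {l} \<Longrightarrow> cross l m \<noteq> 0"
    and syz: "a * deriv_x (def_poly F) + b * deriv_y (def_poly F) + c * deriv_z (def_poly F) = 0"
    and v: "lin_eval l v = 0"
  shows "lin_eval l (poly_eval a v, poly_eval b v, poly_eval c v) = 0"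
proof -
  obtain p q r where l: "l = (p, q, r)" by (cases l) auto
  let ?P = "pconst p * a + pconst q * b + pconst r * c"
  have P: "poly_eval ?P v = lin_eval l (poly_eval a v, poly_eval b v, poly_eval c v)" for v
    by (simp add: l lin_eval_def)
  have zero: "poly_eval ?P v = 0" if "lin_eval l v = 0" "\<forall>m\<in>F - {l}. lin_eval m v \<noteq> 0" for v
  proof -
    let ?T = "(poly_eval a v, poly_eval b v, poly_eval c v)"
    have "0 = poly_eval (a * deriv_x (def_poly F) + b * deriv_y (def_poly F) + c * deriv_z (def_poly F)) v"
      by (simp only: syz poly_eval_zero)
    also have "\<dots> = (\<Sum>n\<in>F. lin_eval n ?T * (\<Prod>m\<in>F - {n}. lin_eval m v))"
      by (simp add: syzygy_eval_def_poly[OF F(1)])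
    also have "\<dots> = lin_eval l ?T * (\<Prod>m\<in>F - {l}. lin_eval m v)"
    proof -
      have "lin_eval n ?T * (\<Prod>m\<in>F - {n}. lin_eval m v) = 0" if n: "n \<in> F - {l}" for n
      proof -
        have "(\<Prod>m\<in>F - {n}. lin_eval m v) = 0"
          using F(1,2) n \<open>lin_eval l v = 0\<close> by (intro prod_zero) auto
        then show ?thesis by simp
      qed
      then have "(\<Sum>n\<in>F - {l}. lin_eval n ?T * (\<Prod>m\<in>F - {n}. lin_eval m v)) = 0"
        by (intro sum.neutral ballI)
      then show ?thesis by (subst sum.remove[OF F(1,2)]) simp
    qed
    finally show ?thesis using that(2) F(1) P by auto
  qed
  obtain w where w: "lin_eval l w = 0" "\<forall>m\<in>F - {l}. lin_eval m w \<noteq> 0"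
    using generic_point_on_line[of "F - {l}" l] F by auto
  obtain x y z u1 u2 u3 where vw: "v = (x, y, z)" "w = (u1, u2, u3)" by (cases v; cases w) auto
  have "poly_eval ?P (x, y, z) = 0"
  proof (rule poly_eval_zero_cofinite_line)
    show "finite ((\<lambda>m. - lin_eval m v / lin_eval m w) ` (F - {l}))" using F(1) by simp
    fix t assume t: "t \<notin> (\<lambda>m. - lin_eval m v / lin_eval m w) ` (F - {l})"
    show "poly_eval ?P (x + t * u1, y + t * u2, z + t * u3) = 0"
    proof (rule zero)
      show "lin_eval l (x + t * u1, y + t * u2, z + t * u3) = 0"
        using v w(1) by (simp add: lin_eval_along vw)
      show "\<forall>m\<in>F - {l}. lin_eval m (x + t * u1, y + t * u2, z + t * u3) \<noteq> 0"
      proof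
        fix m assume m: "m \<in> F - {l}"
        then have "t \<noteq> - lin_eval m v / lin_eval m w" using t by blast
        then show "lin_eval m (x + t * u1, y + t * u2, z + t * u3) \<noteq> 0"
          using w(2) m by (auto simp: lin_eval_along vw field_simps eq_neg_iff_add_eq_0)
      qed
    qed
  qed
  then show ?thesis using P vw(1) by simp
qed

text \<open>With cofactors \<open>h l\<close>, the derivation maps the product of the linear forms
  to the sum of the cofactors times that product.\<close>

lemma tangent_imp_syzygy:
  assumes F: "finite F"
    and tan: "\<And>l v. l \<in> F \<Longrightarrow> lin_eval l (poly_eval a v, poly_eval b v, poly_eval c v) = lin_eval l v * h l v"
    and sum: "\<And>v. (\<Sum>l\<in>F. h l v) = 0"
  shows "a * deriv_x (def_poly F) + b * deriv_y (def_poly F) + c * deriv_z (def_poly F) = 0"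
proof (rule poly_eval_eq_zero_imp)
  fix v
  have "poly_eval (a * deriv_x (def_poly F) + b * deriv_y (def_poly F) + c * deriv_z (def_poly F)) v
     = (\<Sum>l\<in>F. lin_eval l v * h l v * (\<Prod>m\<in>F - {l}. lin_eval m v))"
    by (simp add: syzygy_eval_def_poly[OF F] tan)
  also have "\<dots> = (\<Sum>l\<in>F. h l v * (\<Prod>m\<in>F. lin_eval m v))"
    by (rule sum.cong) (use F in \<open>auto simp: prod.remove mult_ac\<close>)
  also have "\<dots> = 0" using sum by (simp add: sum_distrib_right[symmetric])
  finally show "poly_eval (a * deriv_x (def_poly F) + b * deriv_y (def_poly F) + c * deriv_z (def_poly F)) v = 0" .
qed

section \<open>Intersection lattices in terms of vanishing determinants\<close>

definition meet :: "(nat \<Rightarrow> vec3) \<Rightarrow> nat set \<Rightarrow> vec3 set" where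
  "meet L G = \<Inter> (zero_set ` L ` G)"

lemma meet_iff: "v \<in> meet L G \<longleftrightarrow> (\<forall>k\<in>G. lin_eval (L k) v = 0)"
  by (simp add: meet_def zero_set_def)

lemma meet_antimono: "G \<subseteq> H \<Longrightarrow> meet L H \<subseteq> meet L G"
  unfolding meet_def by blast

lemma meet_le: "meet L G \<subseteq> meet L H \<longleftrightarrow> (\<forall>k\<in>H. meet L G \<subseteq> zero_set (L k))"
  unfolding meet_def by blast

locale lines =
  fixes L :: "nat \<Rightarrow> vec3" and n :: nat
  assumes nonzero: "k < n \<Longrightarrow> L k \<noteq> 0"
    and distinct: "a < n \<Longrightarrow> b < n \<Longrightarrow> a \<noteq> b \<Longrightarrow> cross (L a) (L b) \<noteq> 0"
begin

lemma inj_zero_set: "a < n \<Longrightarrow> b < n \<Longrightarrow> zero_set (L a) \<subseteq> zero_set (L b) \<Longrightarrow> a = b"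
  using zero_set_subset_imp_cross[of "L a" "L b"] distinct[of a b] by blast

lemma inj_L: "inj_on L {..<n}"
proof (rule inj_onI)
  fix a b assume "a \<in> {..<n}" "b \<in> {..<n}" "L a = L b"
  then show "a = b" using inj_zero_set[of a b] by simp
qed

lemma line_arrangement: "line_arrangement (L ` {..<n})"
  unfolding line_arrangement_def
proof (intro conjI ballI inj_onI)
  fix l m assume "l \<in> L ` {..<n}" "m \<in> L ` {..<n}" and eq: "zero_set l = zero_set m"
  then obtain a b where "l = L a" "a < n" "m = L b" "b < n" by blast
  then show "l = m" using inj_zero_set[of a b] eq by simp
qed (use nonzero in auto)

lemma card_lines: "card (L ` {..<n}) = n"
  using inj_L by (simp add: card_image)

lemma meet_point:
  assumes "a < n" "b < n" "a \<noteq> b" "lin_eval (L a) v = 0" "lin_eval (L b) v = 0"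
  shows "\<exists>c. v = smult3 c (cross (L a) (L b))"
  using meet_eq_cross[OF distinct[OF assms(1-3)] assms(4,5)] .

text \<open>Two distinct lines of \<open>G\<close> meet in one point, and the intersection is {0}
  exactly if some line of \<open>G\<close> misses it. At most one line always leaves a nonzero
  vector.\<close>

lemma meet_zero_iff:
  assumes "G \<subseteq> {..<n}"
  shows "meet L G = {0} \<longleftrightarrow> (\<exists>a\<in>G. \<exists>b\<in>G. \<exists>c\<in>G. b \<noteq> c \<and> det3 (L a) (L b) (L c) \<noteq> 0)"
proof
  assume *: "\<exists>a\<in>G. \<exists>b\<in>G. \<exists>c\<in>G. b \<noteq> c \<and> det3 (L a) (L b) (L c) \<noteq> 0"
  then obtain a b c where abc: "a \<in> G" "b \<in> G" "c \<in> G" "b \<noteq> c" "det3 (L a) (L b) (L c) \<noteq> 0" by blast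
  have "v = 0" if v: "v \<in> meet L G" for v
  proof -
    obtain s where s: "v = smult3 s (cross (L b) (L c))"
      using meet_point[of b c v] abc v assms by (auto simp: meet_iff)
    have "lin_eval (L a) v = 0" using v abc(1) by (simp add: meet_iff)
    then have "s = 0" using abc(5) by (simp add: s det3_def)
    then show ?thesis by (simp add: s smult3_def zero_vec3 split: prod.splits)
  qed
  then show "meet L G = {0}" by (auto simp: meet_iff)
next
  assume *: "meet L G = {0}"
  show "\<exists>a\<in>G. \<exists>b\<in>G. \<exists>c\<in>G. b \<noteq> c \<and> det3 (L a) (L b) (L c) \<noteq> 0"
  proof (cases "\<exists>b\<in>G. \<exists>c\<in>G. b \<noteq> c")
    case True
    then obtain b c where bc: "b \<in> G" "c \<in> G" "b \<noteq> c" by blast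
    then have "cross (L b) (L c) \<noteq> 0" using distinct assms by blast
    then have "cross (L b) (L c) \<notin> meet L G" using * by simp
    then show ?thesis using bc by (auto simp: meet_iff det3_def)
  next
    case False
    then obtain k where "G \<subseteq> {k}" by (cases "G = {}") auto
    moreover obtain v where "v \<noteq> 0" "lin_eval (L k) v = 0"
      using exists_nonzero_on_line[of "L k"] by (auto simp: zero_set_def)
    ultimately have "v \<in> meet L G" by (auto simp: meet_iff)
    then show ?thesis using * \<open>v \<noteq> 0\<close> by simp
  qed
qed

text \<open>The disjuncts are the ways to lie on line \<open>k\<close>: it belongs to the family, it
  passes through the point common to two members, or the family has no common point. Only vanishing
  of determinants enters, so the criterion transfers between arrangements.\<close>

lemma meet_subset_iff:
  assumes "G \<subseteq> {..<n}" "k < n"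
  shows "meet L G \<subseteq> zero_set (L k) \<longleftrightarrow> k \<in> G \<or>
    (\<exists>a\<in>G. \<exists>b\<in>G. a \<noteq> b \<and> det3 (L k) (L a) (L b) = 0) \<or>
    (\<exists>a\<in>G. \<exists>b\<in>G. \<exists>c\<in>G. b \<noteq> c \<and> det3 (L a) (L b) (L c) \<noteq> 0)"
    (is "_ \<longleftrightarrow> _ \<or> ?P \<or> ?Q")
proof
  assume "k \<in> G \<or> ?P \<or> ?Q"
  then consider "k \<in> G" | ?P | ?Q by blast
  then show "meet L G \<subseteq> zero_set (L k)"
  proof cases
    case 1
    then show ?thesis by (auto simp: meet_iff zero_set_def)
  next
    case 2
    then obtain a b where ab: "a \<in> G" "b \<in> G" "a \<noteq> b" "det3 (L k) (L a) (L b) = 0" by blast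
    show ?thesis
    proof
      fix v assume v: "v \<in> meet L G"
      obtain s where "v = smult3 s (cross (L a) (L b))"
        using meet_point[of a b v] ab v assms by (auto simp: meet_iff)
      then show "v \<in> zero_set (L k)" using ab(4) by (simp add: zero_set_def det3_def)
    qed
  next
    case 3
    then have "meet L G = {0}" using meet_zero_iff[OF assms(1)] by blast
    then show ?thesis by (simp add: zero_set_def)
  qed
next
  assume *: "meet L G \<subseteq> zero_set (L k)"
  show "k \<in> G \<or> ?P \<or> ?Q"
  proof (cases "\<exists>b\<in>G. \<exists>c\<in>G. b \<noteq> c")
    case True
    then obtain b c where bc: "b \<in> G" "c \<in> G" "b \<noteq> c" by blast
    show ?thesis
    proof (cases ?Q)
      case False
      then have "cross (L b) (L c) \<in> meet L G" using bc by (auto simp: meet_iff det3_def)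
      then have "det3 (L k) (L b) (L c) = 0" using * by (auto simp: zero_set_def det3_def)
      then show ?thesis using bc by blast
    qed blast
  next
    case False
    show ?thesis
    proof (cases "G = {}")
      case True
      then have "zero_set (L k) = UNIV" using * by (auto simp: meet_def)
      then show ?thesis using zero_set_zero_iff nonzero[OF assms(2)] by blast
    next
      case nonempty: False
      then obtain g where "G = {g}" using False by blast
      then have "g = k" using * inj_zero_set[of g k] assms by (simp add: meet_def)
      then show ?thesis using \<open>G = {g}\<close> by simp
    qed
  qed
qed

lemma intersection_lattice_eq:
  "intersection_lattice (L ` {..<n}) = meet L ` {G. G \<subseteq> {..<n} \<and> meet L G \<noteq> {0}}"
proof -
  have "{\<Inter> (zero_set ` G) | G. G \<subseteq> L ` {..<n} \<and> \<Inter> (zero_set ` G) \<noteq> {0}} =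
      {\<Inter> (zero_set ` L ` H) | H. H \<subseteq> {..<n} \<and> \<Inter> (zero_set ` L ` H) \<noteq> {0}}"
    unfolding subset_image_iff by blast
  then show ?thesis unfolding intersection_lattice_def meet_def by (simp only: image_Collect)
qed

text \<open>A point on at least two lines is determined by the set of lines through it.\<close>
lemma t_count_eq:
  assumes "i \<ge> 2"
  shows "t_count (L ` {..<n}) i =
    card {T. \<exists>a<n. \<exists>b<n. a \<noteq> b \<and> T = {k. k < n \<and> det3 (L k) (L a) (L b) = 0} \<and> card T = i}"
proof -
  let ?S = "\<lambda>p. {k. k < n \<and> p \<subseteq> zero_set (L k)}"
  let ?A = "{p \<in> proj_points. card {l \<in> L ` {..<n}. p \<subseteq> zero_set l} = i}"
  let ?B = "{T. \<exists>a<n. \<exists>b<n. a \<noteq> b \<and> T = {k. k < n \<and> det3 (L k) (L a) (L b) = 0} \<and> card T = i}"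
  have cardS: "card {l \<in> L ` {..<n}. p \<subseteq> zero_set l} = card (?S p)" for p
  proof -
    have "{l \<in> L ` {..<n}. p \<subseteq> zero_set l} = L ` ?S p" by auto
    then show ?thesis using card_image[OF inj_on_subset[OF inj_L, of "?S p"]] by auto
  qed
  have pt: "proj_pt v \<subseteq> zero_set l \<longleftrightarrow> lin_eval l v = 0" for v l
  proof
    assume *: "proj_pt v \<subseteq> zero_set l"
    have "v = smult3 1 v" by (simp add: smult3_def split: prod.splits)
    then have "v \<in> proj_pt v" unfolding proj_pt_def by blast
    then show "lin_eval l v = 0" using * by (auto simp: zero_set_def)
  qed (auto simp: proj_pt_def zero_set_def)
  have point: "p = proj_pt (cross (L a) (L b))"
    if pab: "p \<in> proj_points" "a < n" "b < n" "a \<noteq> b" "p \<subseteq> zero_set (L a)" "p \<subseteq> zero_set (L b)" for p a b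
  proof -
    obtain v where v: "p = proj_pt v" "v \<noteq> 0" using pab(1) unfolding proj_points_def by blast
    then obtain s where s: "v = smult3 s (cross (L a) (L b))"
      using meet_point[of a b v] pab pt by auto
    have "s \<noteq> 0" using v(2) s by (auto simp: smult3_def zero_vec3 split: prod.splits)
    then show ?thesis unfolding v(1) s by (rule proj_pt_smult3)
  qed
  \<comment> \<open>Here \<open>i \<ge> 2\<close> is used: it provides two lines whose cross product
    recovers the point.\<close>
  have two: "\<exists>a<n. \<exists>b<n. a \<noteq> b \<and> p \<subseteq> zero_set (L a) \<and> p \<subseteq> zero_set (L b)"
    if c: "card (?S p) = i" for p
  proof -
    have "\<not> card (?S p) \<le> Suc 0" using c assms by simp
    then have "\<exists>a\<in>?S p. \<exists>b\<in>?S p. a \<noteq> b"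
      by (subst (asm) card_le_Suc0_iff_eq) auto
    then show ?thesis by blast
  qed
  have "bij_betw ?S ?A ?B"
    unfolding bij_betw_def
  proof
    show "inj_on ?S ?A"
    proof (rule inj_onI)
      fix p q assume pq: "p \<in> ?A" "q \<in> ?A" "?S p = ?S q"
      obtain a b where ab: "a < n" "b < n" "a \<noteq> b" "p \<subseteq> zero_set (L a)" "p \<subseteq> zero_set (L b)"
        using two[of p] pq(1) cardS by auto
      then have "a \<in> ?S q" "b \<in> ?S q" using pq(3) by auto
      then show "p = q" using point[of p a b] point[of q a b] ab pq by auto
    qed
    show "?S ` ?A = ?B"
    proof (intro equalityI subsetI)
      fix T assume "T \<in> ?S ` ?A"
      then obtain p where p: "p \<in> proj_points" "card (?S p) = i" "T = ?S p" using cardS by auto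
      then obtain a b where ab: "a < n" "b < n" "a \<noteq> b" "p \<subseteq> zero_set (L a)" "p \<subseteq> zero_set (L b)"
        using two[of p] by auto
      have "?S p = {k. k < n \<and> det3 (L k) (L a) (L b) = 0}"
        unfolding point[OF p(1) ab] pt det3_def ..
      then show "T \<in> ?B" using p ab(1-3) by auto
    next
      fix T assume "T \<in> ?B"
      then obtain a b where ab: "a < n" "b < n" "a \<noteq> b" "card T = i"
        "T = {k. k < n \<and> det3 (L k) (L a) (L b) = 0}" by blast
      let ?p = "proj_pt (cross (L a) (L b))"
      have "?p \<in> proj_points" using distinct[OF ab(1-3)] unfolding proj_points_def by blast
      moreover have "T = ?S ?p" by (simp add: ab(5) pt det3_def)
      ultimately show "T \<in> ?S ` ?A" using ab(4) cardS by auto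
    qed
  qed
  then show ?thesis unfolding t_count_def by (rule bij_betw_same_card)
qed

end

text \<open>Inclusions between intersections are decided by vanishing determinants, so sending the
  intersection of an index set in \<open>L\<close> to the one in \<open>M\<close> is well defined
  and respects order both ways.\<close>

lemma iso_lattices_if_same_dets:
  assumes L: "lines L n" and M: "lines M n"
    and eq: "\<And>a b c. a < n \<Longrightarrow> b < n \<Longrightarrow> c < n \<Longrightarrow> det3 (L a) (L b) (L c) = 0 \<longleftrightarrow> det3 (M a) (M b) (M c) = 0"
  shows "iso_lattices (L ` {..<n}) (M ` {..<n})"
proof -
  interpret L: lines L n by (rule L)
  interpret M: lines M n by (rule M)
  have eq': "det3 (L a) (L b) (L c) = 0 \<longleftrightarrow> det3 (M a) (M b) (M c) = 0"
    if "G \<subseteq> {..<n}" "a \<in> G" "b \<in> G" "c \<in> G" for G a b c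
    using that by (intro eq) auto
  have zero: "meet L G = {0} \<longleftrightarrow> meet M G = {0}" if G: "G \<subseteq> {..<n}" for G
    unfolding L.meet_zero_iff[OF G] M.meet_zero_iff[OF G]
    by (intro bex_cong conj_cong refl) (simp add: eq'[OF G])
  have sub: "meet L G \<subseteq> zero_set (L k) \<longleftrightarrow> meet M G \<subseteq> zero_set (M k)"
    if G: "G \<subseteq> {..<n}" and k: "k < n" for G k
  proof -
    have "det3 (L k) (L a) (L b) = 0 \<longleftrightarrow> det3 (M k) (M a) (M b) = 0" if "a \<in> G" "b \<in> G" for a b
      using that G k by (intro eq) auto
    then show ?thesis
      unfolding L.meet_subset_iff[OF G k] M.meet_subset_iff[OF G k]
      by (intro bex_cong conj_cong disj_cong refl) (simp_all add: eq'[OF G])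
  qed
  have le: "meet L G \<subseteq> meet L H \<longleftrightarrow> meet M G \<subseteq> meet M H"
    if "G \<subseteq> {..<n}" "H \<subseteq> {..<n}" for G H
  proof -
    have "meet L G \<subseteq> zero_set (L k) \<longleftrightarrow> meet M G \<subseteq> zero_set (M k)" if "k \<in> H" for k
      using sub[of G k] \<open>G \<subseteq> {..<n}\<close> \<open>H \<subseteq> {..<n}\<close> that by auto
    then show ?thesis unfolding meet_le by (rule ball_cong[OF refl])
  qed
  \<comment> \<open>All lines containing \<open>X\<close> form its largest index set. Using it makes
    the map independent of how \<open>X\<close> was obtained.\<close>
  define \<phi> where "\<phi> = (\<lambda>X. meet M {k. k < n \<and> X \<subseteq> zero_set (L k)})"
  have phi: "\<phi> (meet L G) = meet M G" if G: "G \<subseteq> {..<n}" for G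
  proof -
    have "{k. k < n \<and> meet L G \<subseteq> zero_set (L k)} = {k. k < n \<and> meet M G \<subseteq> zero_set (M k)}"
      by (intro Collect_cong conj_cong refl) (rule sub[OF G])
    then have "\<phi> (meet L G) = meet M {k. k < n \<and> meet M G \<subseteq> zero_set (M k)}" by (simp add: \<phi>_def)
    also have "\<dots> = meet M G"
    proof (rule subset_antisym)
      show "meet M {k. k < n \<and> meet M G \<subseteq> zero_set (M k)} \<subseteq> meet M G"
      proof (rule meet_antimono, rule subsetI)
        fix k assume "k \<in> G"
        then have "k < n" "meet M G \<subseteq> zero_set (M k)" using G by (auto simp: meet_iff zero_set_def)
        then show "k \<in> {k. k < n \<and> meet M G \<subseteq> zero_set (M k)}" by simp
      qed
      show "meet M G \<subseteq> meet M {k. k < n \<and> meet M G \<subseteq> zero_set (M k)}"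
        unfolding meet_le by simp
    qed
    finally show ?thesis .
  qed
  let ?G = "{G. G \<subseteq> {..<n} \<and> meet L G \<noteq> {0}}"
  have lat: "intersection_lattice (L ` {..<n}) = meet L ` ?G"
    "intersection_lattice (M ` {..<n}) = meet M ` ?G"
  proof -
    have "?G = {G. G \<subseteq> {..<n} \<and> meet M G \<noteq> {0}}"
      by (intro Collect_cong conj_cong refl) (simp add: zero)
    then show "intersection_lattice (M ` {..<n}) = meet M ` ?G"
      unfolding M.intersection_lattice_eq by simp
  qed (rule L.intersection_lattice_eq)
  have bij: "bij_betw \<phi> (meet L ` ?G) (meet M ` ?G)"
    unfolding bij_betw_def
  proof
    show "inj_on \<phi> (meet L ` ?G)"
    proof (rule inj_onI)
      fix X Y assume XY: "X \<in> meet L ` ?G" "Y \<in> meet L ` ?G" "\<phi> X = \<phi> Y"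
      then obtain G H where GH: "G \<subseteq> {..<n}" "H \<subseteq> {..<n}" "X = meet L G" "Y = meet L H" by blast
      have "meet M G = meet M H" using XY(3) unfolding GH(3,4) phi[OF GH(1)] phi[OF GH(2)] .
      then show "X = Y"
        unfolding GH(3,4) using le[OF GH(1,2)] le[OF GH(2,1)] by (intro subset_antisym) simp_all
    qed
    show "\<phi> ` meet L ` ?G = meet M ` ?G" 
      unfolding image_image by (rule image_cong) (auto simp: phi)
  qed
  have ord: "\<forall>X\<in>meet L ` ?G. \<forall>Y\<in>meet L ` ?G. Y \<subseteq> X \<longleftrightarrow> \<phi> Y \<subseteq> \<phi> X"
  proof (intro ballI)
    fix X Y assume "X \<in> meet L ` ?G" "Y \<in> meet L ` ?G"
    then obtain G H where GH: "G \<subseteq> {..<n}" "H \<subseteq> {..<n}" "X = meet L G" "Y = meet L H" by blast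
    show "Y \<subseteq> X \<longleftrightarrow> \<phi> Y \<subseteq> \<phi> X" unfolding GH(3,4) phi[OF GH(1)] phi[OF GH(2)] by (rule le[OF GH(2,1)])
  qed
  show ?thesis
    unfolding iso_lattices_def lat by (rule exI[of _ \<phi>], rule conjI, rule bij, rule ord)
qed

section \<open>Explicit arrangements\<close>

definition jac :: "poly3 \<Rightarrow> nat \<Rightarrow> poly3" where
  "jac f i = [deriv_x f, deriv_y f, deriv_z f] ! i"

lemma sum_jac: "(\<Sum>i<3. a i * jac f i) = a 0 * deriv_x f + a 1 * deriv_y f + a 2 * deriv_z f"
  by (simp add: jac_def eval_nat_numeral)

lemma less_3_cases: "(i :: nat) < 3 \<Longrightarrow> i = 0 \<or> i = 1 \<or> i = 2"
  by auto

lemma jacobian_ideal_eq: "jacobian_ideal f = span_ideal 3 (jac f)"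
proof (intro equalityI subsetI)
  fix p assume "p \<in> jacobian_ideal f"
  then obtain a b c where p: "p = a * deriv_x f + b * deriv_y f + c * deriv_z f"
    unfolding jacobian_ideal_def by blast
  have "p = (\<Sum>i<3. ([a, b, c] ! i) * jac f i)" by (simp add: sum_jac p)
  then show "p \<in> span_ideal 3 (jac f)"
    unfolding span_ideal_def by (intro CollectI exI[of _ "\<lambda>i. [a, b, c] ! i"]) simp
next
  fix p assume "p \<in> span_ideal 3 (jac f)"
  then obtain a where "p = (\<Sum>i<3. a i * jac f i)" unfolding span_ideal_def by blast
  then show "p \<in> jacobian_ideal f" unfolding sum_jac jacobian_ideal_def by blast
qed

lemma homogeneous_jac: "homogeneous n f \<Longrightarrow> i < 3 \<Longrightarrow> homogeneous (n - 1) (jac f i)"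
  using less_3_cases[of i] by (auto simp: jac_def homogeneous_deriv)

text \<open>Homogeneous generators make the ideal closed under components, and their positive degree
  keeps constant terms out.\<close>

lemma span_ideal_resolution:
  assumes hom: "\<And>i. i < n \<Longrightarrow> homogeneous e (f i)" and e: "e > 0"
  shows "\<exists>D Phi. min_graded_free_res (span_ideal n f) D Phi"
proof (rule min_graded_free_res_exists)
  show "0 \<in> span_ideal n f"
    unfolding span_ideal_def by (intro CollectI exI[of _ "\<lambda>_. 0"]) simp
  show "p + q \<in> span_ideal n f" if pq: "p \<in> span_ideal n f" "q \<in> span_ideal n f" for p q
  proof -
    obtain a b where "p = (\<Sum>i<n. a i * f i)" "q = (\<Sum>i<n. b i * f i)"
      using pq unfolding span_ideal_def by blast
    then have "p + q = (\<Sum>i<n. (a i + b i) * f i)" by (simp add: distrib_right sum.distrib)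
    then show ?thesis unfolding span_ideal_def by (intro CollectI exI[of _ "\<lambda>i. a i + b i"]) simp
  qed
  show "c * p \<in> span_ideal n f" if p: "p \<in> span_ideal n f" for c p
  proof -
    obtain a where "p = (\<Sum>i<n. a i * f i)" using p unfolding span_ideal_def by blast
    then have "c * p = (\<Sum>i<n. (c * a i) * f i)" by (simp add: sum_distrib_left mult.assoc)
    then show ?thesis unfolding span_ideal_def by (intro CollectI exI[of _ "\<lambda>i. c * a i"]) simp
  qed
  show "hcomp m p \<in> span_ideal n f" if p: "p \<in> span_ideal n f" for m p
  proof -
    obtain a where "p = (\<Sum>i<n. a i * f i)" using p unfolding span_ideal_def by blast
    then have "hcomp m p = (\<Sum>i<n. hcomp m (f i * a i))" by (simp add: hcomp_sum mult.commute)
    also have "\<dots> = (\<Sum>i<n. f i * hcomp (m - e) (a i))"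
      by (intro sum.cong) (auto simp: hcomp_mult[OF hom])
    also have "\<dots> = (\<Sum>i<n. hcomp (m - e) (a i) * f i)" by (simp add: mult.commute)
    finally show ?thesis
      unfolding span_ideal_def by (intro CollectI exI[of _ "\<lambda>i. hcomp (m - e) (a i)"]) simp
  qed
  show "Poly_Mapping.lookup p 0 = 0" if p: "p \<in> span_ideal n f" for p
  proof -
    obtain a where "p = (\<Sum>i<n. a i * f i)" using p unfolding span_ideal_def by blast
    moreover have "Poly_Mapping.lookup (f i) 0 = 0" if "i < n" for i
      using hom[OF that] e unfolding homogeneous_alt by (metis mdeg_zero(1) less_irrefl of_nat_0)
    ultimately show ?thesis by (simp add: lookup_sum lookup_mult_0)
  qed
qed

section \<open>Forms that vanish on lines\<close>

lemma lin_eval_triple: "lin_eval (p, q, r) (x, y, z) = p * x + q * y + r * z"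
  by (simp add: lin_eval_def)

text \<open>Along \<open>l\<close>, in a direction on which \<open>m\<close> is nonzero, the factor
  \<open>m\<close> vanishes for one parameter only. It can therefore be cancelled, and several
  linear factors can be split off in turn.\<close>

lemma linear_factor_step:
  assumes vanish: "\<And>v. lin_eval l v = 0 \<Longrightarrow> poly_eval (lin_poly m * p) v = 0"
    and lm: "cross l m \<noteq> 0" and v: "lin_eval l v = 0"
  shows "poly_eval p v = 0"
proof -
  obtain w where w: "lin_eval l w = 0" "lin_eval m w \<noteq> 0"
    using generic_point_on_line[of "{m}" l] lm by auto
  obtain x y z a b c where vw: "v = (x, y, z)" "w = (a, b, c)" by (cases v; cases w) auto
  have "poly_eval p (x, y, z) = 0"
  proof (rule poly_eval_zero_cofinite_line)
    show "finite {- lin_eval m v / lin_eval m w}" by simp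
    fix t assume t: "t \<notin> {- lin_eval m v / lin_eval m w}"
    let ?u = "(x + t * a, y + t * b, z + t * c)"
    have "lin_eval l ?u = 0" using v w(1) by (simp add: lin_eval_along vw)
    then have "lin_eval m ?u * poly_eval p ?u = 0" using vanish[of ?u] by simp
    moreover have "lin_eval m ?u \<noteq> 0"
    proof
      assume "lin_eval m ?u = 0"
      then have "t * lin_eval m w = - lin_eval m v"
        by (simp add: lin_eval_along vw eq_neg_iff_add_eq_0 add.commute)
      then have "t = - lin_eval m v / lin_eval m w" using w(2) by (simp add: field_simps)
      then show False using t by simp
    qed
    ultimately show "poly_eval p ?u = 0" by simp
  qed
  then show ?thesis by (simp add: vw)
qed

lemma homogeneous_3_eval:
  assumes "homogeneous 3 p"
  shows "poly_eval p (x, y, z) =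
      Poly_Mapping.lookup p (3,0,0) * x ^ 3 + Poly_Mapping.lookup p (2,1,0) * x ^ 2 * y
      + Poly_Mapping.lookup p (2,0,1) * x ^ 2 * z + Poly_Mapping.lookup p (1,2,0) * x * y ^ 2
      + Poly_Mapping.lookup p (1,1,1) * x * y * z + Poly_Mapping.lookup p (1,0,2) * x * z ^ 2
      + Poly_Mapping.lookup p (0,3,0) * y ^ 3 + Poly_Mapping.lookup p (0,2,1) * y ^ 2 * z
      + Poly_Mapping.lookup p (0,1,2) * y * z ^ 2 + Poly_Mapping.lookup p (0,0,3) * z ^ 3"
proof -
  let ?S = "{(3,0,0), (2,1,0), (2,0,1), (1,2,0), (1,1,1), (1,0,2), (0,3,0), (0,2,1), (0,1,2), (0,0,3)}
    :: (nat \<times> nat \<times> nat) set"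
  have "(i, j, k) \<in> ?S" if m: "(i, j, k) \<in> Poly_Mapping.keys p" for i j k
  proof -
    have s: "i + j + k = 3" using assms m by (auto simp: homogeneous_def mdeg_def)
    then have "i = 0 \<or> i = 1 \<or> i = 2 \<or> i = 3" "j = 0 \<or> j = 1 \<or> j = 2 \<or> j = 3" by arith+
    then show ?thesis using s by (elim disjE) simp_all
  qed
  then have sub: "Poly_Mapping.keys p \<subseteq> ?S" by (metis (no_types, lifting) prod_cases3 subsetI)
  have "poly_eval p (x, y, z) = (\<Sum>m\<in>?S. Poly_Mapping.lookup p m * mon_eval m (x, y, z))"
    by (rule poly_eval_superset[OF _ sub]) simp
  then show ?thesis by (simp add: mon_eval_simp mult.assoc add.assoc)
qed

context lines
begin

lemma syzygy_tangent_line: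
  assumes k: "k < n"
    and syz: "a * deriv_x (def_poly (L ` {..<n})) + b * deriv_y (def_poly (L ` {..<n}))
      + c * deriv_z (def_poly (L ` {..<n})) = 0"
    and v: "lin_eval (L k) v = 0"
  shows "lin_eval (L k) (poly_eval a v, poly_eval b v, poly_eval c v) = 0"
proof (rule syzygy_tangent[OF _ _ _ syz v])
  fix m assume "m \<in> L ` {..<n} - {L k}"
  then obtain j where "j < n" "m = L j" "j \<noteq> k" by blast
  then show "cross (L k) m \<noteq> 0" using distinct[of k j] k by simp
qed (use k in auto)

text \<open>A syzygy with constant coefficients is a constant vector tangent to all lines. It lies
  in all of the planes, and three of them already meet in 0 only.\<close>

lemma jac_independent:
  assumes tri: "i < n" "j < n" "k < n" "det3 (L i) (L j) (L k) \<noteq> 0"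
  shows "\<forall>a. (\<Sum>i<3. pconst (a i) * jac (def_poly (L ` {..<n})) i) = 0 \<longrightarrow> (\<forall>i<3. a i = 0)"
proof (intro allI impI)
  fix a :: "nat \<Rightarrow> complex" and i' :: nat
  assume *: "(\<Sum>i<3. pconst (a i) * jac (def_poly (L ` {..<n})) i) = 0" and i': "i' < 3"
  let ?v = "(a 0, a 1, a 2)"
  have on: "lin_eval (L m) ?v = 0" if "m < n" for m
    using syzygy_tangent_line[OF that *[unfolded sum_jac], of 0] by simp
  have "j \<noteq> k"
  proof
    assume "j = k"
    then have "det3 (L i) (L j) (L k) = 0"
      by (cases "L i"; cases "L k") (simp add: det3_def cross_def lin_eval_def)
    then show False using tri(4) by simp
  qed
  obtain c where c: "?v = smult3 c (cross (L j) (L k))"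
    using meet_point[OF tri(2,3) \<open>j \<noteq> k\<close> on on] tri by blast
  have "c * det3 (L i) (L j) (L k) = 0"
    using on[OF tri(1)] unfolding c by (simp add: det3_def)
  then have "c = 0" using tri(4) by simp
  then have "?v = 0" unfolding c by (simp add: smult3_def zero_vec3 split: prod.splits)
  then have "a 0 = 0" "a 1 = 0" "a 2 = 0" by (simp_all add: zero_vec3)
  then show "a i' = 0" using less_3_cases[OF i'] by auto
qed

text \<open>A tangent derivation becomes a syzygy after subtracting a multiple of the Euler derivation.\<close>
lemma syzygy_of_tangent:
  assumes hom: "homogeneous (d + 1) a" "homogeneous (d + 1) b" "homogeneous (d + 1) c"
    and tan: "\<And>k v. k < n \<Longrightarrow> lin_eval (L k) v = 0 \<Longrightarrow>
      lin_eval (L k) (poly_eval a v, poly_eval b v, poly_eval c v) = 0"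
  obtains h where "homogeneous d h"
    "(of_nat n * a - var_x * h) * deriv_x (def_poly (L ` {..<n}))
      + (of_nat n * b - var_y * h) * deriv_y (def_poly (L ` {..<n}))
      + (of_nat n * c - var_z * h) * deriv_z (def_poly (L ` {..<n})) = 0"
proof -
  have "\<exists>q. homogeneous d q \<and> (\<forall>v. lin_eval (L k) (poly_eval a v, poly_eval b v, poly_eval c v) =
      lin_eval (L k) v * poly_eval q v)" if k: "k < n" for k
  proof -
    obtain p q r where l: "L k = (p, q, r)" by (cases "L k") auto
    let ?P = "pconst p * a + pconst q * b + pconst r * c"
    have ev: "poly_eval ?P v = lin_eval (L k) (poly_eval a v, poly_eval b v, poly_eval c v)" for v
      by (simp add: l lin_eval_def)
    have "homogeneous (0 + (d + 1)) ?P"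
      by (intro homogeneous_add homogeneous_mult homogeneous_const hom)
    then have "homogeneous (d + 1) ?P" by simp
    moreover have "poly_eval ?P v = 0" if "lin_eval (L k) v = 0" for v
      unfolding ev by (rule tan[OF k that])
    ultimately obtain q where q: "?P = lin_poly (L k) * q" "homogeneous (d + 1 - 1) q"
      using lin_poly_dvd_homogeneous[OF nonzero[OF k], of ?P "d + 1"] by blast
    have "lin_eval (L k) (poly_eval a v, poly_eval b v, poly_eval c v) =
      lin_eval (L k) v * poly_eval q v" for v
      unfolding ev[symmetric] q(1) by simp
    then show ?thesis using q(2) by (intro exI[of _ q]) simp
  qed
  then have "\<exists>q. \<forall>k\<in>{..<n}. homogeneous d (q k) \<and>
      (\<forall>v. lin_eval (L k) (poly_eval a v, poly_eval b v, poly_eval c v) = lin_eval (L k) v * poly_eval (q k) v)"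
    by (intro bchoice) auto
  then obtain q where q': "\<forall>k\<in>{..<n}. homogeneous d (q k) \<and>
      (\<forall>v. lin_eval (L k) (poly_eval a v, poly_eval b v, poly_eval c v) = lin_eval (L k) v * poly_eval (q k) v)"
    ..
  have q: "homogeneous d (q k)"
    "lin_eval (L k) (poly_eval a v, poly_eval b v, poly_eval c v) = lin_eval (L k) v * poly_eval (q k) v"
    if "k < n" for k v
    using bspec[OF q', of k] that by blast+
  \<comment> \<open>Scaling by \<open>n\<close> and subtracting \<open>h\<close> times the Euler
    derivation changes each cofactor \<open>q k\<close> into \<open>n * q k - h\<close>, and these
    sum to 0. The scaling avoids division.\<close>
  define h where "h = (\<Sum>k<n. q k)"
  have of_nat: "poly_eval (of_nat n) v = of_nat n" for v
    using poly_eval_single[of 0 "of_nat n" v] by (simp del: poly_eval_single)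
  let ?ix = "the_inv_into {..<n} L"
  have ix: "?ix (L k) = k" if "k < n" for k
    using the_inv_into_f_f[OF inj_L] that by simp
  show thesis
  proof (rule that)
    show "homogeneous d h" unfolding h_def by (rule homogeneous_sum) (use q in auto)
    show "(of_nat n * a - var_x * h) * deriv_x (def_poly (L ` {..<n}))
      + (of_nat n * b - var_y * h) * deriv_y (def_poly (L ` {..<n}))
      + (of_nat n * c - var_z * h) * deriv_z (def_poly (L ` {..<n})) = 0"
    proof (rule tangent_imp_syzygy[where h = "\<lambda>l v. of_nat n * poly_eval (q (?ix l)) v - poly_eval h v"])
      fix l and v :: vec3 assume "l \<in> L ` {..<n}"
      then obtain k where k: "k < n" "l = L k" by blast
      have ixk: "?ix l = k" unfolding k(2) by (rule ix[OF k(1)])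
      obtain p p' p'' where l: "L k = (p, p', p'')" by (cases "L k") auto
      obtain x y z where v: "v = (x, y, z)" by (cases v) auto
      show "lin_eval l (poly_eval (of_nat n * a - var_x * h) v, poly_eval (of_nat n * b - var_y * h) v,
          poly_eval (of_nat n * c - var_z * h) v) =
        lin_eval l v * (of_nat n * poly_eval (q (?ix l)) v - poly_eval h v)"
        using q(2)[OF k(1), of v] unfolding ixk unfolding k(2) l v
        by (simp add: lin_eval_triple of_nat) algebra
    next
      fix v
      have "(\<Sum>l\<in>L ` {..<n}. of_nat n * poly_eval (q (?ix l)) v - poly_eval h v) =
          (\<Sum>k<n. of_nat n * poly_eval (q k) v - poly_eval h v)"
        by (subst sum.reindex[OF inj_L]) (auto simp: ix intro!: sum.cong)
      also have "\<dots> = 0" by (simp add: sum_subtractf sum_distrib_left[symmetric] h_def)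
      finally show "(\<Sum>l\<in>L ` {..<n}. of_nat n * poly_eval (q (?ix l)) v - poly_eval h v) = 0" .
    qed simp
  qed
qed

end

section \<open>Integer coordinates and evaluation\<close>

definition cvec :: "int \<times> int \<times> int \<Rightarrow> vec3" where
  "cvec l = (case l of (a, b, c) \<Rightarrow> (of_int a, of_int b, of_int c))"

definition icross :: "int \<times> int \<times> int \<Rightarrow> int \<times> int \<times> int \<Rightarrow> int \<times> int \<times> int" where
  "icross l m = (case l of (a, b, c) \<Rightarrow> case m of (p, q, r) \<Rightarrow>
     (b * r - c * q, c * p - a * r, a * q - b * p))"

definition idet :: "int \<times> int \<times> int \<Rightarrow> int \<times> int \<times> int \<Rightarrow> int \<times> int \<times> int \<Rightarrow> int" where
  "idet l m n = (case l of (a, b, c) \<Rightarrow> case icross m n of (p, q, r) \<Rightarrow> a * p + b * q + c * r)"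

lemma cvec_eq_0_iff: "cvec l = 0 \<longleftrightarrow> l = (0, 0, 0)"
  by (auto simp: cvec_def zero_vec3 split: prod.splits)

lemma cross_cvec: "cross (cvec l) (cvec m) = cvec (icross l m)"
  by (simp add: cross_def cvec_def icross_def split: prod.splits)

lemma det3_cvec: "det3 (cvec l) (cvec m) (cvec n) = of_int (idet l m n)"
  unfolding det3_def cross_cvec by (simp add: idet_def cvec_def lin_eval_def split: prod.splits)

definition pairwise_distinct :: "(int \<times> int \<times> int) list \<Rightarrow> bool" where
  "pairwise_distinct xs \<longleftrightarrow> list_all (\<lambda>l. l \<noteq> (0, 0, 0)) xs \<and>
     list_all (\<lambda>i. list_all (\<lambda>j. i = j \<or> icross (xs ! i) (xs ! j) \<noteq> (0, 0, 0)) [0..<length xs]) [0..<length xs]"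

text \<open>One truth value per ordered triple, so a single list equation compares all determinants
  of two arrangements.\<close>

definition zero_dets :: "(int \<times> int \<times> int) list \<Rightarrow> bool list list list" where
  "zero_dets xs = map (\<lambda>a. map (\<lambda>b. map (\<lambda>c. idet a b c = 0) xs) xs) xs"

text \<open>One list of line indices per intersection point. Every list is an ascending filter of
  the same range, so all pairs through a point produce the same list and \<open>remdups\<close>
  keeps one.\<close>

definition flats :: "(int \<times> int \<times> int) list \<Rightarrow> nat list list" where
  "flats xs = remdups (concat (map (\<lambda>a. map (\<lambda>b. filter (\<lambda>k. idet (xs ! k) (xs ! a) (xs ! b) = 0) [0..<length xs])
     (filter (\<lambda>b. a \<noteq> b) [0..<length xs])) [0..<length xs]))"

lemma lines_cvec:
  assumes "pairwise_distinct xs"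
  shows "lines (\<lambda>k. cvec (xs ! k)) (length xs)"
proof
  fix k assume "k < length xs"
  then show "cvec (xs ! k) \<noteq> 0"
    using assms by (auto simp: pairwise_distinct_def cvec_eq_0_iff list_all_iff)
next
  fix a b assume ab: "a < length xs" "b < length xs" "a \<noteq> b"
  have B: "\<forall>i\<in>{0..<length xs}. \<forall>j\<in>{0..<length xs}. i = j \<or> icross (xs ! i) (xs ! j) \<noteq> (0, 0, 0)"
    using assms by (simp add: pairwise_distinct_def list_all_iff)
  show "cross (cvec (xs ! a)) (cvec (xs ! b)) \<noteq> 0"
    unfolding cross_cvec cvec_eq_0_iff
    using bspec[OF bspec[OF B, of a], of b] ab by simp
qed

lemma zero_dets_eq_imp:
  assumes "zero_dets xs = zero_dets ys" "length ys = length xs"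
    "a < length xs" "b < length xs" "c < length xs"
  shows "det3 (cvec (xs ! a)) (cvec (xs ! b)) (cvec (xs ! c)) = 0 \<longleftrightarrow>
    det3 (cvec (ys ! a)) (cvec (ys ! b)) (cvec (ys ! c)) = 0"
proof -
  have "zero_dets xs ! a ! b ! c = zero_dets ys ! a ! b ! c" using assms(1) by simp
  then show ?thesis using assms(2-5) by (simp add: zero_dets_def det3_cvec)
qed

lemma t_count_flats:
  assumes "pairwise_distinct xs" "i \<ge> 2"
  shows "t_count ((\<lambda>k. cvec (xs ! k)) ` {..<length xs}) i = length (filter (\<lambda>T. length T = i) (flats xs))"
proof -
  interpret lines "\<lambda>k. cvec (xs ! k)" "length xs" by (rule lines_cvec) fact
  let ?n = "length xs"
  let ?fl = "\<lambda>a b. filter (\<lambda>k. idet (xs ! k) (xs ! a) (xs ! b) = 0) [0..<?n]"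
  let ?T = "\<lambda>a b. {k. k < ?n \<and> det3 (cvec (xs ! k)) (cvec (xs ! a)) (cvec (xs ! b)) = 0}"
  have set_fl: "set (?fl a b) = ?T a b" for a b by (auto simp: det3_cvec)
  have card_fl: "card (?T a b) = length (?fl a b)" for a b
    unfolding set_fl[symmetric] by (rule distinct_card) simp
  have flats: "set (flats xs) = (\<Union>a\<in>{..<?n}. \<Union>b\<in>{..<?n} - {a}. {?fl a b})"
    unfolding flats_def by auto
  let ?F = "{T \<in> set (flats xs). length T = i}"
  have "{T. \<exists>a<?n. \<exists>b<?n. a \<noteq> b \<and> T = ?T a b \<and> card T = i} = set ` ?F"
  proof (intro equalityI subsetI)
    fix T assume "T \<in> {T. \<exists>a<?n. \<exists>b<?n. a \<noteq> b \<and> T = ?T a b \<and> card T = i}"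
    then obtain a b where ab: "a < ?n" "b < ?n" "a \<noteq> b" "T = ?T a b" "card T = i" by blast
    have "?fl a b \<in> ?F" using ab card_fl[of a b] unfolding flats by auto
    moreover have "T = set (?fl a b)" using ab(4) set_fl by simp
    ultimately show "T \<in> set ` ?F" by (rule rev_image_eqI)
  next
    fix T assume "T \<in> set ` ?F"
    then obtain a b where ab: "a < ?n" "b < ?n" "a \<noteq> b" "length (?fl a b) = i" "T = set (?fl a b)"
      unfolding flats by blast
    then have "a < ?n \<and> b < ?n \<and> a \<noteq> b \<and> T = ?T a b \<and> card T = i"
      using set_fl[of a b] card_fl[of a b] by simp
    then show "T \<in> {T. \<exists>a<?n. \<exists>b<?n. a \<noteq> b \<and> T = ?T a b \<and> card T = i}" by blast
  qed
  moreover have "inj_on set ?F"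
  proof (rule inj_onI)
    fix S T assume "S \<in> ?F" "T \<in> ?F" "set S = set T"
    then have "sorted S" "distinct S" "sorted T" "distinct T"
      unfolding flats by (auto simp: sorted_wrt_filter)
    then show "S = T" using \<open>set S = set T\<close> by (metis sorted_distinct_set_unique)
  qed
  moreover have "card ?F = length (filter (\<lambda>T. length T = i) (flats xs))"
  proof -
    have "?F = set (filter (\<lambda>T. length T = i) (flats xs))" by auto
    moreover have "distinct (filter (\<lambda>T. length T = i) (flats xs))" by (simp add: flats_def)
    ultimately show ?thesis by (simp only: distinct_card)
  qed
  ultimately show ?thesis using t_count_eq[OF assms(2)] by (simp add: card_image)
qed

text \<open>The lines are numbered so that equal indices correspond to each other under the isomorphism of
  the intersection lattices. Both arrangements were found by a computer search.\<close>
definition lines1 :: "(int \<times> int \<times> int) list" where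
  "lines1 = [(1, 0, 0), (0, 1, 0), (0, 0, 1), (1, -1, 0), (1, 1, 0), (0, 1, -1), (0, 1, 1),
     (-3, 0, 1), (-1, 0, 3), (1, -2, -1), (1, 2, -1), (1, -1, -3)]"

definition lines2 :: "(int \<times> int \<times> int) list" where
  "lines2 = [(1, 0, 0), (0, 0, 1), (0, 1, 0), (-1, 0, 3), (1, 0, 3), (0, 1, 1), (0, 1, -1),
     (2, -3, 0), (1, -1, 0), (1, -2, -1), (1, -2, 1), (1, -1, -3)]"

lemma lines_distinct: "pairwise_distinct lines1" "pairwise_distinct lines2"
  by code_simp+

lemma zero_dets_lines: "zero_dets lines1 = zero_dets lines2"
  by code_simp

lemma length_lines: "length lines1 = 12" "length lines2 = 12"
  by (simp_all add: lines1_def lines2_def)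

lemma flats_lines:
  "map (\<lambda>i. length (filter (\<lambda>T. length T = i) (flats lines1))) [2, 3, 4] = [21, 9, 3]"
  "list_all (\<lambda>T. length T \<le> 4) (flats lines1)"
  "map (\<lambda>i. length (filter (\<lambda>T. length T = i) (flats lines2))) [2, 3, 4] = [21, 9, 3]"
  "list_all (\<lambda>T. length T \<le> 4) (flats lines2)"
  by code_simp+

definition L1 :: "nat \<Rightarrow> vec3" where "L1 k = cvec (lines1 ! k)"
definition L2 :: "nat \<Rightarrow> vec3" where "L2 k = cvec (lines2 ! k)"

interpretation A1: lines L1 12
  using lines_cvec[OF lines_distinct(1)] unfolding L1_def[abs_def] length_lines .

interpretation A2: lines L2 12
  using lines_cvec[OF lines_distinct(2)] unfolding L2_def[abs_def] length_lines .

lemma t_counts: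
  "t_count (L1 ` {..<12}) 2 = 21" "t_count (L1 ` {..<12}) 3 = 9" "t_count (L1 ` {..<12}) 4 = 3"
  "i > 4 \<Longrightarrow> t_count (L1 ` {..<12}) i = 0"
  "t_count (L2 ` {..<12}) 2 = 21" "t_count (L2 ` {..<12}) 3 = 9" "t_count (L2 ` {..<12}) 4 = 3"
  "i > 4 \<Longrightarrow> t_count (L2 ` {..<12}) i = 0"
proof -
  note t1 = t_count_flats[OF lines_distinct(1), unfolded length_lines L1_def[symmetric]]
  note t2 = t_count_flats[OF lines_distinct(2), unfolded length_lines L2_def[symmetric]]
  show "t_count (L1 ` {..<12}) 2 = 21" "t_count (L1 ` {..<12}) 3 = 9" "t_count (L1 ` {..<12}) 4 = 3"
    using t1[of 2] t1[of 3] t1[of 4] flats_lines(1) by simp_all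
  show "t_count (L2 ` {..<12}) 2 = 21" "t_count (L2 ` {..<12}) 3 = 9" "t_count (L2 ` {..<12}) 4 = 3"
    using t2[of 2] t2[of 3] t2[of 4] flats_lines(3) by simp_all
  assume i: "i > 4"
  show "t_count (L1 ` {..<12}) i = 0"
    using t1[of i] i flats_lines(2) by (auto simp: list_all_iff filter_empty_conv)
  show "t_count (L2 ` {..<12}) i = 0"
    using t2[of i] i flats_lines(4) by (auto simp: list_all_iff filter_empty_conv)
qed

lemma lattices_iso: "iso_lattices (L1 ` {..<12}) (L2 ` {..<12})"
proof (rule iso_lattices_if_same_dets[OF A1.lines_axioms A2.lines_axioms])
  fix a b c :: nat assume "a < 12" "b < 12" "c < 12"
  then show "det3 (L1 a) (L1 b) (L1 c) = 0 \<longleftrightarrow> det3 (L2 a) (L2 b) (L2 c) = 0"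
    unfolding L1_def L2_def by (intro zero_dets_eq_imp zero_dets_lines) (simp_all add: length_lines)
qed

section \<open>Jacobian syzygies of degree six\<close>

text \<open>The nine linear conditions on ten coefficients are independent. Solving them for
  \<open>a9\<close> as parameter gives the explicit cubic, with 6 as common denominator.\<close>

lemma cubic_zeros_a:
  fixes g :: "complex \<Rightarrow> complex \<Rightarrow> complex \<Rightarrow> complex"
  assumes g: "\<And>x y z. g x y z = a0 * x ^ 3 + a1 * x ^ 2 * y + a2 * x ^ 2 * z + a3 * x * y ^ 2
      + a4 * x * y * z + a5 * x * z ^ 2 + a6 * y ^ 3 + a7 * y ^ 2 * z + a8 * y * z ^ 2 + a9 * z ^ 3"
    and zeros: "g 1 0 (-1) = 0" "g 1 0 1 = 0" "g 1 1 1 = 0" "g 1 1 (-1) = 0" "g 3 2 2 = 0" "g 3 2 (-2) = 0" "g 2 (-1) 1 = 0" "g 7 4 1 = 0" "g 5 2 1 = 0"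
  shows "6 * g x y z = a9 * ((2) * x ^ 3 + (-7) * x ^ 2 * y + (-6) * x ^ 2 * z + (10) * x * y ^ 2 + (15) * x * y * z + (-2) * x * z ^ 2 + (-5) * y ^ 3 + (-15) * y ^ 2 * z + (2) * y * z ^ 2 + (6) * z ^ 3)"
proof -
  have e: "a0 - a2 + a5 - a9 = 0" "a0 + a2 + a5 + a9 = 0" "a0 + a1 + a2 + a3 + a4 + a5 + a6 + a7 + a8 + a9 = 0" "a0 + a1 - a2 + a3 - a4 + a5 + a6 - a7 + a8 - a9 = 0" "27 * a0 + 18 * a1 + 18 * a2 + 12 * a3 + 12 * a4 + 12 * a5 + 8 * a6 + 8 * a7 + 8 * a8 + 8 * a9 = 0" "27 * a0 + 18 * a1 - 18 * a2 + 12 * a3 - 12 * a4 + 12 * a5 + 8 * a6 - 8 * a7 + 8 * a8 - 8 * a9 = 0" "8 * a0 - 4 * a1 + 4 * a2 + 2 * a3 - 2 * a4 + 2 * a5 - a6 + a7 - a8 + a9 = 0" "343 * a0 + 196 * a1 + 49 * a2 + 112 * a3 + 28 * a4 + 7 * a5 + 64 * a6 + 16 * a7 + 4 * a8 + a9 = 0" "125 * a0 + 50 * a1 + 25 * a2 + 20 * a3 + 10 * a4 + 5 * a5 + 8 * a6 + 4 * a7 + 2 * a8 + a9 = 0"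
    using zeros unfolding g by (simp_all add: algebra_simps)
  have c0: "6 * a0 = (2) * a9" using e by algebra
  have c1: "6 * a1 = (-7) * a9" using e by algebra
  have c2: "6 * a2 = (-6) * a9" using e by algebra
  have c3: "6 * a3 = (10) * a9" using e by algebra
  have c4: "6 * a4 = (15) * a9" using e by algebra
  have c5: "6 * a5 = (-2) * a9" using e by algebra
  have c6: "6 * a6 = (-5) * a9" using e by algebra
  have c7: "6 * a7 = (-15) * a9" using e by algebra
  have c8: "6 * a8 = (2) * a9" using e by algebra
  show ?thesis unfolding g using c0 c1 c2 c3 c4 c5 c6 c7 c8 by algebra
qed

text \<open>The same elimination for the other cubic form, now with denominator 27. Its last two
  points also occur in \<open>cubic_zeros_a\<close>.\<close>

lemma cubic_zeros_b:
  fixes g :: "complex \<Rightarrow> complex \<Rightarrow> complex \<Rightarrow> complex"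
  assumes g: "\<And>x y z. g x y z = a0 * x ^ 3 + a1 * x ^ 2 * y + a2 * x ^ 2 * z + a3 * x * y ^ 2
      + a4 * x * y * z + a5 * x * z ^ 2 + a6 * y ^ 3 + a7 * y ^ 2 * z + a8 * y * z ^ 2 + a9 * z ^ 3"
    and zeros: "g 0 1 2 = 0" "g 0 1 (-2) = 0" "g 3 3 (-1) = 0" "g 3 3 1 = 0" "g 3 2 (-1) = 0" "g 3 2 1 = 0" "g 3 6 (-1) = 0" "g 7 4 1 = 0" "g 5 2 1 = 0"
  shows "27 * g x y z = a9 * ((25) * x ^ 3 + (-85) * x ^ 2 * y + (-75) * x ^ 2 * z + (96) * x * y ^ 2 + (180) * x * y * z + (-9) * x * z ^ 2 + (-36) * y ^ 3 + (-108) * y ^ 2 * z + (9) * y * z ^ 2 + (27) * z ^ 3)"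
proof -
  have e: "a6 + 2 * a7 + 4 * a8 + 8 * a9 = 0" "a6 - 2 * a7 + 4 * a8 - 8 * a9 = 0" "27 * a0 + 27 * a1 - 9 * a2 + 27 * a3 - 9 * a4 + 3 * a5 + 27 * a6 - 9 * a7 + 3 * a8 - a9 = 0" "27 * a0 + 27 * a1 + 9 * a2 + 27 * a3 + 9 * a4 + 3 * a5 + 27 * a6 + 9 * a7 + 3 * a8 + a9 = 0" "27 * a0 + 18 * a1 - 9 * a2 + 12 * a3 - 6 * a4 + 3 * a5 + 8 * a6 - 4 * a7 + 2 * a8 - a9 = 0" "27 * a0 + 18 * a1 + 9 * a2 + 12 * a3 + 6 * a4 + 3 * a5 + 8 * a6 + 4 * a7 + 2 * a8 + a9 = 0" "27 * a0 + 54 * a1 - 9 * a2 + 108 * a3 - 18 * a4 + 3 * a5 + 216 * a6 - 36 * a7 + 6 * a8 - a9 = 0" "343 * a0 + 196 * a1 + 49 * a2 + 112 * a3 + 28 * a4 + 7 * a5 + 64 * a6 + 16 * a7 + 4 * a8 + a9 = 0" "125 * a0 + 50 * a1 + 25 * a2 + 20 * a3 + 10 * a4 + 5 * a5 + 8 * a6 + 4 * a7 + 2 * a8 + a9 = 0"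
    using zeros unfolding g by (simp_all add: algebra_simps)
  have c0: "27 * a0 = (25) * a9" using e by algebra
  have c1: "27 * a1 = (-85) * a9" using e by algebra
  have c2: "27 * a2 = (-75) * a9" using e by algebra
  have c3: "27 * a3 = (96) * a9" using e by algebra
  have c4: "27 * a4 = (180) * a9" using e by algebra
  have c5: "27 * a5 = (-9) * a9" using e by algebra
  have c6: "27 * a6 = (-36) * a9" using e by algebra
  have c7: "27 * a7 = (-108) * a9" using e by algebra
  have c8: "27 * a8 = (9) * a9" using e by algebra
  show ?thesis unfolding g using c0 c1 c2 c3 c4 c5 c6 c7 c8 by algebra
qed

lemma L1_values:
  "L1 0 = (1, 0, 0)" "L1 1 = (0, 1, 0)" "L1 2 = (0, 0, 1)" "L1 3 = (1, -1, 0)" "L1 4 = (1, 1, 0)" "L1 5 = (0, 1, -1)" "L1 6 = (0, 1, 1)" "L1 7 = (-3, 0, 1)" "L1 8 = (-1, 0, 3)" "L1 9 = (1, -2, -1)" "L1 10 = (1, 2, -1)" "L1 11 = (1, -1, -3)"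
  by (simp_all add: L1_def lines1_def cvec_def)

lemma L2_values:
  "L2 0 = (1, 0, 0)" "L2 1 = (0, 0, 1)" "L2 2 = (0, 1, 0)" "L2 3 = (-1, 0, 3)" "L2 4 = (1, 0, 3)" "L2 5 = (0, 1, 1)" "L2 6 = (0, 1, -1)" "L2 7 = (2, -3, 0)" "L2 8 = (1, -1, 0)" "L2 9 = (1, -2, -1)" "L2 10 = (1, -2, 1)" "L2 11 = (1, -1, -3)"
  by (simp_all add: L2_def lines2_def cvec_def)

text \<open>The factors are split off one at a time. Before each step, vanishing on the other lines
  has to be passed on to the quotient, which is possible for pairwise different lines.\<close>

lemma linear_factors3:
  assumes hom: "homogeneous d p" and nz: "l1 \<noteq> 0" "l2 \<noteq> 0" "l3 \<noteq> 0"
    and cr: "cross l2 l1 \<noteq> 0" "cross l3 l1 \<noteq> 0" "cross l3 l2 \<noteq> 0"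
    and van: "\<And>v. lin_eval l1 v = 0 \<Longrightarrow> poly_eval p v = 0" "\<And>v. lin_eval l2 v = 0 \<Longrightarrow> poly_eval p v = 0"
      "\<And>v. lin_eval l3 v = 0 \<Longrightarrow> poly_eval p v = 0"
  obtains q where "homogeneous (d - 3) q" "p = lin_poly l1 * (lin_poly l2 * (lin_poly l3 * q))"
proof -
  obtain q1 where q1: "p = lin_poly l1 * q1" "homogeneous (d - 1) q1"
    using lin_poly_dvd_homogeneous[OF nz(1) van(1) hom] by blast
  have v2: "poly_eval q1 v = 0" if "lin_eval l2 v = 0" for v
    by (rule linear_factor_step[OF van(2)[unfolded q1(1)] cr(1) that])
  have v3: "poly_eval q1 v = 0" if "lin_eval l3 v = 0" for v
    by (rule linear_factor_step[OF van(3)[unfolded q1(1)] cr(2) that])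
  obtain q2 where q2: "q1 = lin_poly l2 * q2" "homogeneous (d - 1 - 1) q2"
    using lin_poly_dvd_homogeneous[OF nz(2) v2 q1(2)] by blast
  have v3': "poly_eval q2 v = 0" if "lin_eval l3 v = 0" for v
    by (rule linear_factor_step[OF v3[unfolded q2(1)] cr(3) that])
  obtain q where q: "q2 = lin_poly l3 * q" "homogeneous (d - 1 - 1 - 1) q"
    using lin_poly_dvd_homogeneous[OF nz(3) v3' q2(2)] by blast
  show thesis using q(2) by (intro that[of q]) (simp_all add: q1(1) q2(1) q(1))
qed

text \<open>Modulo the Euler derivation, a syzygy is \<open>(x (9z\<^sup>2 - x\<^sup>2) A, y (y\<^sup>2 - z\<^sup>2) B, 0)\<close> with cubic forms
  \<open>A\<close>, \<open>B\<close>. Tangency at the intersection points of the remaining lines makes both vanish at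
  nine points each, which leaves a one-parameter family for each of them. The points \<open>(3 : 2 : 0)\<close> and
  \<open>(2 : 1 : 0)\<close> kill both parameters.\<close>
lemma no_syzygy_L2:
  assumes hom: "homogeneous 6 a" "homogeneous 6 b" "homogeneous 6 c"
    and syz: "a * deriv_x (def_poly (L2 ` {..<12})) + b * deriv_y (def_poly (L2 ` {..<12}))
      + c * deriv_z (def_poly (L2 ` {..<12})) = 0"
  shows "a = 0 \<and> b = 0 \<and> c = 0"
proof -
  have tan: "lin_eval (L2 k) (poly_eval a v, poly_eval b v, poly_eval c v) = 0"
    if "k < 12" "lin_eval (L2 k) v = 0" for k v
    using A2.syzygy_tangent_line[OF that(1) syz that(2)] .
  have cz: "poly_eval c v = 0" if "lin_eval (0, 0, 1) v = 0" for v
    using tan[of 1 v] that unfolding L2_values by (simp add: lin_eval_triple)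
  have "(0, 0, 1) \<noteq> (0 :: vec3)" by (simp add: zero_vec3)
  then obtain e where e: "c = lin_poly (0, 0, 1) * e" "homogeneous (6 - 1) e"
    using lin_poly_dvd_homogeneous[of "(0, 0, 1)" c 6, OF _ cz hom(3)] by blast
  define a' where "a' = a - var_x * e"
  define b' where "b' = b - var_y * e"
  have e5: "homogeneous 5 e" using e(2) by simp
  have hom': "homogeneous 6 a'" "homogeneous 6 b'"
    using homogeneous_mult[OF homogeneous_lin_poly e5, of "(1, 0, 0)"]
      homogeneous_mult[OF homogeneous_lin_poly e5, of "(0, 1, 0)"] hom
    by (auto simp: a'_def b'_def var_lin_poly intro!: homogeneous_diff)
  \<comment> \<open>The Euler derivation is tangent to every line, so subtracting its multiple by
    \<open>e\<close> keeps tangency while the last component becomes 0.\<close>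
  have key: "p * poly_eval a' (x, y, z) + q * poly_eval b' (x, y, z) = 0"
    if "k < 12" "L2 k = (p, q, r)" "p * x + q * y + r * z = 0" for k p q r x y z
    using tan[OF that(1), of "(x, y, z)"] that(3)
    unfolding that(2) a'_def b'_def e(1) var_lin_poly
    by (simp add: lin_eval_triple) algebra
  obtain A where A: "homogeneous 3 A"
    "a' = lin_poly (1, 0, 0) * (lin_poly (-1, 0, 3) * (lin_poly (1, 0, 3) * A))"
  proof (rule linear_factors3[OF hom'(1), of "(1, 0, 0)" "(-1, 0, 3)" "(1, 0, 3)"])
    show "poly_eval a' v = 0" if "lin_eval (1, 0, 0) v = 0" for v
      using key[of 0 1 0 0] that by (cases v) (simp add: L2_values lin_eval_triple)
    show "poly_eval a' v = 0" if "lin_eval (-1, 0, 3) v = 0" for v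
      using key[of 3 "-1" 0 3] that by (cases v) (simp add: L2_values lin_eval_triple)
    show "poly_eval a' v = 0" if "lin_eval (1, 0, 3) v = 0" for v
      using key[of 4 1 0 3] that by (cases v) (simp add: L2_values lin_eval_triple)
  qed (simp_all add: zero_vec3 cross_def)
  obtain B where B: "homogeneous 3 B"
    "b' = lin_poly (0, 1, 0) * (lin_poly (0, 1, 1) * (lin_poly (0, 1, -1) * B))"
  proof (rule linear_factors3[OF hom'(2), of "(0, 1, 0)" "(0, 1, 1)" "(0, 1, -1)"])
    show "poly_eval b' v = 0" if "lin_eval (0, 1, 0) v = 0" for v
      using key[of 2 0 1 0] that by (cases v) (simp add: L2_values lin_eval_triple)
    show "poly_eval b' v = 0" if "lin_eval (0, 1, 1) v = 0" for v
      using key[of 5 0 1 1] that by (cases v) (simp add: L2_values lin_eval_triple)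
    show "poly_eval b' v = 0" if "lin_eval (0, 1, -1) v = 0" for v
      using key[of 6 0 1 "-1"] that by (cases v) (simp add: L2_values lin_eval_triple)
  qed (simp_all add: zero_vec3 cross_def)
  define f where "f = (\<lambda>x y z. poly_eval A (x, y, z))"
  define g where "g = (\<lambda>x y z. poly_eval B (x, y, z))"
  have ev: "poly_eval a' (x, y, z) = x * ((- x + 3 * z) * ((x + 3 * z) * f x y z))"
    "poly_eval b' (x, y, z) = y * ((y + z) * ((y - z) * g x y z))" for x y z
    by (simp_all add: A(2) B(2) f_def g_def lin_eval_triple)
  note K7 = key[of 7 2 "-3" 0, unfolded ev, simplified L2_values, simplified]
    and K8 = key[of 8 1 "-1" 0, unfolded ev, simplified L2_values, simplified]
    and K9 = key[of 9 1 "-2" "-1", unfolded ev, simplified L2_values, simplified]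
    and K10 = key[of 10 1 "-2" 1, unfolded ev, simplified L2_values, simplified]
    and K11 = key[of 11 1 "-1" "-3", unfolded ev, simplified L2_values, simplified]
  have "- (7 * f 7 4 1) = 3 * g 7 4 1" "- (14 * f 7 4 1) = 3 * g 7 4 1"
    "- (20 * f 5 2 1) = 3 * g 5 2 1" "- (40 * f 5 2 1) = 3 * g 5 2 1"
    using K10[of 7 4 1] K11[of 7 4 1] K9[of 5 2 1] K11[of 5 2 1] by simp_all
  then have common: "f 7 4 1 = 0" "g 7 4 1 = 0" "f 5 2 1 = 0" "g 5 2 1 = 0" by algebra+
  have fz: "f 1 0 (-1) = 0" "f 1 0 1 = 0" "f 1 1 1 = 0" "f 1 1 (-1) = 0" "f 3 2 2 = 0"
    "f 3 2 (-2) = 0" "f 2 (-1) 1 = 0"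
    using K10[of 1 0 "-1"] K9[of 1 0 1] K8[of 1 1 1] K8[of 1 1 "-1"] K7[of 3 2 2] K7[of 3 2 "-2"]
      K11[of 2 "-1" 1] by simp_all
  \<comment> \<open>Likewise points with x = 0, x = 3z or x = -3z, where \<open>a'\<close> is
    0.\<close>
  have gz: "g 0 1 2 = 0" "g 0 1 (-2) = 0" "g 3 3 (-1) = 0" "g 3 3 1 = 0" "g 3 2 (-1) = 0"
    "g 3 2 1 = 0" "g 3 6 (-1) = 0"
    using K10[of 0 1 2] K9[of 0 1 "-2"] K8[of 3 3 "-1"] K8[of 3 3 1] K7[of 3 2 "-1"] K7[of 3 2 1]
      K11[of 3 6 "-1"] by simp_all
  define s where "s = Poly_Mapping.lookup A (0, 0, 3)"
  define t where "t = Poly_Mapping.lookup B (0, 0, 3)"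
  have fe: "f x y z = Poly_Mapping.lookup A (3,0,0) * x ^ 3 + Poly_Mapping.lookup A (2,1,0) * x ^ 2 * y
      + Poly_Mapping.lookup A (2,0,1) * x ^ 2 * z + Poly_Mapping.lookup A (1,2,0) * x * y ^ 2
      + Poly_Mapping.lookup A (1,1,1) * x * y * z + Poly_Mapping.lookup A (1,0,2) * x * z ^ 2
      + Poly_Mapping.lookup A (0,3,0) * y ^ 3 + Poly_Mapping.lookup A (0,2,1) * y ^ 2 * z
      + Poly_Mapping.lookup A (0,1,2) * y * z ^ 2 + Poly_Mapping.lookup A (0,0,3) * z ^ 3" for x y z
    unfolding f_def by (rule homogeneous_3_eval[OF A(1)])
  have ge: "g x y z = Poly_Mapping.lookup B (3,0,0) * x ^ 3 + Poly_Mapping.lookup B (2,1,0) * x ^ 2 * y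
      + Poly_Mapping.lookup B (2,0,1) * x ^ 2 * z + Poly_Mapping.lookup B (1,2,0) * x * y ^ 2
      + Poly_Mapping.lookup B (1,1,1) * x * y * z + Poly_Mapping.lookup B (1,0,2) * x * z ^ 2
      + Poly_Mapping.lookup B (0,3,0) * y ^ 3 + Poly_Mapping.lookup B (0,2,1) * y ^ 2 * z
      + Poly_Mapping.lookup B (0,1,2) * y * z ^ 2 + Poly_Mapping.lookup B (0,0,3) * z ^ 3" for x y z
    unfolding g_def by (rule homogeneous_3_eval[OF B(1)])
  note fs = cubic_zeros_a[of f, OF fe fz common(1,3), folded s_def]
    and gt = cubic_zeros_b[of g, OF ge gz common(2,4), folded t_def]
  have "- (9 * f 3 2 0) = 4 * g 3 2 0" "- (4 * f 2 1 0) = g 2 1 0"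
    using K7[of 3 2 0] K9[of 2 1 0] by simp_all
  moreover have "6 * f 3 2 0 = s * (8)" "6 * f 2 1 0 = s * (3)"
    "27 * g 3 2 0 = t * (9)" "27 * g 2 1 0 = t * (16)"
    using fs[of 3 2 0] fs[of 2 1 0] gt[of 3 2 0] gt[of 2 1 0] by simp_all
  ultimately have "s = 0" "t = 0" by algebra+
  then have "f x y z = 0" "g x y z = 0" for x y z using fs[of x y z] gt[of x y z] by simp_all
  then have "A = 0" "B = 0"
    by (intro poly_eval_eq_zero_imp; simp add: f_def g_def split_paired_all)+
  then have "a' = 0" "b' = 0" by (simp_all add: A(2) B(2))
  then have ab: "a = lin_poly (1, 0, 0) * e" "b = lin_poly (0, 1, 0) * e"
    by (simp_all add: a'_def b'_def var_lin_poly)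
  \<comment> \<open>What remains of the syzygy is \<open>e\<close> times the Euler derivation.
    Euler's identity turns it into 12 times \<open>e\<close> times the defining polynomial.\<close>
  let ?F = "L2 ` {..<12}"
  have "poly_eval (e * def_poly ?F) v = 0" for v
  proof -
    obtain x y z where v: "v = (x, y, z)" by (cases v) auto
    have lin: "lin_eval l (x * u, y * u, z * u) = lin_eval l v * u" for l u
      by (cases l) (simp add: lin_eval_triple v algebra_simps)
    have "0 = (\<Sum>l\<in>?F. lin_eval l (x * poly_eval e v, y * poly_eval e v, z * poly_eval e v)
        * (\<Prod>m\<in>?F - {l}. lin_eval m v))"
      using syzygy_eval_def_poly[of ?F "poly_eval a v" v "poly_eval b v" "poly_eval c v"]
        arg_cong[OF syz, of "\<lambda>p. poly_eval p v"]
      by (simp add: ab e(1) v lin_eval_triple)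
    also have "\<dots> = (\<Sum>l\<in>?F. poly_eval e v * (\<Prod>m\<in>?F. lin_eval m v))"
      unfolding lin by (rule sum.cong) (auto simp: prod.remove mult_ac)
    also have "\<dots> = 12 * poly_eval (e * def_poly ?F) v"
      using A2.card_lines by (simp add: def_poly_def)
    finally show ?thesis by simp
  qed
  then have "e * def_poly ?F = 0" by (rule poly_eval_eq_zero_imp)
  moreover have "def_poly ?F \<noteq> 0"
  proof -
    have "lin_poly l \<noteq> 0" if l: "l \<in> ?F" for l
    proof
      assume "lin_poly l = 0"
      then have "lin_eval l v = 0" for v using poly_eval_lin_poly[of l v] by simp
      then have "zero_set l = UNIV" by (auto simp: zero_set_def)
      then show False using l A2.nonzero zero_set_zero_iff by auto
    qed
    then show ?thesis by (simp add: def_poly_def)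
  qed
  ultimately have "e = 0" by simp
  then show ?thesis by (simp add: ab e(1))
qed

text \<open>The first eleven lines have a tangent derivation of degree 5 without \<open>z\<close>-component. Its
  multiple by the equation \<open>x - y - 3z\<close> of the last line is tangent to all twelve.\<close>
lemma syzygy_L1:
  obtains a b c where "homogeneous 6 a" "homogeneous 6 b" "homogeneous 6 c" "a \<noteq> 0 \<or> c \<noteq> 0"
    "a * deriv_x (def_poly (L1 ` {..<12})) + b * deriv_y (def_poly (L1 ` {..<12}))
      + c * deriv_z (def_poly (L1 ` {..<12})) = 0"
proof -
  \<comment> \<open>Q = -(z - 3x)(3z - x) + 12(y^2 - x^2). The factors x^2 - z^2 in \<open>p\<close>
    and y^2 - z^2 in \<open>q\<close> agree for x = y and x = -y, so tangency to these lines
    prescribes \<open>Q\<close> where x^2 = y^2. The coefficient 12 is then forced by the lines x -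
    2y = z and x + 2y = z.\<close>
  define Q where "Q = Poly_Mapping.single (2, 0, 0) (-15) + Poly_Mapping.single (1, 0, 1) 10
    + Poly_Mapping.single (0, 2, 0) 12 + (Poly_Mapping.single (0, 0, 2) (-3) :: poly3)"
  define p where "p = lin_poly (-1, 0, 0) * (lin_poly (-3, 0, 1) * (lin_poly (-1, 0, 3) *
    (lin_poly (1, 0, -1) * (lin_poly (1, 0, 1) * lin_poly (1, -1, -3)))))"
  define q where "q = lin_poly (0, 1, 0) * (lin_poly (0, 1, -1) * (lin_poly (0, 1, 1) *
    (lin_poly (1, -1, -3) * Q)))"
  have "homogeneous 2 Q"
    unfolding Q_def by (intro homogeneous_add) (simp_all add: homogeneous_single mdeg_def)
  then have "homogeneous (1 + (1 + (1 + (1 + 2)))) q"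
    unfolding q_def by (intro homogeneous_mult homogeneous_lin_poly)
  moreover have "homogeneous (1 + (1 + (1 + (1 + (1 + 1))))) p"
    unfolding p_def by (intro homogeneous_mult homogeneous_lin_poly)
  ultimately have hom: "homogeneous (5 + 1) p" "homogeneous (5 + 1) q" by simp_all
  have ev: "poly_eval p (x, y, z) = - x * (z - 3 * x) * (3 * z - x) * (x - z) * (x + z) * (x - y - 3 * z)"
    "poly_eval q (x, y, z) = y * (y - z) * (y + z) * (x - y - 3 * z) *
      (- 15 * x ^ 2 + 10 * x * z + 12 * y ^ 2 - 3 * z ^ 2)" for x y z
    by (simp_all add: p_def q_def Q_def lin_eval_triple mon_eval_simp algebra_simps)
  have tan: "lin_eval (L1 k) (poly_eval p v, poly_eval q v, poly_eval 0 v) = 0"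
    if "k < 12" "lin_eval (L1 k) v = 0" for k v
  proof -
    obtain x y z where v: "v = (x, y, z)" by (cases v) auto
    note on = that(2)[unfolded v]
    have "k = 0 \<or> k = 1 \<or> k = 2 \<or> k = 3 \<or> k = 4 \<or> k = 5 \<or> k = 6 \<or> k = 7 \<or> k = 8 \<or> k = 9
      \<or> k = 10 \<or> k = 11" using that(1) by arith
    then show ?thesis
    proof (elim disjE)
      assume k: "k = 0"
      have s: "x = 0" using on unfolding k L1_values lin_eval_triple by simp
      show ?thesis unfolding k v L1_values lin_eval_triple ev poly_eval_zero s by (simp; algebra?)
    next
      assume k: "k = 1"
      have s: "y = 0" using on unfolding k L1_values lin_eval_triple by simp
      show ?thesis unfolding k v L1_values lin_eval_triple ev poly_eval_zero s by (simp; algebra?)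
    next
      assume k: "k = 2"
      show ?thesis unfolding k v L1_values lin_eval_triple ev poly_eval_zero by simp
    next
      assume k: "k = 3"
      have "x - y = 0" using on unfolding k L1_values lin_eval_triple by simp
      then have s: "x = y" by algebra
      show ?thesis unfolding k v L1_values lin_eval_triple ev poly_eval_zero s by (simp; algebra?)
    next
      assume k: "k = 4"
      have "x + y = 0" using on unfolding k L1_values lin_eval_triple by simp
      then have s: "x = - y" by algebra
      show ?thesis unfolding k v L1_values lin_eval_triple ev poly_eval_zero s by (simp; algebra?)
    next
      assume k: "k = 5"
      have "y - z = 0" using on unfolding k L1_values lin_eval_triple by simp
      then have s: "y = z" by algebra
      show ?thesis unfolding k v L1_values lin_eval_triple ev poly_eval_zero s by (simp; algebra?)
    next
      assume k: "k = 6"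
      have "y + z = 0" using on unfolding k L1_values lin_eval_triple by simp
      then have s: "y = - z" by algebra
      show ?thesis unfolding k v L1_values lin_eval_triple ev poly_eval_zero s by (simp; algebra?)
    next
      assume k: "k = 7"
      have "z - 3 * x = 0" using on unfolding k L1_values lin_eval_triple by simp
      then have s: "z = 3 * x" by algebra
      show ?thesis unfolding k v L1_values lin_eval_triple ev poly_eval_zero s by (simp; algebra?)
    next
      assume k: "k = 8"
      have "3 * z - x = 0" using on unfolding k L1_values lin_eval_triple by simp
      then have s: "x = 3 * z" by algebra
      show ?thesis unfolding k v L1_values lin_eval_triple ev poly_eval_zero s by (simp; algebra?)
    next
      assume k: "k = 9"
      have "x - 2 * y - z = 0" using on unfolding k L1_values lin_eval_triple by simp
      then have s: "x = 2 * y + z" by algebra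
      show ?thesis unfolding k v L1_values lin_eval_triple ev poly_eval_zero s by (simp; algebra?)
    next
      assume k: "k = 10"
      have "x + 2 * y - z = 0" using on unfolding k L1_values lin_eval_triple by simp
      then have s: "x = z - 2 * y" by algebra
      show ?thesis unfolding k v L1_values lin_eval_triple ev poly_eval_zero s by (simp; algebra?)
    next
      assume k: "k = 11"
      have "x - y - 3 * z = 0" using on unfolding k L1_values lin_eval_triple by simp
      then have s: "x = y + 3 * z" by algebra
      show ?thesis unfolding k v L1_values lin_eval_triple ev poly_eval_zero s by (simp; algebra?)
    qed
  qed
  \<comment> \<open>The Euler correction turns the zero last component into -z h.\<close>
  obtain h where h: "homogeneous 5 h"
    "(of_nat 12 * p - var_x * h) * deriv_x (def_poly (L1 ` {..<12}))
      + (of_nat 12 * q - var_y * h) * deriv_y (def_poly (L1 ` {..<12}))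
      + (of_nat 12 * 0 - var_z * h) * deriv_z (def_poly (L1 ` {..<12})) = 0"
    by (rule A1.syzygy_of_tangent[OF hom homogeneous_zero tan])
  have m: "homogeneous 6 (of_nat 12 * r)" if "homogeneous (5 + 1) r" for r
    using homogeneous_mult[OF homogeneous_const that, of "of_nat 12"] by simp
  have vh: "homogeneous 6 (lin_poly l * h)" for l
    using homogeneous_mult[OF homogeneous_lin_poly h(1), of l] by simp
  have hom': "homogeneous 6 (of_nat 12 * p - var_x * h)" "homogeneous 6 (of_nat 12 * q - var_y * h)"
    "homogeneous 6 (of_nat 12 * 0 - var_z * h)"
    unfolding var_lin_poly
    by (rule homogeneous_diff[OF m vh], rule hom homogeneous_zero)+
  \<comment> \<open>If the first and last components vanished, \<open>h\<close> and then
    \<open>p\<close> would be 0, but \<open>p\<close> has the value -30 at (2, 0, 1).\<close>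
  have nz: "of_nat 12 * p - var_x * h \<noteq> 0 \<or> of_nat 12 * 0 - var_z * h \<noteq> 0"
  proof (rule ccontr)
    assume *: "\<not> ?thesis"
    moreover have "var_z \<noteq> 0" using poly_eval_vars(3)[of 0 0 1] by (metis poly_eval_zero zero_neq_one)
    ultimately have "h = 0" by simp
    then have "p = 0" using * by simp
    then show False using ev(1)[of 2 0 1] by simp
  qed
  show thesis by (rule that[OF hom' nz h(2)])
qed

lemma homogeneous_jac_L1: "i < 3 \<Longrightarrow> homogeneous 11 (jac (def_poly (L1 ` {..<12})) i)"
  using homogeneous_jac[OF homogeneous_def_poly, of "L1 ` {..<12}" i] A1.card_lines by simp

lemma homogeneous_jac_L2: "i < 3 \<Longrightarrow> homogeneous 11 (jac (def_poly (L2 ` {..<12})) i)"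
  using homogeneous_jac[OF homogeneous_def_poly, of "L2 ` {..<12}" i] A2.card_lines by simp

lemma jac_independent_L1:
  "\<forall>a. (\<Sum>i<3. pconst (a i) * jac (def_poly (L1 ` {..<12})) i) = 0 \<longrightarrow> (\<forall>i<3. a i = 0)"
  by (rule A1.jac_independent[of 0 1 2])
     (simp_all only: L1_values, simp_all add: det3_def cross_def lin_eval_def)

lemma jac_independent_L2:
  "\<forall>a. (\<Sum>i<3. pconst (a i) * jac (def_poly (L2 ` {..<12})) i) = 0 \<longrightarrow> (\<forall>i<3. a i = 0)"
  by (rule A2.jac_independent[of 0 1 2])
     (simp_all only: L2_values, simp_all add: det3_def cross_def lin_eval_def)

lemma graded_betti_L1_L2:
  assumes "min_graded_free_res (jacobian_ideal (def_poly (L1 ` {..<12}))) D1 Phi1"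
    and "min_graded_free_res (jacobian_ideal (def_poly (L2 ` {..<12}))) D2 Phi2"
  shows "\<exists>i j. graded_betti D1 i j \<noteq> graded_betti D2 i j"
proof -
  obtain a b c where abc: "homogeneous 6 a" "homogeneous 6 b" "homogeneous 6 c" "a \<noteq> 0 \<or> c \<noteq> 0"
    "a * deriv_x (def_poly (L1 ` {..<12})) + b * deriv_y (def_poly (L1 ` {..<12}))
      + c * deriv_z (def_poly (L1 ` {..<12})) = 0" by (rule syzygy_L1)
  let ?a = "\<lambda>i. [a, b, c] ! i"
  have "homogeneous 6 (?a i)" if "i < 3" for i
    using less_3_cases[OF that] abc(1-3) by auto
  moreover have "(\<Sum>i<3. ?a i * jac (def_poly (L1 ` {..<12})) i) = 0"
    unfolding sum_jac using abc(5) by simp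
  moreover obtain j where "j < 3" "?a j \<noteq> 0"
    using abc(4) by (metis nth_Cons_0 nth_Cons_numeral nth_Cons_Suc zero_less_numeral
        less_Suc_eq numeral_2_eq_2 numeral_3_eq_3)
  moreover have "\<forall>i<3. u i = 0"
    if u: "\<forall>i<3. homogeneous 6 (u i)" "(\<Sum>i<3. u i * jac (def_poly (L2 ` {..<12})) i) = 0" for u
  proof -
    have "u 0 = 0 \<and> u 1 = 0 \<and> u 2 = 0"
      by (rule no_syzygy_L2) (use u in \<open>simp_all add: sum_jac\<close>)
    then show ?thesis using less_3_cases by auto
  qed
  ultimately show ?thesis
    using graded_betti_differ[of 3 11 "jac (def_poly (L1 ` {..<12}))" "jac (def_poly (L2 ` {..<12}))" 6 ?a j,
        OF _ _ jac_independent_L1 jac_independent_L2 _ _ _ _ _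
          assms[unfolded jacobian_ideal_eq]]
      homogeneous_jac_L1 homogeneous_jac_L2 by blast
qed

theorem theorem5p5:
  shows "\<exists>F1 F2. line_arrangement F1 \<and> line_arrangement F2 \<and>
     card F1 = 12 \<and> card F2 = 12 \<and>
     t_count F1 2 = 21 \<and> t_count F1 3 = 9 \<and> t_count F1 4 = 3 \<and> (\<forall>i > 4. t_count F1 i = 0) \<and>
     t_count F2 2 = 21 \<and> t_count F2 3 = 9 \<and> t_count F2 4 = 3 \<and> (\<forall>i > 4. t_count F2 i = 0) \<and>
     iso_lattices F1 F2 \<and>
     (\<exists>D Phi. min_graded_free_res (jacobian_ideal (def_poly F1)) D Phi) \<and>
     (\<exists>D Phi. min_graded_free_res (jacobian_ideal (def_poly F2)) D Phi) \<and>
     (\<forall>D1 Phi1 D2 Phi2.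
        min_graded_free_res (jacobian_ideal (def_poly F1)) D1 Phi1 \<longrightarrow>
        min_graded_free_res (jacobian_ideal (def_poly F2)) D2 Phi2 \<longrightarrow>
        (\<exists>i j. graded_betti D1 i j \<noteq> graded_betti D2 i j))"
proof (rule exI[of _ "L1 ` {..<12}"], rule exI[of _ "L2 ` {..<12}"], intro conjI allI impI)
  show "\<exists>D Phi. min_graded_free_res (jacobian_ideal (def_poly (L1 ` {..<12}))) D Phi"
    unfolding jacobian_ideal_eq by (rule span_ideal_resolution[of 3 11]) (simp_all add: homogeneous_jac_L1)
  show "\<exists>D Phi. min_graded_free_res (jacobian_ideal (def_poly (L2 ` {..<12}))) D Phi"
    unfolding jacobian_ideal_eq by (rule span_ideal_resolution[of 3 11]) (simp_all add: homogeneous_jac_L2)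
qed (rule A1.line_arrangement A2.line_arrangement A1.card_lines A2.card_lines t_counts lattices_iso
    graded_betti_L1_L2; assumption?)+

end
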